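(* In the setting of the context (rank one perturbation $H=\Omega+|g\rangle\langle h|$ of the multiplication operator), let $$C_1(x)=1-\langle h|\tfrac{\mathcal{P}}{x-\Omega}|g\rangle,\qquad C_2(x)=\langle h|\delta(x-\Omega)|g\rangle .$$ Assume that $g,h$ are real and that $$|C(x\pm i0)|^2=|C_1(x)\pm i\pi C_2(x)|^2=C_1(x)^2+\pi^2C_2(x)^2\neq0\quad\text{for }x\in G_0\cap\mathbb{R}.$$ Define the following ket- and bra-vectors as functionals over $\mathcal{D}(G)$: $$A=\tfrac{\mathcal{P}}{x-\Omega}|g\rangle,\quad A'=\langle h|\tfrac{\mathcal{P}}{x-\Omega},\quad B=\delta(x-\Omega)|g\rangle,\quad B'=\langle h|\delta(x-\Omega).$$ Then for $x\in P(K)$ $$\kappa(x)=\delta(x-\Omega)+\frac{1}{C_1^2+\pi^2C_2^2}\big(AC_2A'+AC_1B'+BC_1A'-\pi^2BC_2B'\big).$$ If $C_2(x)\neq0$, this may be written $$\kappa(x)=\delta(x-\Omega)-\frac{BB'}{C_2}+\frac{(C_1B+AC_2)(C_1B'+A'C_2)}{(C_1^2+\pi^2C_2^2)C_2}=p(x)+|\alpha(x)\rangle\langle\alpha'(x)|$$ with $$p(x)=\delta(x-\Omega)-\frac{\delta(x-\Omega)|g\rangle\langle h|\delta(x-\Omega)}{\langle h|\delta(x-\Omega)|g\rangle},$$ $$|\alpha(x)\rangle=N(x)\Big(C_1(x)\delta(x-\Omega)|g\rangle+C_2(x)\tfrac{\mathcal{P}}{x-\Omega}|g\rangle\Big),\quad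 \langle\alpha'(x)|=N(x)\Big(C_1(x)\langle h|\delta(x-\Omega)+C_2(x)\langle h|\tfrac{\mathcal{P}}{x-\Omega}\Big),$$ and $N(x)^2=1/\big((C_1^2+\pi^2C_2^2)C_2\big)$.
   Context: Setting. $G\subset\mathbb{R}^n$ is open and bounded, $P:G\to\mathbb{R}$ is $C^\infty$, bounded with all its derivatives, with $\nabla P(y)\ne0$ for all $y\in G$. $V=L^2(G)$, $\langle f_1|f_2\rangle=\int\overline{f_1}f_2\,dy$, $(\Omega f)(y)=P(y)f(y)$, $R_\Omega(z)=1/(z-\Omega)$. $\mathcal{D}(\cdot)$ denotes $C^\infty$ functions with compact support in the indicated open set. $S(x)=\{y\in G:P(y)=x\}$, $d\sigma_x$ is the Euclidean surface element of $S(x)$, and $d\tau_x(y)=d\sigma_x(y)/|\nabla P(y)|$. For $f_1,f_2\in\mathcal{D}(G)$, $x\in\mathbb{R}$: $$\langle f_1|\delta(x-\Omega)|f_2\rangle=\int_{S(x)}\overline{f_1(y)}f_2(y)\,d\tau_x(y),\qquad \langle f_1|\tfrac{\mathcal{P}}{x-\Omega}|f_2\rangle=\int d\omega\,\tfrac{\mathcal{P}}{x-\omega}\int_{S(\omega)}\overline{f_1(y)}f_2(y)\,d\tau_\omega(y)$$ ($\mathcal{P}$ = Cauchy principal value). Ket-vectors are the functionals $f\mapsto\langle f|\cdots\rangle$ on $\mathcal{D}(G)$, e.g. $B$ is $f\mapsto\langle f|\delta(x-\Omega)|g\rangle$; bra-vectors are functionals $f\mapsto\langle\cdots|f\rangle$,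 e.g. $A'$ is $f\mapsto\langle h|\frac{\mathcal P}{x-\Omega}|f\rangle$. A product ket$\cdot$scalar$\cdot$bra such as $AC_2A'$ is the sesquilinear form $(f_1,f_2)\mapsto\langle f_1|A\rangle\,C_2\,\langle A'|f_2\rangle$ on $\mathcal{D}(G)$. All of $A,A',B,B',C_1,C_2$ depend on $x$. Let $g,h\in\mathcal{D}(G)$, $H=\Omega+|g\rangle\langle h|$, with resolvent $$R(z)=R_\Omega(z)+\frac{R_\Omega(z)|g\rangle\langle h|R_\Omega(z)}{C(z)},\qquad C(z)=1-\langle h|R_\Omega(z)|g\rangle ,$$ and let $K\subset G$ be compact containing the supports of $g,h$. Standing assumption: there are an open $G_1\subset\mathbb{R}$ containing $P(K)$ and an open interval $I\ni0$ such that, with $G_0=\{x+iu:x\in G_1,u\in I\}$, $C(z)$ is holomorphic and $\neq0$ in $G_0\setminus P(K)$ and $C(x\pm i0)=\lim_{u\to0\pm}C(x+iu)\neq0$ for $x\in G_0\cap\mathbb{R}$. For $x\in G_1$, $\kappa(x)$ is the sesquilinear form on $\mathcal{D}(G)$ $$\langle f_1|\kappa(x)|f_2\rangle=\frac1{2\pi i}\Big(\lim_{u\to0-}\langle f_1|R(x+iu)|f_2\rangle-\lim_{u\to0+}\langle f_1|R(x+iu)|f_2\rangle\Big).$$ It is the density, for $f_1,f_2\in\mathcal{D}(G)$, of the operator-valued distribution $\mu(x)=\frac1{2\pi i}(R(x-i0)-R(x+i0))$, for which the spectral Schwartz distribution $\frac1\pi\overline\partial R$ on $G_0$ equals $\mu(x)\delta(y)$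 at $x+iy$: $\langle f_1|\mu(\varphi)|f_2\rangle=\int dx\,\varphi(x)\langle f_1|\kappa(x)|f_2\rangle$. $N(x)$ is a (possibly non-real) square root. *)

theory Defs
  imports "HOL-Analysis.Analysis"
begin

primrec mixed_deriv ::
  "'a::real_normed_vector list \<Rightarrow> ('a \<Rightarrow> 'b::real_normed_vector) \<Rightarrow> 'a \<Rightarrow> 'b" where
  "mixed_deriv [] f = f"
| "mixed_deriv (b # bs) f = (\<lambda>y. frechet_derivative (mixed_deriv bs f) (at y) b)"

(* On an open set: all iterated partial derivatives exist and are differentiable,
   hence continuous. *)
definition smooth_on :: "'a::euclidean_space set \<Rightarrow> ('a \<Rightarrow> 'b::real_normed_vector) \<Rightarrow> bool" where
  "smooth_on S f \<longleftrightarrow>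
     (\<forall>bs\<in>lists Basis. \<forall>y\<in>S. mixed_deriv bs f differentiable (at y))"

definition grad :: "('a::euclidean_space \<Rightarrow> real) \<Rightarrow> 'a \<Rightarrow> 'a" where
  "grad P y = (\<Sum>b\<in>Basis. frechet_derivative P (at y) b *\<^sub>R b)"

(* A function with compact support in G is identified with its extension by 0 to the
   whole space. *)
definition test_functions :: "'a::euclidean_space set \<Rightarrow> ('a \<Rightarrow> complex) set" where
  "test_functions G =
     {f. smooth_on UNIV f \<and> compact (closure {y. f y \<noteq> 0}) \<and> closure {y. f y \<noteq> 0} \<subseteq> G}"


subsection \<open>Surface measure\<close>

(* (n-1)-dimensional Lebesgue measure on the coordinate hyperplane orthogonal to b, as a
   Borel measure on the ambient space; compare lborel_def.  If n = 1 it is the unit mass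
   at 0. *)
definition hyperplane_lborel :: "'a::euclidean_space \<Rightarrow> 'a measure" where
  "hyperplane_lborel b =
     distr (\<Pi>\<^sub>M i\<in>Basis - {b}. lborel) borel (\<lambda>c. \<Sum>i\<in>Basis - {b}. c i *\<^sub>R i)"

(* A piece of S that is the graph of a C^1 function phi (with gradient phi') over a
   relatively open subset U of the coordinate hyperplane orthogonal to b. *)
definition graph_patch ::
  "'a::euclidean_space set \<Rightarrow> 'a \<Rightarrow> 'a set \<Rightarrow> ('a \<Rightarrow> real) \<Rightarrow> ('a \<Rightarrow> 'a) \<Rightarrow> bool" where
  "graph_patch S b U \<phi> \<phi>' \<longleftrightarrow>
     b \<in> Basis \<and> openin (top_of_set {v. v \<bullet> b = 0}) U \<and>
     (\<forall>v\<in>U. \<phi>' v \<bullet> b = 0 \<and>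
        (\<phi> has_derivative (\<lambda>d. \<phi>' v \<bullet> d)) (at v within {v. v \<bullet> b = 0})) \<and>
     continuous_on U \<phi>' \<and>
     (\<lambda>v. v + \<phi> v *\<^sub>R b) ` U \<subseteq> S"

(* The Borel measure on S whose surface element in every graph patch is
   sqrt (1 + |grad phi|^2) dv.  It exists and is unique if S is a C^1 hypersurface
   (if n = 1, a discrete set with the counting measure). *)
definition surface_measure :: "'a::euclidean_space set \<Rightarrow> 'a measure" where
  "surface_measure S =
     (THE \<sigma>. sets \<sigma> = sets (restrict_space borel S) \<and>
        (\<forall>b U \<phi> \<phi>' E. graph_patch S b U \<phi> \<phi>' \<and> E \<in> sets borel \<and>
             E \<subseteq> (\<lambda>v. v + \<phi> v *\<^sub>R b) ` U \<longrightarrow>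
           emeasure \<sigma> E =
             (\<integral>\<^sup>+ v\<in>U. indicator E (v + \<phi> v *\<^sub>R b) * ennreal (sqrt (1 + (norm (\<phi>' v))\<^sup>2))
                \<partial>hyperplane_lborel b)))"

definition level_surface :: "'a set \<Rightarrow> ('a \<Rightarrow> real) \<Rightarrow> real \<Rightarrow> 'a set" where
  "level_surface G P x = {y \<in> G. P y = x}"

definition level_measure ::
  "'a::euclidean_space set \<Rightarrow> ('a \<Rightarrow> real) \<Rightarrow> real \<Rightarrow> 'a measure" where
  "level_measure G P x =
     density (surface_measure (level_surface G P x)) (\<lambda>y. ennreal (1 / norm (grad P y)))"


subsection \<open>Operators on square integrable functions\<close>

definition braket ::
  "'a::euclidean_space set \<Rightarrow> ('a \<Rightarrow> complex) \<Rightarrow> ('a \<Rightarrow> complex) \<Rightarrow> complex" where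
  "braket G f1 f2 = (LINT y:G|lborel. cnj (f1 y) * f2 y)"

definition square_integrable :: "'a::euclidean_space set \<Rightarrow> ('a \<Rightarrow> complex) set" where
  "square_integrable G =
     {f. set_borel_measurable lborel G f \<and> set_integrable lborel G (\<lambda>y. (cmod (f y))\<^sup>2)}"

definition mult_op :: "('a \<Rightarrow> real) \<Rightarrow> ('a \<Rightarrow> complex) \<Rightarrow> 'a \<Rightarrow> complex" where
  "mult_op P f = (\<lambda>y. of_real (P y) * f y)"

definition mult_resolvent ::
  "('a \<Rightarrow> real) \<Rightarrow> complex \<Rightarrow> ('a \<Rightarrow> complex) \<Rightarrow> 'a \<Rightarrow> complex" where
  "mult_resolvent P z f = (\<lambda>y. 1 / (z - of_real (P y)) * f y)"

definition perturbed_op ::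
  "'a::euclidean_space set \<Rightarrow> ('a \<Rightarrow> real) \<Rightarrow> ('a \<Rightarrow> complex) \<Rightarrow> ('a \<Rightarrow> complex)
     \<Rightarrow> ('a \<Rightarrow> complex) \<Rightarrow> 'a \<Rightarrow> complex" where
  "perturbed_op G P g h f = (\<lambda>y. mult_op P f y + g y * braket G h f)"

(* (z - T)^{-1} f on L^2(G).  Elements of L^2(G) are represented by functions; for z in the
   resolvent set of T the chosen representative is determined up to a null set, so its inner
   products do not depend on the choice. *)
definition resolvent ::
  "'a::euclidean_space set \<Rightarrow> (('a \<Rightarrow> complex) \<Rightarrow> 'a \<Rightarrow> complex) \<Rightarrow> complex
     \<Rightarrow> ('a \<Rightarrow> complex) \<Rightarrow> 'a \<Rightarrow> complex" where
  "resolvent G T z f =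
     (SOME u. u \<in> square_integrable G \<and> (AE y in lborel. y \<in> G \<longrightarrow> z * u y - T u y = f y))"

definition C_fun ::
  "'a::euclidean_space set \<Rightarrow> ('a \<Rightarrow> real) \<Rightarrow> ('a \<Rightarrow> complex) \<Rightarrow> ('a \<Rightarrow> complex)
     \<Rightarrow> complex \<Rightarrow> complex" where
  "C_fun G P g h z = 1 - braket G h (mult_resolvent P z g)"


subsection \<open>Sesquilinear forms on test functions\<close>

definition delta_form ::
  "'a::euclidean_space set \<Rightarrow> ('a \<Rightarrow> real) \<Rightarrow> real
     \<Rightarrow> ('a \<Rightarrow> complex) \<Rightarrow> ('a \<Rightarrow> complex) \<Rightarrow> complex" where
  "delta_form G P x f1 f2 = (LINT y|level_measure G P x. cnj (f1 y) * f2 y)"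

definition principal_value :: "real \<Rightarrow> (real \<Rightarrow> complex) \<Rightarrow> complex" where
  "principal_value x F =
     Lim (at_right 0) (\<lambda>\<epsilon>. LINT \<omega>:{\<omega>. \<epsilon> \<le> \<bar>x - \<omega>\<bar>}|lborel. F \<omega> / of_real (x - \<omega>))"

definition pv_form ::
  "'a::euclidean_space set \<Rightarrow> ('a \<Rightarrow> real) \<Rightarrow> real
     \<Rightarrow> ('a \<Rightarrow> complex) \<Rightarrow> ('a \<Rightarrow> complex) \<Rightarrow> complex" where
  "pv_form G P x f1 f2 = principal_value x (\<lambda>\<omega>. delta_form G P \<omega> f1 f2)"

definition kappa ::
  "'a::euclidean_space set \<Rightarrow> ('a \<Rightarrow> real) \<Rightarrow> ('a \<Rightarrow> complex) \<Rightarrow> ('a \<Rightarrow> complex) \<Rightarrow> real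
     \<Rightarrow> ('a \<Rightarrow> complex) \<Rightarrow> ('a \<Rightarrow> complex) \<Rightarrow> complex" where
  "kappa G P g h x f1 f2 =
     1 / (2 * of_real pi * \<i>) *
     (Lim (at_left 0)
        (\<lambda>u. braket G f1 (resolvent G (perturbed_op G P g h) (Complex x u) f2)) -
      Lim (at_right 0)
        (\<lambda>u. braket G f1 (resolvent G (perturbed_op G P g h) (Complex x u) f2)))"

definition C1 ::
  "'a::euclidean_space set \<Rightarrow> ('a \<Rightarrow> real) \<Rightarrow> ('a \<Rightarrow> complex) \<Rightarrow> ('a \<Rightarrow> complex)
     \<Rightarrow> real \<Rightarrow> complex" where
  "C1 G P g h x = 1 - pv_form G P x h g"

definition C2 ::
  "'a::euclidean_space set \<Rightarrow> ('a \<Rightarrow> real) \<Rightarrow> ('a \<Rightarrow> complex) \<Rightarrow> ('a \<Rightarrow> complex)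
     \<Rightarrow> real \<Rightarrow> complex" where
  "C2 G P g h x = delta_form G P x h g"

definition p_form ::
  "'a::euclidean_space set \<Rightarrow> ('a \<Rightarrow> real) \<Rightarrow> ('a \<Rightarrow> complex) \<Rightarrow> ('a \<Rightarrow> complex) \<Rightarrow> real
     \<Rightarrow> ('a \<Rightarrow> complex) \<Rightarrow> ('a \<Rightarrow> complex) \<Rightarrow> complex" where
  "p_form G P g h x f1 f2 =
     delta_form G P x f1 f2 -
     delta_form G P x f1 g * delta_form G P x h f2 / delta_form G P x h g"

definition alpha_ket ::
  "'a::euclidean_space set \<Rightarrow> ('a \<Rightarrow> real) \<Rightarrow> ('a \<Rightarrow> complex) \<Rightarrow> ('a \<Rightarrow> complex) \<Rightarrow> real
     \<Rightarrow> complex \<Rightarrow> ('a \<Rightarrow> complex) \<Rightarrow> complex" where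
  "alpha_ket G P g h x N f =
     N * (C1 G P g h x * delta_form G P x f g + C2 G P g h x * pv_form G P x f g)"

definition alpha_bra ::
  "'a::euclidean_space set \<Rightarrow> ('a \<Rightarrow> real) \<Rightarrow> ('a \<Rightarrow> complex) \<Rightarrow> ('a \<Rightarrow> complex) \<Rightarrow> real
     \<Rightarrow> complex \<Rightarrow> ('a \<Rightarrow> complex) \<Rightarrow> complex" where
  "alpha_bra G P g h x N f =
     N * (C1 G P g h x * delta_form G P x h f + C2 G P g h x * pv_form G P x h f)"

end

theory Submission
  imports Defs
begin

text \<open>
  By the rank one resolvent formula, \<open>\<kappa>\<close> is determined by the limits of
  \<open>\<langle>f\<^sub>1|1/(x + iu - \<Omega>)|f\<^sub>2\<rangle>\<close> as \<open>u \<rightarrow> 0\<plusminus>\<close>. The coarea formula writes this inner product as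
  \<open>\<integral> \<phi>(\<omega>) / (x + iu - \<omega>) d\<omega>\<close> with \<open>\<phi>(\<omega>) = \<langle>f\<^sub>1|\<delta>(\<omega> - \<Omega>)|f\<^sub>2\<rangle>\<close>. Since \<open>\<phi>\<close> is Lipschitz with bounded
  support, the Plemelj formula gives the limits as principal value \<open>\<minusplus> i\<pi> \<phi>(x)\<close>, and the rest is algebra.

  The surface measure is a definite description, so it has to be shown to exist and to be unique. Locally,
  replacing a coordinate \<open>y \<bullet> b\<close> with \<open>\<partial>\<^sub>b P \<noteq> 0\<close> by \<open>P y\<close> straightens the level sets. In such a chart the
  level measure of \<open>x\<close> is \<open>dv / |\<partial>\<^sub>b P|\<close> on a hyperplane, Fubini gives the coarea formula, and integrals of
  Lipschitz functions are Lipschitz in \<open>x\<close>. Countably many charts are glued.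
\<close>

subsection \<open>Lebesgue measure on coordinate hyperplanes\<close>

text \<open>The theorem concerns one fixed level \<open>x\<close>, whereas the coarea formula sees
  only almost every level. Lipschitz dependence on the level therefore does double duty: it upgrades
  almost-everywhere identities between charts to every level, and it bounds the difference quotient
  in the Plemelj formula. It also dictates the data of a chart: a lower bound for the derivative in
  direction \<open>b\<close>, so that the inverse along a line is Lipschitz, and a Lipschitz bound
  for that derivative, so that the density is Lipschitz.

  \<open>surface_measure\<close>, \<open>resolvent\<close> and \<open>Lim\<close> say nothing about
  their values until existence, and enough uniqueness, is shown. The formula for the surface measure
  ranges over all graph patches in all directions. Hence two tasks: the chart measures must satisfy
  it on patches unrelated to any chart, and the patches that charts supply must suffice to force
  uniqueness.

  The sign of \<open>u\<close> survives in the limit only through arctan(R/u), which tends to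
  \<plusminus>\<pi>/2; this is the source of every delta term in the boundary values.\<close>

lemma sets_hyperplane_lborel [simp, measurable_cong]: "sets (hyperplane_lborel b) = sets borel"
  and space_hyperplane_lborel [simp]: "space (hyperplane_lborel b) = UNIV"
  by (simp_all add: hyperplane_lborel_def)

text \<open>The measure lives on the whole space, so orthogonality to \<open>b\<close> is available
  only almost everywhere; identities between integrands on the hyperplane are proved up to this null
  set.\<close>

lemma AE_hyperplane_lborel:
  assumes b: "b \<in> Basis"
  shows "AE v in hyperplane_lborel b. v \<bullet> b = 0"
proof -
  have "(\<Sum>i\<in>Basis - {b}. c i *\<^sub>R i) \<bullet> b = 0" for c
    using b by (subst inner_sum_left) (auto simp: inner_Basis intro!: sum.neutral)
  then show ?thesis
    unfolding hyperplane_lborel_def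
    by (subst AE_distr_iff) auto
qed

text \<open>Tonelli, with the factor of \<open>b\<close> split off the product measure that
  underlies \<open>lborel\<close>.\<close>

lemma nn_integral_lborel_hyperplane:
  fixes f :: "'a::euclidean_space \<Rightarrow> ennreal"
  assumes b: "b \<in> Basis" and f [measurable]: "f \<in> borel_measurable borel"
  shows "(\<integral>\<^sup>+y. f y \<partial>lborel) = (\<integral>\<^sup>+v. \<integral>\<^sup>+s. f (v + s *\<^sub>R b) \<partial>lborel \<partial>hyperplane_lborel b)"
proof -
  let ?M = "\<Pi>\<^sub>M i\<in>Basis - {b}. (lborel :: real measure)" and ?p = "\<lambda>c. \<Sum>i\<in>Basis - {b}. c i *\<^sub>R i"
  interpret product_sigma_finite "\<lambda>_::'a. lborel :: real measure" ..
  interpret lb: sigma_finite_measure "lborel :: real measure" ..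
  have ins: "insert b (Basis - {b}) = Basis" using b by auto
  have "(\<integral>\<^sup>+y. f y \<partial>lborel) = (\<integral>\<^sup>+c. f (\<Sum>i\<in>Basis. c i *\<^sub>R i) \<partial>(\<Pi>\<^sub>M i\<in>Basis. lborel))"
    by (subst lborel_eq) (simp add: nn_integral_distr)
  also have "\<dots> = (\<integral>\<^sup>+c. f (\<Sum>i\<in>Basis. c i *\<^sub>R i) \<partial>(\<Pi>\<^sub>M i\<in>insert b (Basis - {b}). lborel))"
    by (simp only: ins)
  also have "\<dots> = (\<integral>\<^sup>+c. \<integral>\<^sup>+s. f (\<Sum>i\<in>Basis. (c(b := s)) i *\<^sub>R i) \<partial>lborel \<partial>?M)"
    by (subst product_nn_integral_insert) (auto simp: ins)
  also have "\<dots> = (\<integral>\<^sup>+c. \<integral>\<^sup>+s. f (?p c + s *\<^sub>R b) \<partial>lborel \<partial>?M)"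
  proof -
    have "(\<Sum>i\<in>Basis. (c(b := s)) i *\<^sub>R i) = ?p c + s *\<^sub>R b" for c s
      using sum.remove[OF finite_Basis b, of "\<lambda>i. (c(b := s)) i *\<^sub>R i"] by (simp add: add.commute)
    then show ?thesis by simp
  qed
  also have "\<dots> = (\<integral>\<^sup>+v. \<integral>\<^sup>+s. f (v + s *\<^sub>R b) \<partial>lborel \<partial>hyperplane_lborel b)"
    unfolding hyperplane_lborel_def by (subst nn_integral_distr) auto
  finally show ?thesis .
qed

text \<open>Thickening \<open>A\<close> by the unit interval in direction \<open>b\<close> turns
  hyperplane area into volume; the slab stays in a ball of radius \<open>R + 1\<close>, whose volume
  is finite.\<close>

lemma emeasure_hyperplane_lborel_bounded:
  fixes A :: "'a::euclidean_space set"
  assumes b: "b \<in> Basis" and A [measurable]: "A \<in> sets borel" and bd: "bounded A"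
  shows "emeasure (hyperplane_lborel b) A < \<infinity>"
proof -
  obtain R where R: "\<And>y. y \<in> A \<Longrightarrow> norm y \<le> R" using bd by (auto simp: bounded_iff)
  let ?p = "\<lambda>y. y - (y \<bullet> b) *\<^sub>R b"
  let ?f = "\<lambda>y. indicator A (?p y) * indicator {0..1} (y \<bullet> b) :: ennreal"
  have "(\<integral>\<^sup>+v. indicator A v \<partial>hyperplane_lborel b)
    = (\<integral>\<^sup>+v. \<integral>\<^sup>+s. ?f (v + s *\<^sub>R b) \<partial>lborel \<partial>hyperplane_lborel b)"
  proof (rule nn_integral_cong_AE)
    show "AE v in hyperplane_lborel b. indicator A v = (\<integral>\<^sup>+s. ?f (v + s *\<^sub>R b) \<partial>lborel)"
      using AE_hyperplane_lborel[OF b]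
    proof eventually_elim
      case (elim v)
      then have "?f (v + s *\<^sub>R b) = indicator A v * indicator {0..1} s" for s
        using b by (simp add: inner_add_left)
      then show ?case by (simp add: nn_integral_cmult)
    qed
  qed
  also have "\<dots> = (\<integral>\<^sup>+y. ?f y \<partial>lborel)"
    by (rule nn_integral_lborel_hyperplane[symmetric, OF b]) measurable
  also have "\<dots> \<le> (\<integral>\<^sup>+y. indicator (cball (0::'a) (R + 1)) y \<partial>lborel)"
  proof -
    have "norm y \<le> R + 1" if "?p y \<in> A" "0 \<le> y \<bullet> b" "y \<bullet> b \<le> 1" for y
    proof -
      have "norm y \<le> norm (?p y) + norm ((y \<bullet> b) *\<^sub>R b)"
        using norm_triangle_ineq[of "?p y" "(y \<bullet> b) *\<^sub>R b"] by simp
      then show ?thesis using R[OF that(1)] that b by simp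
    qed
    then show ?thesis
      by (intro nn_integral_mono) (auto simp: indicator_def)
  qed
  also have "\<dots> < \<infinity>" using emeasure_bounded_finite[OF bounded_cball, of "0::'a" "R + 1"] by simp
  finally show ?thesis by simp
qed

lemma sigma_finite_hyperplane_lborel:
  assumes b: "b \<in> Basis" shows "sigma_finite_measure (hyperplane_lborel b)"
proof
  show "\<exists>A. countable A \<and> A \<subseteq> sets (hyperplane_lborel b) \<and> \<Union> A = space (hyperplane_lborel b) \<and>
     (\<forall>a\<in>A. emeasure (hyperplane_lborel b) a \<noteq> \<infinity>)"
  proof (intro exI[of _ "range (\<lambda>n::nat. ball 0 (real n))"] conjI ballI)
    show "\<Union> (range (\<lambda>n::nat. ball 0 (real n))) = space (hyperplane_lborel b)"
      using reals_Archimedean2 by (auto simp: dist_norm)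
  qed (use emeasure_hyperplane_lborel_bounded[OF b] in \<open>auto simp: less_top[symmetric]\<close>)
qed

subsection \<open>Straightening charts\<close>

text \<open>\<open>e\<close> is the sign of the derivative of \<open>P\<close> in direction \<open>b\<close> on \<open>W\<close>.\<close>

locale level_chart =
  fixes P :: "'a::euclidean_space \<Rightarrow> real" and dP :: "'a \<Rightarrow> 'a"
    and W :: "'a set" and b :: 'a and e m L :: real
  assumes open_W: "open W" and convex_W: "convex W" and bounded_W: "bounded W"
    and b: "b \<in> Basis"
    and deriv: "\<And>y. y \<in> W \<Longrightarrow> (P has_derivative (\<lambda>d. dP y \<bullet> d)) (at y)"
    and cont_dP: "continuous_on W dP"
    and m_pos: "0 < m"
    and e: "\<bar>e\<bar> = 1"
    and lower: "\<And>y. y \<in> W \<Longrightarrow> m \<le> e * (dP y \<bullet> b)"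
    and L_nonneg: "0 \<le> L"
    and lip: "\<And>y y'. y \<in> W \<Longrightarrow> y' \<in> W \<Longrightarrow> \<bar>dP y \<bullet> b - dP y' \<bullet> b\<bar> \<le> L * norm (y - y')"
begin

abbreviation H :: "'a measure" where "H \<equiv> hyperplane_lborel b"

abbreviation pt :: "'a \<Rightarrow> real \<Rightarrow> 'a" where "pt v s \<equiv> v + s *\<^sub>R b"

text \<open>\<open>\<Phi>\<close> replaces the \<open>b\<close>-coordinate by the value of \<open>P\<close>, so it maps the level set of \<open>x\<close> into the
  hyperplane at height \<open>x\<close>; its Jacobian is \<open>dP y \<bullet> b\<close>. That its image is open and its inverse \<open>\<Psi>\<close>
  continuous is invariance of domain.\<close>

definition \<Phi> :: "'a \<Rightarrow> 'a" where "\<Phi> y = y + (P y - y \<bullet> b) *\<^sub>R b"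

definition \<Psi> :: "'a \<Rightarrow> 'a" where "\<Psi> = inv_into W \<Phi>"

text \<open>The Jacobian factor of \<open>\<Psi>\<close>. The default 0 confines integrals over the
  whole hyperplane to those feet above which the level is attained, so that no domain of integration
  depends on \<open>x\<close>.\<close>

definition q :: "'a \<Rightarrow> real" where
  "q w = (if w \<in> \<Phi> ` W then 1 / \<bar>dP (\<Psi> w) \<bullet> b\<bar> else 0)"

text \<open>Off the image \<open>\<Psi>\<close> is unspecified and need not be Borel. The value 0
  repairs this and does not affect integrals, because \<open>q\<close> vanishes at the same
  points.\<close>

definition \<Psi>0 :: "'a \<Rightarrow> 'a" where "\<Psi>0 w = (if w \<in> \<Phi> ` W then \<Psi> w else 0)"

text \<open>The part of the level measure of \<open>x\<close> that lies in \<open>W\<close>: the surface element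
  \<open>norm (dP y) / \<bar>dP y \<bullet> b\<bar>\<close> divided by \<open>norm (dP y)\<close>.\<close>

definition \<tau> :: "real \<Rightarrow> 'a measure" where
  "\<tau> x = distr (density H (\<lambda>v. ennreal (q (pt v x)))) borel
           (\<lambda>v. \<Psi>0 (pt v x))"

lemma bb [simp]: "b \<bullet> b = 1" "norm b = 1" using b by simp_all

section \<open>Monotonicity of P on lines in direction b\<close>

lemma e_abs: "y \<in> W \<Longrightarrow> m \<le> \<bar>dP y \<bullet> b\<bar>"
  using lower[of y] e by (cases "e = 1") (auto simp: abs_if split: if_splits)

lemma cont_P: "continuous_on W P"
  by (meson deriv has_derivative_continuous continuous_at_imp_continuous_on)

lemma deriv_line:
  assumes "pt v s \<in> W"
  shows "((\<lambda>s. P (pt v s)) has_real_derivative (dP (pt v s) \<bullet> b)) (at s within X)"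
proof -
  have "((\<lambda>s. P (pt v s)) has_derivative (\<lambda>d. dP (pt v s) \<bullet> (d *\<^sub>R b))) (at s within X)"
    by (rule has_derivative_compose[of "\<lambda>s. pt v s" "\<lambda>d. d *\<^sub>R b", OF _ deriv[OF assms]])
       (auto intro!: derivative_eq_intros)
  then show ?thesis
    by (simp add: has_field_derivative_def mult.commute[of _ "dP (pt v s) \<bullet> b"])
qed

lemma line_convex:
  assumes "pt v s \<in> W" "pt v s' \<in> W" "s \<le> t" "t \<le> s'"
  shows "pt v t \<in> W"
proof (cases "s = s'")
  case True with assms show ?thesis by simp
next
  case False
  then have "s < s'" using assms by simp
  define u where "u = (t - s) / (s' - s)"
  have "u * (s' - s) = t - s" using \<open>s < s'\<close> by (simp add: u_def)
  then have u3: "t = (1 - u) * s + u * s'" by (simp add: algebra_simps)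
  have u: "0 \<le> u" "u \<le> 1"
    using assms \<open>s < s'\<close> by (simp_all add: u_def)
  have "pt v t = (1 - u) *\<^sub>R (pt v s) + u *\<^sub>R (pt v s')"
    unfolding u3 by (simp add: algebra_simps)
  then show ?thesis
    using convexD_alt[OF convex_W assms(1,2) u(1,2)] by simp
qed

text \<open>The mean value theorem on a segment, which convexity keeps inside \<open>W\<close>. The
  gain of at least \<open>m\<close> per unit length yields injectivity, the Lipschitz constant 1/m
  of the inverse and, later, that nearby levels are attained.\<close>

lemma line_increase:
  assumes "pt v s \<in> W" "pt v s' \<in> W" "s \<le> s'"
  shows "m * (s' - s) \<le> e * (P (pt v s') - P (pt v s))"
proof (cases "s = s'")
  case False
  then have "s < s'" using assms by simp
  obtain z where z: "s < z" "z < s'"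
    "P (pt v s') - P (pt v s) = (s' - s) * (dP (pt v z) \<bullet> b)"
    using MVT2[OF \<open>s < s'\<close>, of "\<lambda>s. P (pt v s)" "\<lambda>s. dP (pt v s) \<bullet> b"]
      deriv_line line_convex[OF assms(1,2)] by force
  have "m \<le> e * (dP (pt v z) \<bullet> b)"
    by (rule lower) (use line_convex[OF assms(1,2)] z in auto)
  then have "(s' - s) * m \<le> (s' - s) * (e * (dP (pt v z) \<bullet> b))"
    using assms(3) by (intro mult_left_mono) auto
  then show ?thesis unfolding z(3) by (simp add: mult.commute mult.left_commute)
qed simp

lemma line_dist:
  assumes "pt v s \<in> W" "pt v s' \<in> W"
  shows "m * \<bar>s' - s\<bar> \<le> \<bar>P (pt v s') - P (pt v s)\<bar>"
proof -
  have *: "e * x \<le> \<bar>x\<bar>" for x using e by (metis abs_ge_self abs_mult mult_1)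
  show ?thesis
  proof (cases "s \<le> s'")
    case True
    then show ?thesis using line_increase[OF assms True] *[of "P (pt v s') - P (pt v s)"] by simp
  next
    case False
    then show ?thesis using line_increase[OF assms(2,1)] *[of "P (pt v s) - P (pt v s')"]
      by (simp add: abs_minus_commute)
  qed
qed

lemma \<Phi>_line: "v \<bullet> b = 0 \<Longrightarrow> \<Phi> (pt v s) = v + P (pt v s) *\<^sub>R b"
  by (simp add: \<Phi>_def algebra_simps)

lemma proj_orthogonal: "(y - (y \<bullet> b) *\<^sub>R b) \<bullet> b = 0"
  by (simp add: inner_diff_left)

lemma \<Phi>_b: "\<Phi> y \<bullet> b = P y"
  by (simp add: \<Phi>_def inner_add_left)

lemma \<Phi>_proj: "\<Phi> y - (\<Phi> y \<bullet> b) *\<^sub>R b = y - (y \<bullet> b) *\<^sub>R b"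
  unfolding \<Phi>_b by (simp add: \<Phi>_def algebra_simps)

text \<open>\<open>\<Phi>\<close> preserves the component orthogonal to \<open>b\<close>, so two
  points with the same image lie on one line; their common value of \<open>P\<close> then forces
  them together.\<close>

lemma inj_\<Phi>: "inj_on \<Phi> W"
proof (rule inj_onI)
  fix y y' assume yy: "y \<in> W" "y' \<in> W" "\<Phi> y = \<Phi> y'"
  define v where "v = y - (y \<bullet> b) *\<^sub>R b"
  have v': "v = y' - (y' \<bullet> b) *\<^sub>R b" using \<Phi>_proj[of y] \<Phi>_proj[of y'] yy(3) by (simp add: v_def)
  have y: "y = pt v (y \<bullet> b)" "y' = pt v (y' \<bullet> b)"
    unfolding v_def by (simp, simp add: v'[unfolded v_def])
  have "P y = P y'" using \<Phi>_b[of y] \<Phi>_b[of y'] yy(3) by simp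
  then have "m * \<bar>y' \<bullet> b - y \<bullet> b\<bar> \<le> 0"
    using line_dist[of v "y \<bullet> b" "y' \<bullet> b"] y yy by simp
  then have "y' \<bullet> b = y \<bullet> b" using m_pos by (simp add: mult_le_0_iff)
  then show "y = y'" using y by metis
qed

lemma cont_\<Phi>: "continuous_on W \<Phi>"
  unfolding \<Phi>_def by (intro continuous_intros cont_P)

lemma open_\<Phi>W: "open (\<Phi> ` W)"
  by (rule invariance_of_domain[OF cont_\<Phi> open_W inj_\<Phi>])

lemma \<Psi>_\<Phi> [simp]: "y \<in> W \<Longrightarrow> \<Psi> (\<Phi> y) = y"
  by (simp add: \<Psi>_def inj_\<Phi>)

lemma \<Psi>_in: "w \<in> \<Phi> ` W \<Longrightarrow> \<Psi> w \<in> W"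
  by auto

lemma \<Phi>_\<Psi> [simp]: "w \<in> \<Phi> ` W \<Longrightarrow> \<Phi> (\<Psi> w) = w"
  by auto

lemma cont_\<Psi>: "continuous_on (\<Phi> ` W) \<Psi>"
proof -
  obtain g where g: "homeomorphism W (\<Phi> ` W) \<Phi> g"
    using invariance_of_domain_homeomorphism[OF open_W cont_\<Phi> _ inj_\<Phi>] by auto
  have "continuous_on (\<Phi> ` W) g" using g by (simp add: homeomorphism_def)
  moreover have "g w = \<Psi> w" if "w \<in> \<Phi> ` W" for w
    using that g by (auto simp: homeomorphism_def)
  ultimately show ?thesis by (simp cong: continuous_on_cong)
qed

lemma P_\<Psi>: "w \<in> \<Phi> ` W \<Longrightarrow> P (\<Psi> w) = w \<bullet> b"
  by (metis \<Phi>_\<Psi> \<Phi>_b)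

lemma \<Psi>_line:
  assumes "v \<bullet> b = 0" "pt v x \<in> \<Phi> ` W"
  shows "\<Psi> (pt v x) = v + (\<Psi> (pt v x) \<bullet> b) *\<^sub>R b" "P (\<Psi> (pt v x)) = x"
proof -
  let ?w = "pt v x"
  have "?w - (?w \<bullet> b) *\<^sub>R b = \<Psi> ?w - (\<Psi> ?w \<bullet> b) *\<^sub>R b"
    using \<Phi>_proj[of "\<Psi> ?w"] assms(2) by simp
  moreover have "?w \<bullet> b = x" using assms(1) by (simp add: inner_add_left)
  ultimately show "\<Psi> (pt v x) = v + (\<Psi> (pt v x) \<bullet> b) *\<^sub>R b"
    by (simp add: algebra_simps)
  show "P (\<Psi> ?w) = x" using P_\<Psi>[OF assms(2)] assms(1) by (simp add: inner_add_left)
qed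

lemma in_\<Phi>W_line:
  "v \<bullet> b = 0 \<Longrightarrow> v + x *\<^sub>R b \<in> \<Phi> ` W \<longleftrightarrow> (\<exists>s. pt v s \<in> W \<and> P (pt v s) = x)"
  (is "_ \<Longrightarrow> ?l = ?r")
proof
  assume "v \<bullet> b = 0" ?l
  then show ?r using \<Psi>_line[of v x] \<Psi>_in[of "pt v x"] by metis
next
  assume "v \<bullet> b = 0" ?r
  then show ?l by (metis \<Phi>_line image_eqI)
qed

section \<open>Measurability, and integration against the chart measures\<close>

lemma q_nonneg [simp]: "0 \<le> q w" by (simp add: q_def)

lemma q_le: "q w \<le> 1 / m"
  using e_abs[OF \<Psi>_in, of w] m_pos by (auto simp: q_def intro!: divide_left_mono)

lemma borel_\<Psi>0 [measurable]: "\<Psi>0 \<in> borel_measurable borel"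
proof -
  have "(\<lambda>w. indicator (\<Phi> ` W) w *\<^sub>R \<Psi> w) \<in> borel_measurable borel"
    by (rule borel_measurable_continuous_on_indicator) (use open_\<Phi>W cont_\<Psi> in auto)
  moreover have "(\<lambda>w. indicator (\<Phi> ` W) w *\<^sub>R \<Psi> w) = \<Psi>0"
    by (auto simp: \<Psi>0_def fun_eq_iff)
  ultimately show ?thesis by simp
qed

lemma borel_q [measurable]: "q \<in> borel_measurable borel"
proof -
  have "continuous_on (\<Phi> ` W) (\<lambda>w. 1 / \<bar>dP (\<Psi> w) \<bullet> b\<bar>)"
    using e_abs[OF \<Psi>_in] m_pos
    by (intro continuous_intros continuous_on_compose2[OF cont_dP cont_\<Psi>]) fastforce+
  then have "(\<lambda>w. indicator (\<Phi> ` W) w *\<^sub>R (1 / \<bar>dP (\<Psi> w) \<bullet> b\<bar>)) \<in> borel_measurable borel"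
    by (intro borel_measurable_continuous_on_indicator) (use open_\<Phi>W in auto)
  moreover have "(\<lambda>w. indicator (\<Phi> ` W) w *\<^sub>R (1 / \<bar>dP (\<Psi> w) \<bullet> b\<bar>)) = q"
    by (auto simp: q_def fun_eq_iff)
  ultimately show ?thesis by (simp only:)
qed

lemma sets_\<tau> [simp, measurable_cong]: "sets (\<tau> x) = sets borel" and space_\<tau> [simp]: "space (\<tau> x) = UNIV"
  by (simp_all add: \<tau>_def)

lemma nn_integral_\<tau>:
  assumes [measurable]: "f \<in> borel_measurable borel"
  shows "(\<integral>\<^sup>+y. f y \<partial>\<tau> x) = (\<integral>\<^sup>+v. ennreal (q (pt v x)) * f (\<Psi>0 (pt v x)) \<partial>H)"
  unfolding \<tau>_def by (simp add: nn_integral_distr nn_integral_density)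

lemma integral_\<tau>:
  fixes f :: "'a \<Rightarrow> 'c::{banach,second_countable_topology}"
  assumes [measurable]: "f \<in> borel_measurable borel"
  shows "(\<integral>y. f y \<partial>\<tau> x) = (\<integral>v. q (pt v x) *\<^sub>R f (\<Psi>0 (pt v x)) \<partial>H)"
  unfolding \<tau>_def by (simp add: integral_distr integral_density)

lemma integrable_\<tau>_iff:
  fixes f :: "'a \<Rightarrow> 'c::{banach,second_countable_topology}"
  assumes [measurable]: "f \<in> borel_measurable borel"
  shows "integrable (\<tau> x) f \<longleftrightarrow>
    integrable H (\<lambda>v. q (pt v x) *\<^sub>R f (\<Psi>0 (pt v x)))"
  unfolding \<tau>_def by (simp add: integrable_distr_eq integrable_density)

lemma AE_\<tau>: "AE y in \<tau> x. y \<in> W \<and> P y = x"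
proof -
  have "AE v in H. 0 < ennreal (q (pt v x)) \<longrightarrow>
          \<Psi>0 (pt v x) \<in> W \<and> P (\<Psi>0 (pt v x)) = x"
    using AE_hyperplane_lborel[OF b]
  proof eventually_elim
    case (elim v)
    then show ?case using \<Psi>_line[of v x] \<Psi>_in[of "pt v x"] by (auto simp: q_def \<Psi>0_def)
  qed
  then have "AE v in density H (\<lambda>v. ennreal (q (pt v x))).
     \<Psi>0 (pt v x) \<in> W \<and> P (\<Psi>0 (pt v x)) = x"
    by (subst AE_density) auto
  \<comment> \<open>\<open>P\<close> is unrestricted outside \<open>W\<close>; the set is Borel as a
    relatively closed subset of an open set.\<close>
  moreover have "{y \<in> space borel. y \<in> W \<and> P y = x} \<in> sets borel"
  proof -
    have "closedin (top_of_set W) (W \<inter> P -` {x})"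
      by (rule continuous_closedin_preimage[OF cont_P]) simp
    then obtain T where "closed T" "W \<inter> P -` {x} = W \<inter> T" by (auto simp: closedin_closed)
    moreover have "{y \<in> space borel. y \<in> W \<and> P y = x} = W \<inter> P -` {x}" by auto
    ultimately show ?thesis using open_W by auto
  qed
  ultimately show ?thesis
    unfolding \<tau>_def by (subst AE_distr_iff) auto
qed

end

section \<open>The coarea formula in a chart\<close>

context level_chart begin

text \<open>The substitution \<omega> = \<open>P (pt v s)\<close> on one line. It is proved as
  equality of two measures, so that the change of variables theorem is applied only to sets of
  finite length, and arbitrary \<open>ennreal\<close> integrands follow without integrability
  conditions.\<close>

lemma line_substitution:
  fixes h :: "real \<Rightarrow> ennreal"
  assumes v: "v \<bullet> b = 0" and h [measurable]: "h \<in> borel_measurable borel"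
  shows "(\<integral>\<^sup>+s. indicator W (pt v s) * h s \<partial>lborel)
    = (\<integral>\<^sup>+\<omega>. ennreal (q (pt v \<omega>)) * h (\<Psi>0 (pt v \<omega>) \<bullet> b) \<partial>lborel)"
proof -
  define T where "T = {s. pt v s \<in> W}"
  define p where "p s = P (pt v s)" for s
  have "open T"
    using open_vimage[OF open_W, of "\<lambda>s. pt v s"] unfolding T_def vimage_def
    by (simp add: continuous_on_add continuous_on_scaleR)
  then have T [measurable]: "T \<in> sets borel" by simp
  have "bounded T"
  proof -
    obtain R where R: "\<And>y. y \<in> W \<Longrightarrow> norm y \<le> R" using bounded_W by (auto simp: bounded_iff)
    have "\<bar>s\<bar> \<le> R" if "s \<in> T" for s
      using Basis_le_norm[OF b, of "pt v s"] R[of "pt v s"] that v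
      by (simp add: T_def inner_add_left)
    then show ?thesis by (auto simp: bounded_iff)
  qed
  have \<Phi>p: "\<Phi> (pt v s) = v + p s *\<^sub>R b" for s by (simp add: p_def \<Phi>_line v)
  have inj: "inj_on p T"
  proof (rule inj_onI)
    fix s s' assume "s \<in> T" "s' \<in> T" "p s = p s'"
    then show "s = s'" using line_dist[of v s s'] m_pos
      by (simp add: T_def p_def mult_le_0_iff)
  qed
  define M1 where "M1 = density lborel (indicator T :: real \<Rightarrow> ennreal)"
  define M2 where "M2 = distr (density lborel (\<lambda>\<omega>. ennreal (q (pt v \<omega>)))) borel (\<lambda>\<omega>. \<Psi>0 (pt v \<omega>) \<bullet> b)"
  have "M1 = M2"
  proof (rule measure_eqI)
    show "sets M1 = sets M2" by (simp add: M1_def M2_def)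
    fix E assume "E \<in> sets M1"
    then have E [measurable]: "E \<in> sets borel" by (simp add: M1_def)
    \<comment> \<open>Chosen so that the integrand pulled back to the line is the constant 1 on
      \<open>T \<inter> E\<close>; its integral is then the length of that set.\<close>
    define F where "F \<omega> = q (pt v \<omega>) * indicator E (\<Psi>0 (pt v \<omega>) \<bullet> b)" for \<omega>
    have F [measurable]: "F \<in> borel_measurable borel" unfolding F_def by measurable
    have Fp: "\<bar>dP (pt v s) \<bullet> b\<bar> * F (p s) = 1" if "s \<in> T \<inter> E" for s
    proof -
      have "v + p s *\<^sub>R b \<in> \<Phi> ` W" "\<Psi> (v + p s *\<^sub>R b) = pt v s"
        using that \<Phi>p[of s, symmetric] by (auto simp: T_def)
      moreover have "\<bar>dP (pt v s) \<bullet> b\<bar> \<noteq> 0"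
        using e_abs[of "pt v s"] m_pos that by (auto simp: T_def)
      ultimately show ?thesis
        using that v by (simp add: F_def q_def \<Psi>0_def inner_add_left)
    qed
    have F0: "F \<omega> = 0" if "\<omega> \<notin> p ` (T \<inter> E)" for \<omega>
    proof (rule ccontr)
      assume "F \<omega> \<noteq> 0"
      then have *: "pt v \<omega> \<in> \<Phi> ` W" "\<Psi> (pt v \<omega>) \<bullet> b \<in> E"
        by (auto simp: F_def q_def \<Psi>0_def indicator_def split: if_splits)
      define s where "s = \<Psi> (pt v \<omega>) \<bullet> b"
      have "s \<in> T" "p s = \<omega>" using \<Psi>_line[OF v *(1)] \<Psi>_in[OF *(1)]
        by (auto simp: T_def p_def s_def)
      then have "\<omega> \<in> p ` (T \<inter> E)" using *(2) unfolding s_def[symmetric] by (metis IntI image_eqI)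
      then show False using that by simp
    qed
    \<comment> \<open>Boundedness of \<open>T\<close> enters here: the constant 1 has to be
      absolutely integrable.\<close>
    have lm: "T \<inter> E \<in> lmeasurable"
      using \<open>bounded T\<close> by (intro bounded_set_imp_lmeasurable bounded_Int) auto
    have one: "(\<lambda>s. 1::real) absolutely_integrable_on (T \<inter> E)"
      "integral (T \<inter> E) (\<lambda>s. 1::real) = measure lebesgue (T \<inter> E)"
      using lm lmeasure_integral[OF lm] by (auto simp: absolutely_integrable_on_const simp del: integral_const)
    have "F absolutely_integrable_on p ` (T \<inter> E) \<and> integral (p ` (T \<inter> E)) F = measure lebesgue (T \<inter> E)"
    proof (subst has_absolute_integral_change_of_variables_1'[symmetric])
      show "(p has_field_derivative dP (pt v s) \<bullet> b) (at s within T \<inter> E)" if "s \<in> T \<inter> E" for s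
        unfolding p_def using that by (intro deriv_line) (auto simp: T_def)
      have "(\<lambda>s. \<bar>dP (pt v s) \<bullet> b\<bar> * F (p s)) absolutely_integrable_on (T \<inter> E)"
        by (rule set_integrable_cong[THEN iffD1, OF refl refl _ one(1)]) (simp add: Fp)
      then show "(\<lambda>s. \<bar>dP (pt v s) \<bullet> b\<bar> * F (p s)) absolutely_integrable_on T \<inter> E \<and>
        integral (T \<inter> E) (\<lambda>s. \<bar>dP (pt v s) \<bullet> b\<bar> * F (p s)) = measure lebesgue (T \<inter> E)"
        using one(2) integral_cong[of "T \<inter> E" "\<lambda>s. \<bar>dP (pt v s) \<bullet> b\<bar> * F (p s)" "\<lambda>s. 1"] Fp by simp
    qed (use inj in \<open>auto intro: inj_on_subset\<close>)
    then have "(F has_integral measure lebesgue (T \<inter> E)) (p ` (T \<inter> E))"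
      by (auto simp: has_integral_iff set_lebesgue_integral_eq_integral)
    then have "(F has_integral measure lebesgue (T \<inter> E)) UNIV"
      by (rule has_integral_on_superset) (use F0 in auto)
    moreover have "0 \<le> F \<omega>" for \<omega> by (simp add: F_def)
    ultimately have "(\<integral>\<^sup>+\<omega>. F \<omega> \<partial>lborel) = ennreal (measure lebesgue (T \<inter> E))"
      by (intro nn_integral_has_integral_lborel F)
    also have "\<dots> = emeasure lborel (T \<inter> E)"
      using lm emeasure_eq_ennreal_measure[of lebesgue "T \<inter> E"]
      by (simp add: fmeasurable_def less_top)
    finally have F_int: "(\<integral>\<^sup>+\<omega>. F \<omega> \<partial>lborel) = emeasure lborel (T \<inter> E)" .
    have "emeasure M1 E = (\<integral>\<^sup>+s. indicator (T \<inter> E) s \<partial>lborel)"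
      unfolding M1_def by (subst emeasure_density) (auto intro!: nn_integral_cong split: split_indicator simp del: nn_integral_indicator)
    moreover have "emeasure M2 E = (\<integral>\<^sup>+s. indicator E s \<partial>M2)" by (simp add: M2_def)
    moreover have "(\<integral>\<^sup>+s. indicator E s \<partial>M2) = (\<integral>\<^sup>+\<omega>. F \<omega> \<partial>lborel)"
      unfolding M2_def F_def
      by (simp add: nn_integral_distr nn_integral_density ennreal_mult' ennreal_indicator del: nn_integral_indicator)
    ultimately show "emeasure M1 E = emeasure M2 E" using F_int by simp
  qed
  then have "(\<integral>\<^sup>+s. h s \<partial>M1) = (\<integral>\<^sup>+s. h s \<partial>M2)" by simp
  moreover have "indicator W (pt v s) = (indicator T s :: ennreal)" for s by (simp add: T_def indicator_def)
  ultimately show ?thesis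
    by (simp add: M1_def M2_def nn_integral_density nn_integral_distr)
qed

lemma nn_coarea:
  assumes f [measurable]: "f \<in> borel_measurable borel"
  shows "(\<integral>\<^sup>+y. indicator W y * f y \<partial>lborel) = (\<integral>\<^sup>+x. \<integral>\<^sup>+y. f y \<partial>\<tau> x \<partial>lborel)"
proof -
  interpret H: sigma_finite_measure H by (rule sigma_finite_hyperplane_lborel[OF b])
  interpret HL: pair_sigma_finite H "lborel :: real measure" ..
  have [measurable]: "W \<in> sets borel" using open_W by simp
  have "(\<integral>\<^sup>+y. indicator W y * f y \<partial>lborel)
    = (\<integral>\<^sup>+v. \<integral>\<^sup>+s. indicator W (pt v s) * f (pt v s) \<partial>lborel \<partial>H)"
    by (rule nn_integral_lborel_hyperplane[OF b]) measurable
  also have "\<dots> = (\<integral>\<^sup>+v. \<integral>\<^sup>+\<omega>. ennreal (q (pt v \<omega>)) * f (\<Psi>0 (pt v \<omega>)) \<partial>lborel \<partial>H)"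
  proof (rule nn_integral_cong_AE)
    show "AE v in H. (\<integral>\<^sup>+s. indicator W (pt v s) * f (pt v s) \<partial>lborel)
      = (\<integral>\<^sup>+\<omega>. ennreal (q (pt v \<omega>)) * f (\<Psi>0 (pt v \<omega>)) \<partial>lborel)"
      using AE_hyperplane_lborel[OF b]
    proof eventually_elim
      case (elim v)
      \<comment> \<open>The substitution produces the point of the line whose
        \<open>b\<close>-coordinate is that of \<open>\<Psi>0 (pt v \<omega>)\<close>; where
        \<open>q\<close> is nonzero, this is \<open>\<Psi>0 (pt v \<omega>)\<close> itself.\<close>
      have "ennreal (q (pt v \<omega>)) * f (v + (\<Psi>0 (pt v \<omega>) \<bullet> b) *\<^sub>R b)
        = ennreal (q (pt v \<omega>)) * f (\<Psi>0 (pt v \<omega>))" for \<omega>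
        using \<Psi>_line(1)[OF elim, of \<omega>] by (auto simp: q_def \<Psi>0_def)
      then show ?case using line_substitution[OF elim, of "\<lambda>s. f (pt v s)"] by simp
    qed
  qed
  also have "\<dots> = (\<integral>\<^sup>+\<omega>. \<integral>\<^sup>+v. ennreal (q (pt v \<omega>)) * f (\<Psi>0 (pt v \<omega>)) \<partial>H \<partial>lborel)"
    by (rule HL.Fubini'[symmetric]) measurable
  also have "\<dots> = (\<integral>\<^sup>+x. \<integral>\<^sup>+y. f y \<partial>\<tau> x \<partial>lborel)"
    by (simp add: nn_integral_\<tau>)
  finally show ?thesis .
qed

section \<open>Finite mass and Lipschitz dependence on the level\<close>

text \<open>Orthogonal projection does not increase the norm, so every line that meets
  \<open>W\<close> has its foot in a fixed ball. One set \<open>B\<close> of finite area thus serves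
  all levels, which makes bounds uniform in \<open>x\<close> possible.\<close>

lemma q_bounded_support:
  obtains B where "B \<in> sets borel" "bounded B" "emeasure H B < \<infinity>"
    "\<And>v x. v \<bullet> b = 0 \<Longrightarrow> v \<notin> B \<Longrightarrow> q (pt v x) = 0"
proof -
  obtain R where R: "\<And>y. y \<in> W \<Longrightarrow> norm y \<le> R" using bounded_W by (auto simp: bounded_iff)
  have "q (pt v x) = 0" if vb: "v \<bullet> b = 0" "v \<notin> cball 0 R" for v x
  proof (rule ccontr)
    assume "q (pt v x) \<noteq> 0"
    then obtain s where s: "pt v s \<in> W" using in_\<Phi>W_line[OF vb(1), of x] by (auto simp: q_def split: if_splits)
    have "(norm v)\<^sup>2 \<le> (norm (pt v s))\<^sup>2"
      using vb(1) by (simp add: power2_norm_eq_inner inner_add inner_commute)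
    then have "norm v \<le> norm (pt v s)" by (rule power2_le_imp_le) simp
    then show False using R[OF s] vb(2) by simp
  qed
  then show ?thesis
    by (intro that[of "cball 0 R"]) (auto intro!: emeasure_hyperplane_lborel_bounded[OF b, simplified])
qed

lemma finite_\<tau>: "finite_measure (\<tau> x)"
proof
  obtain B where B: "B \<in> sets borel" "bounded B" "emeasure H B < \<infinity>"
    "\<And>v x. v \<bullet> b = 0 \<Longrightarrow> v \<notin> B \<Longrightarrow> q (pt v x) = 0"
    by (rule q_bounded_support) blast
  have [measurable]: "B \<in> sets borel" by fact
  have "emeasure (\<tau> x) UNIV = (\<integral>\<^sup>+y. 1 \<partial>\<tau> x)" by simp
  also have "\<dots> = (\<integral>\<^sup>+v. ennreal (q (pt v x)) \<partial>H)"
    by (subst nn_integral_\<tau>) auto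
  also have "\<dots> \<le> (\<integral>\<^sup>+v. ennreal (1 / m) * indicator B v \<partial>H)"
  proof (rule nn_integral_mono_AE)
    show "AE v in H. ennreal (q (pt v x)) \<le> ennreal (1 / m) * indicator B v"
      using AE_hyperplane_lborel[OF b]
    proof eventually_elim
      case (elim v) then show ?case using B(4)[OF elim, of x] q_le[of "pt v x"]
        by (cases "v \<in> B") (auto intro: ennreal_leI)
    qed
  qed
  also have "\<dots> < \<infinity>"
    using B(3) by (simp add: nn_integral_cmult ennreal_mult_less_top)
  finally show "emeasure (\<tau> x) (space (\<tau> x)) \<noteq> \<infinity>" by simp
qed

lemma integrable_\<tau>_bounded:
  fixes f :: "'a \<Rightarrow> 'c::{banach,second_countable_topology}"
  assumes "f \<in> borel_measurable borel" "\<And>y. norm (f y) \<le> M"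
  shows "integrable (\<tau> x) f"
  using assms by (intro finite_measure.integrable_const_bound[OF finite_\<tau>, of _ M]) auto

text \<open>Handles lines along which only one of two levels is attained in \<open>W\<close>: a function that vanishes
  off \<open>W\<close> is small at the point where it is attained.\<close>

lemma unattained_level:
  assumes v: "v \<bullet> b = 0" and s: "pt v s \<in> W" and x': "pt v x' \<notin> \<Phi> ` W"
  shows "\<exists>s'. pt v s' \<notin> W \<and> \<bar>s - s'\<bar> \<le> \<bar>P (pt v s) - x'\<bar> / m"
proof (rule ccontr)
  define d where "d = \<bar>P (pt v s) - x'\<bar> / m"
  have md: "m * d = \<bar>P (pt v s) - x'\<bar>" and d: "0 \<le> d" using m_pos by (auto simp: d_def)
  assume "\<not> ?thesis"
  \<comment> \<open>The denial puts the whole segment of half-width \<open>d\<close> into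
    \<open>W\<close>. On each half \<open>P\<close> changes by at least \<open>m * d\<close>, the
    distance from its value at \<open>s\<close> to \<open>x'\<close>, so it attains
    \<open>x'\<close> after all.\<close>
  then have W: "pt v s' \<in> W" if "\<bar>s - s'\<bar> \<le> d" for s' using that by (auto simp: d_def)
  have "m * d \<le> e * (P (pt v (s + d)) - P (pt v s))"
    using line_increase[OF s W[of "s + d"]] d by simp
  have "m * d \<le> e * (P (pt v s) - P (pt v (s - d)))"
    using line_increase[OF W[of "s - d"] s] d by simp
  have le: "e * P (pt v (s - d)) \<le> e * x'" "e * x' \<le> e * P (pt v (s + d))"
  proof -
    consider "e = 1" | "e = -1" using e by linarith
    then show "e * P (pt v (s - d)) \<le> e * x'" "e * x' \<le> e * P (pt v (s + d))"
      using md \<open>m * d \<le> e * (P (pt v (s + d)) - P (pt v s))\<close>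
        \<open>m * d \<le> e * (P (pt v s) - P (pt v (s - d)))\<close>
      by (cases; simp; linarith)+
  qed
  have "\<exists>t\<ge>s - d. t \<le> s + d \<and> e * P (pt v t) = e * x'"
  proof (rule IVT'[of "\<lambda>t. e * P (pt v t)"])
    show "continuous_on {s - d..s + d} (\<lambda>t. e * P (pt v t))"
      by (intro continuous_intros continuous_on_compose2[OF cont_P]) (auto intro!: W)
  qed (use le d in auto)
  then obtain t where "s - d \<le> t" "t \<le> s + d" "P (pt v t) = x'" using e by auto
  then have "pt v x' \<in> \<Phi> ` W"
    unfolding in_\<Phi>W_line[OF v] by (intro exI[of _ t]) (auto intro!: W)
  then show False using x' by simp
qed

text \<open>Changing the level by \<delta> moves the point on the line by at most \<delta>/m. Along
  the line, the quotient of \<open>f\<close> by the derivative has Lipschitz constant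
  \<open>K / m + M * L / m\<^sup>2\<close>, as in the product rule.\<close>

lemma slice_Lipschitz:
  fixes f :: "'a \<Rightarrow> 'c::{banach,second_countable_topology}"
  assumes fL: "\<And>y y'. norm (f y - f y') \<le> K * norm (y - y')"
    and f0: "\<And>y. y \<notin> W \<Longrightarrow> f y = 0" and fM: "\<And>y. norm (f y) \<le> M" and v: "v \<bullet> b = 0"
  defines "\<rho> \<equiv> \<lambda>x. q (pt v x) *\<^sub>R f (\<Psi>0 (pt v x))"
  shows "norm (\<rho> x - \<rho> x') \<le> (K / m + M * L / m\<^sup>2) / m * \<bar>x - x'\<bar>"
proof -
  have M: "0 \<le> M" using fM[of undefined] norm_ge_zero order_trans by blast
  have K: "0 \<le> K"
    using order_trans[OF norm_ge_zero fL, of b 0] by simp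
  have one: "norm (\<rho> x) \<le> K / m / m * \<bar>x - x'\<bar>"
    if x: "pt v x \<in> \<Phi> ` W" and x': "pt v x' \<notin> \<Phi> ` W" for x x'
  proof -
    define s where "s = \<Psi> (pt v x) \<bullet> b"
    have s: "\<Psi> (pt v x) = pt v s" "P (pt v s) = x" "pt v s \<in> W"
      using \<Psi>_line[OF v x] \<Psi>_in[OF x] by (auto simp: s_def)
    obtain s' where s': "pt v s' \<notin> W" "\<bar>s - s'\<bar> \<le> \<bar>x - x'\<bar> / m"
      using unattained_level[OF v s(3) x'] s(2) by auto
    have "norm (f (pt v s)) \<le> K * \<bar>s - s'\<bar>"
      using fL[of "pt v s" "pt v s'"] f0[OF s'(1)] by (simp flip: scaleR_diff_left)
    also have "\<dots> \<le> K * (\<bar>x - x'\<bar> / m)" using s'(2) K by (rule mult_left_mono)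
    finally have "q (pt v x) * norm (f (pt v s)) \<le> (1 / m) * (K * (\<bar>x - x'\<bar> / m))"
      using m_pos by (intro mult_mono q_le) auto
    then show ?thesis
      using x s(1) by (simp add: \<rho>_def \<Psi>0_def mult_ac)
  qed
  have K1: "K / m / m * \<bar>x - x'\<bar> \<le> (K / m + M * L / m\<^sup>2) / m * \<bar>x - x'\<bar>"
    using K M L_nonneg m_pos
    by (intro mult_right_mono divide_right_mono) auto
  have zero: "\<rho> x = 0" if "pt v x \<notin> \<Phi> ` W" for x using that by (simp add: \<rho>_def q_def)
  consider "pt v x \<in> \<Phi> ` W" "pt v x' \<in> \<Phi> ` W" | "pt v x \<in> \<Phi> ` W" "pt v x' \<notin> \<Phi> ` W"
    | "pt v x \<notin> \<Phi> ` W" "pt v x' \<in> \<Phi> ` W" | "pt v x \<notin> \<Phi> ` W" "pt v x' \<notin> \<Phi> ` W"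
    by blast
  then show ?thesis
  proof cases
    case 1
    define s where "s = \<Psi> (pt v x) \<bullet> b"
    define s' where "s' = \<Psi> (pt v x') \<bullet> b"
    have s: "\<Psi> (pt v x) = pt v s" "P (pt v s) = x" "pt v s \<in> W"
      using \<Psi>_line[OF v 1(1)] \<Psi>_in[OF 1(1)] by (auto simp: s_def)
    have s': "\<Psi> (pt v x') = pt v s'" "P (pt v s') = x'" "pt v s' \<in> W"
      using \<Psi>_line[OF v 1(2)] \<Psi>_in[OF 1(2)] by (auto simp: s'_def)
    define a where "a = \<bar>dP (pt v s) \<bullet> b\<bar>"
    define a' where "a' = \<bar>dP (pt v s') \<bullet> b\<bar>"
    have a: "m \<le> a" "m \<le> a'" "0 < a" "0 < a'"
      using e_abs[OF s(3)] e_abs[OF s'(3)] m_pos by (auto simp: a_def a'_def)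
    have d: "\<bar>s - s'\<bar> \<le> \<bar>x - x'\<bar> / m"
      using line_dist[OF s'(3) s(3)] s(2) s'(2) m_pos by (simp add: field_simps abs_minus_commute)
    have fd: "norm (f (pt v s) - f (pt v s')) \<le> K * \<bar>s - s'\<bar>"
      using fL[of "pt v s" "pt v s'"] by (simp flip: scaleR_diff_left)
    have ad: "\<bar>a' - a\<bar> \<le> L * \<bar>s - s'\<bar>"
      using lip[OF s'(3) s(3)] abs_triangle_ineq3[of "dP (pt v s') \<bullet> b" "dP (pt v s) \<bullet> b"]
      unfolding a_def a'_def by (simp add: abs_minus_commute flip: scaleR_diff_left)
    have "\<rho> x - \<rho> x' = (1 / a) *\<^sub>R (f (pt v s) - f (pt v s')) + (1 / a - 1 / a') *\<^sub>R f (pt v s')"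
      using 1 s(1) s'(1) by (simp add: \<rho>_def q_def \<Psi>0_def a_def a'_def algebra_simps)
    then have "norm (\<rho> x - \<rho> x') \<le> norm ((1 / a) *\<^sub>R (f (pt v s) - f (pt v s')))
        + norm ((1 / a - 1 / a') *\<^sub>R f (pt v s'))"
      by (simp only: norm_triangle_ineq)
    also have "norm ((1 / a) *\<^sub>R (f (pt v s) - f (pt v s'))) \<le> (1 / m) * (K * \<bar>s - s'\<bar>)"
      using a fd m_pos by (auto intro!: mult_mono divide_left_mono simp del: times_divide_eq_left)
    also have "norm ((1 / a - 1 / a') *\<^sub>R f (pt v s')) \<le> (L * \<bar>s - s'\<bar> / m\<^sup>2) * M"
    proof -
      have "\<bar>1 / a - 1 / a'\<bar> = \<bar>a' - a\<bar> / (a * a')"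
        using a by (simp add: divide_simps abs_mult)
      also have "\<dots> \<le> (L * \<bar>s - s'\<bar>) / (m * m)"
        using ad a m_pos by (intro frac_le mult_mono) auto
      finally show ?thesis
        unfolding norm_scaleR power2_eq_square
        using fM by (intro mult_mono) (auto intro: order_trans[OF abs_ge_zero])
    qed
    also have "(1 / m) * (K * \<bar>s - s'\<bar>) + (L * \<bar>s - s'\<bar> / m\<^sup>2) * M = (K / m + M * L / m\<^sup>2) * \<bar>s - s'\<bar>"
      by (simp add: field_simps)
    also have "\<dots> \<le> (K / m + M * L / m\<^sup>2) * (\<bar>x - x'\<bar> / m)"
      using d K M L_nonneg m_pos by (intro mult_left_mono) auto
    finally show ?thesis by simp
  next
    case 2 then show ?thesis using one[OF 2] K1 zero[OF 2(2)] by simp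
  next
    case 3 then show ?thesis using one[OF 3(2,1)] K1 zero[OF 3(1)] by (simp add: abs_minus_commute)
  next
    case 4 then show ?thesis using K M L_nonneg m_pos zero by simp
  qed
qed

text \<open>The bound on each line is integrated over the fixed set \<open>B\<close>. As
  \<open>f\<close> vanishes off \<open>W\<close>, no regularity of the boundary of \<open>W\<close>
  enters.\<close>

lemma integral_\<tau>_Lipschitz:
  fixes f :: "'a \<Rightarrow> 'c::{banach,second_countable_topology}"
  assumes fL: "\<And>y y'. norm (f y - f y') \<le> K * norm (y - y')"
    and f0: "\<And>y. y \<notin> W \<Longrightarrow> f y = 0" and fM: "\<And>y. norm (f y) \<le> M"
  shows "\<exists>C. \<forall>x x'. norm ((\<integral>y. f y \<partial>\<tau> x) - (\<integral>y. f y \<partial>\<tau> x')) \<le> C * \<bar>x - x'\<bar>"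
proof -
  have "continuous_on UNIV f"
    using order_trans[OF norm_ge_zero fL, of b 0]
    by (intro lipschitz_on_continuous_on[of K] lipschitz_onI) (simp_all add: dist_norm fL)
  then have f [measurable]: "f \<in> borel_measurable borel" by (rule borel_measurable_continuous_onI)
  obtain B where B: "B \<in> sets borel" "bounded B" "emeasure H B < \<infinity>"
    "\<And>v x. v \<bullet> b = 0 \<Longrightarrow> v \<notin> B \<Longrightarrow> q (pt v x) = 0"
    by (rule q_bounded_support) blast
  have [measurable]: "B \<in> sets borel" by fact
  define c where "c = (K / m + M * L / m\<^sup>2) / m"
  have *: "norm ((\<integral>y. f y \<partial>\<tau> x) - (\<integral>y. f y \<partial>\<tau> x')) \<le> c * measure H B * \<bar>x - x'\<bar>" for x x'
  proof -
    let ?r = "\<lambda>x v. q (pt v x) *\<^sub>R f (\<Psi>0 (pt v x))"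
    have i: "integrable H (?r x)" for x
      using integrable_\<tau>_bounded[OF f fM, of x] by (simp add: integrable_\<tau>_iff)
    have "norm ((\<integral>y. f y \<partial>\<tau> x) - (\<integral>y. f y \<partial>\<tau> x')) = norm (\<integral>v. ?r x v - ?r x' v \<partial>H)"
      by (simp add: integral_\<tau> i)
    also have "\<dots> \<le> (\<integral>v. norm (?r x v - ?r x' v) \<partial>H)"
      by (rule integral_norm_bound)
    also have "\<dots> \<le> (\<integral>v. indicator B v * (c * \<bar>x - x'\<bar>) \<partial>H)"
    proof (rule integral_mono_AE)
      show "AE v in H. norm (?r x v - ?r x' v) \<le> indicator B v * (c * \<bar>x - x'\<bar>)"
        using AE_hyperplane_lborel[OF b]
      proof eventually_elim
        case (elim v)
        then show ?case
          using slice_Lipschitz[OF fL f0 fM elim, of x x'] B(4)[OF elim]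
          by (cases "v \<in> B") (simp_all add: c_def)
      qed
      show "integrable H (\<lambda>v. indicator B v * (c * \<bar>x - x'\<bar>))"
        using B(3) by (intro integrable_mult_left integrable_real_indicator) auto
      show "integrable H (\<lambda>v. norm (?r x v - ?r x' v))"
        by (intro integrable_norm Bochner_Integration.integrable_diff i)
    qed
    also have "\<dots> = c * measure H B * \<bar>x - x'\<bar>"
      by simp
    finally show ?thesis .
  qed
  show ?thesis
    by (intro exI[of _ "c * measure H B"] allI *)
qed

end

subsection \<open>Independence of the chart\<close>

text \<open>Two continuous functions differ on an open set, and a nonempty open set is not
  null.\<close>

lemma continuous_AE_lborel_eq:
  fixes F G :: "real \<Rightarrow> real"
  assumes "continuous_on UNIV F" "continuous_on UNIV G" "AE x in lborel. F x = G x"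
  shows "F x = G x"
proof (rule ccontr)
  assume ne: "F x \<noteq> G x"
  have "open {x. F x \<noteq> G x}" by (rule open_Collect_neq[OF assms(1,2)])
  then obtain r where r: "r > 0" "ball x r \<subseteq> {x. F x \<noteq> G x}"
    using ne unfolding open_contains_ball by blast
  have "AE x in lborel. x \<notin> {x. F x \<noteq> G x}" using assms(3) by simp
  then have "emeasure lborel {x. F x \<noteq> G x} = 0"
    using \<open>open {x. F x \<noteq> G x}\<close> by (subst (asm) AE_iff_measurable[OF _ refl]) auto
  then have "emeasure lborel (ball x r) = 0"
    using emeasure_mono[OF r(2), of lborel] \<open>open {x. F x \<noteq> G x}\<close> by simp
  moreover have "ball x r = {x - r<..<x + r}" by (auto simp: dist_real_def)
  ultimately show False using r(1) by simp
qed

lemma (in level_chart) borel_P_on: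
  assumes V: "open V" "V \<subseteq> W"
  shows "(\<lambda>y. indicator V y *\<^sub>R P y) \<in> borel_measurable borel"
  by (intro borel_measurable_continuous_on_indicator continuous_on_subset[OF cont_P V(2)])
     (use V in auto)

text \<open>Tests the slice integrals against a set \<open>J\<close> of levels. The right-hand side
  no longer mentions the chart, which is what makes two charts comparable. Cutting \<open>P\<close>
  down to \<open>V\<close> makes it Borel, and \<open>f\<close> vanishes elsewhere.\<close>

lemma (in level_chart) integral_\<tau>_layer:
  fixes f :: "'a \<Rightarrow> real"
  assumes f: "f \<in> borel_measurable borel" "\<And>y. 0 \<le> f y" "\<And>y. f y \<le> M" and V: "open V" "V \<subseteq> W"
    and f0: "\<And>y. y \<notin> V \<Longrightarrow> f y = 0" and J [measurable]: "J \<in> sets borel"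
  shows "(\<integral>\<^sup>+x. ennreal (\<integral>y. f y \<partial>\<tau> x) * indicator J x \<partial>lborel)
    = (\<integral>\<^sup>+y. indicator J (indicator V y *\<^sub>R P y) * ennreal (f y) \<partial>lborel)"
proof -
  note [measurable] = f(1) borel_P_on[OF V]
  have "ennreal (\<integral>y. f y \<partial>\<tau> x) * indicator J x = (\<integral>\<^sup>+y. indicator J (indicator V y *\<^sub>R P y) * ennreal (f y) \<partial>\<tau> x)" for x
  proof -
    have "(\<integral>\<^sup>+y. indicator J (indicator V y *\<^sub>R P y) * ennreal (f y) \<partial>\<tau> x) = (\<integral>\<^sup>+y. indicator J x * ennreal (f y) \<partial>\<tau> x)"
    proof (rule nn_integral_cong_AE)
      show "AE y in \<tau> x. indicator J (indicator V y *\<^sub>R P y) * ennreal (f y) = indicator J x * ennreal (f y)"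
        using AE_\<tau>[of x]
      proof eventually_elim
        case (elim y) then show ?case using f0[of y] by (cases "y \<in> V") auto
      qed
    qed
    also have "\<dots> = indicator J x * (\<integral>\<^sup>+y. ennreal (f y) \<partial>\<tau> x)"
      by (rule nn_integral_cmult) simp
    also have "(\<integral>\<^sup>+y. ennreal (f y) \<partial>\<tau> x) = ennreal (\<integral>y. f y \<partial>\<tau> x)"
      using f by (intro nn_integral_eq_integral integrable_\<tau>_bounded[of _ M]) auto
    finally show ?thesis by (simp add: mult.commute)
  qed
  then have "(\<integral>\<^sup>+x. ennreal (\<integral>y. f y \<partial>\<tau> x) * indicator J x \<partial>lborel)
    = (\<integral>\<^sup>+x. \<integral>\<^sup>+y. indicator J (indicator V y *\<^sub>R P y) * ennreal (f y) \<partial>\<tau> x \<partial>lborel)" by simp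
  also have "\<dots> = (\<integral>\<^sup>+y. indicator W y * (indicator J (indicator V y *\<^sub>R P y) * ennreal (f y)) \<partial>lborel)"
    by (rule nn_coarea[symmetric]) measurable
  also have "\<dots> = (\<integral>\<^sup>+y. indicator J (indicator V y *\<^sub>R P y) * ennreal (f y) \<partial>lborel)"
    by (intro nn_integral_cong) (use f0 V in \<open>auto simp: indicator_def\<close>)
  finally show ?thesis .
qed

lemma Lipschitz_imp_continuous_UNIV:
  fixes F :: "'a::metric_space \<Rightarrow> 'b::real_normed_vector"
  assumes "\<And>x x'. norm (F x - F x') \<le> C * dist x x'"
  shows "continuous_on UNIV F"
proof -
  have "norm (F x - F x') \<le> \<bar>C\<bar> * dist x x'" for x x'
    using assms[of x x'] mult_right_mono[OF abs_ge_self, of "dist x x'" C] by simp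
  then show ?thesis
    by (intro lipschitz_on_continuous_on[of "\<bar>C\<bar>"] lipschitz_onI) (simp_all add: dist_norm[of "F _"])
qed

context
  fixes P :: "'a::euclidean_space \<Rightarrow> real" and dP W b e m L W' b' e' m' L'
  assumes A: "level_chart P dP W b e m L" and B: "level_chart P dP W' b' e' m' L'"
begin

interpretation A: level_chart P dP W b e m L by (rule A)
interpretation B: level_chart P dP W' b' e' m' L' by (rule B)

text \<open>By the coarea formula both sides have the same integral over every set of levels \<open>x\<close>, so they
  agree for almost all \<open>x\<close>; both are continuous in \<open>x\<close>. This replaces a change of variables between
  the two coordinate hyperplanes.\<close>

lemma slice_integrals_agree:
  fixes f :: "'a \<Rightarrow> real"
  assumes fL: "\<And>y y'. norm (f y - f y') \<le> K * norm (y - y')"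
    and f0: "\<And>y. y \<notin> W \<inter> W' \<Longrightarrow> f y = 0" and f_nn: "\<And>y. 0 \<le> f y" and fM: "\<And>y. f y \<le> M"
  shows "(\<integral>y. f y \<partial>A.\<tau> x) = (\<integral>y. f y \<partial>B.\<tau> x)"
proof -
  let ?A = "\<lambda>x. \<integral>y. f y \<partial>A.\<tau> x" and ?B = "\<lambda>x. \<integral>y. f y \<partial>B.\<tau> x"
  have fM': "norm (f y) \<le> M" for y using f_nn fM by simp
  have fA: "f y = 0" if "y \<notin> W" for y using f0 that by auto
  have fB: "f y = 0" if "y \<notin> W'" for y using f0 that by auto
  have cf: "continuous_on UNIV f"
    using fL by (intro Lipschitz_imp_continuous_UNIV[of f K]) (simp add: dist_norm)
  have f [measurable]: "f \<in> borel_measurable borel" by (rule borel_measurable_continuous_onI[OF cf])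
  obtain CA where CA: "\<forall>x x'. norm (?A x - ?A x') \<le> CA * \<bar>x - x'\<bar>"
    using A.integral_\<tau>_Lipschitz[OF fL fA fM'] by blast
  obtain CB where CB: "\<forall>x x'. norm (?B x - ?B x') \<le> CB * \<bar>x - x'\<bar>"
    using B.integral_\<tau>_Lipschitz[OF fL fB fM'] by blast
  have contA: "continuous_on UNIV ?A"
    using CA by (intro Lipschitz_imp_continuous_UNIV[of _ CA]) (simp add: dist_real_def)
  have contB: "continuous_on UNIV ?B"
    using CB by (intro Lipschitz_imp_continuous_UNIV[of _ CB]) (simp add: dist_real_def)
  note cont = contA contB
  note [measurable] = cont[THEN borel_measurable_continuous_onI]
  have V: "open (W \<inter> W')" "W \<inter> W' \<subseteq> W" "W \<inter> W' \<subseteq> W'" using A.open_W B.open_W by auto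
  have "density lborel (\<lambda>x. ennreal (?A x)) = density lborel (\<lambda>x. ennreal (?B x))"
  proof (rule measure_eqI)
    fix J :: "real set" assume "J \<in> sets (density lborel (\<lambda>x. ennreal (?A x)))"
    then have J: "J \<in> sets borel" by simp
    have "(\<integral>\<^sup>+x. ennreal (?A x) * indicator J x \<partial>lborel) = (\<integral>\<^sup>+x. ennreal (?B x) * indicator J x \<partial>lborel)"
      by (rule trans[OF A.integral_\<tau>_layer[OF f f_nn fM V(1,2) f0 J]
          B.integral_\<tau>_layer[OF f f_nn fM V(1,3) f0 J, symmetric]])
    then show "emeasure (density lborel (\<lambda>x. ennreal (?A x))) J
      = emeasure (density lborel (\<lambda>x. ennreal (?B x))) J"
      using J by (simp add: emeasure_density)
  qed simp
  then have "AE x in lborel. ennreal (?A x) = ennreal (?B x)"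
    by (intro sigma_finite_measure.density_unique[OF sigma_finite_lborel]) auto
  then have "AE x in lborel. ?A x = ?B x"
    by eventually_elim (use f_nn in \<open>simp add: integral_nonneg\<close>)
  then show ?thesis by (rule continuous_AE_lborel_eq[OF cont])
qed

text \<open>The indicator of \<open>V\<close> is the increasing limit of truncated multiples of the
  distance to its complement; these are Lipschitz, and for Lipschitz functions agreement is
  known.\<close>

lemma slice_measures_agree_open:
  assumes V: "open V" "V \<subseteq> W \<inter> W'"
  shows "emeasure (A.\<tau> x) V = emeasure (B.\<tau> x) V"
proof -
  define f where "f n y = min 1 (real n * infdist y (- V))" for n y
  \<comment> \<open>\<open>infdist\<close> to the empty set is 0 by convention, so that
    \<open>V = UNIV\<close> would ruin the approximation; bounded \<open>W\<close> excludes this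
    case.\<close>
  have "V \<noteq> UNIV" using V A.bounded_W by (metis Int_subset_iff bounded_subset not_bounded_UNIV)
  then have nV: "- V \<noteq> {}" by auto
  have clV: "closed (- V)" using V by (simp add: closed_def)
  have f_nn: "0 \<le> f n y" and f1: "f n y \<le> 1" for n y by (auto simp: f_def infdist_nonneg)
  have f0: "f n y = 0" if "y \<notin> W \<inter> W'" for n y
    using that V by (simp add: f_def) (metis ComplI infdist_zero mult_zero_right subsetD min.absorb2 zero_le_one)
  have fL: "norm (f n y - f n y') \<le> real n * norm (y - y')" for n y y'
  proof -
    have "norm (f n y - f n y') \<le> \<bar>real n * infdist y (- V) - real n * infdist y' (- V)\<bar>"
      by (auto simp: f_def)
    also have "\<dots> = real n * \<bar>infdist y (- V) - infdist y' (- V)\<bar>"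
      by (simp add: abs_mult flip: right_diff_distrib)
    also have "\<dots> \<le> real n * dist y y'"
      by (intro mult_left_mono infdist_triangle_abs) simp
    finally show ?thesis by (simp add: dist_norm)
  qed
  have [measurable]: "f n \<in> borel_measurable borel" for n
    using fL by (intro borel_measurable_continuous_onI Lipschitz_imp_continuous_UNIV[of _ "real n"])
      (simp add: dist_norm)
  have inc: "incseq (\<lambda>n y. ennreal (f n y))"
    by (auto simp: incseq_def le_fun_def f_def intro!: ennreal_leI min.mono mult_right_mono infdist_nonneg)
  have SUP: "(SUP n. ennreal (f n y)) = indicator V y" for y
  proof (cases "y \<in> V")
    case True
    then have "0 < infdist y (- V)"
      using in_closed_iff_infdist_zero[OF clV nV, of y] infdist_nonneg[of y "- V"] by force
    then obtain n where "1 \<le> real n * infdist y (- V)"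
      by (metis less_imp_le reals_Archimedean3)
    then have "f n y = 1" by (simp add: f_def)
    show ?thesis
    proof (rule antisym)
      show "(SUP n. ennreal (f n y)) \<le> indicator V y"
        using True f1 by (intro SUP_least) (simp add: ennreal_leI flip: ennreal_1)
      show "indicator V y \<le> (SUP n. ennreal (f n y))"
        using True \<open>f n y = 1\<close> by (intro SUP_upper2[of n]) auto
    qed
  next
    case False then have "f n y = 0" for n by (simp add: f_def)
    then show ?thesis using False by simp
  qed
  let ?A = "\<lambda>n. \<integral>\<^sup>+y. ennreal (f n y) \<partial>A.\<tau> x" and ?B = "\<lambda>n. \<integral>\<^sup>+y. ennreal (f n y) \<partial>B.\<tau> x"
  have eq: "?A n = ?B n" for n
  proof -
    have "?A n = ennreal (\<integral>y. f n y \<partial>A.\<tau> x)"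
      using f_nn f1 by (intro nn_integral_eq_integral A.integrable_\<tau>_bounded[of _ 1]) auto
    also have "\<dots> = ennreal (\<integral>y. f n y \<partial>B.\<tau> x)"
      using slice_integrals_agree[of "f n" "real n" 1 x, OF fL f0 f_nn f1] by simp
    also have "\<dots> = ?B n"
      using f_nn f1 by (intro nn_integral_eq_integral[symmetric] B.integrable_\<tau>_bounded[of _ 1]) auto
    finally show ?thesis .
  qed
  have "emeasure (A.\<tau> x) V = (\<integral>\<^sup>+y. (SUP n. ennreal (f n y)) \<partial>A.\<tau> x)"
    using V by (simp add: SUP)
  also have "\<dots> = (SUP n. ?A n)"
    by (intro nn_integral_monotone_convergence_SUP inc) simp
  also have "\<dots> = (SUP n. ?B n)" by (simp add: eq)
  also have "\<dots> = (\<integral>\<^sup>+y. (SUP n. ennreal (f n y)) \<partial>B.\<tau> x)"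
    by (intro nn_integral_monotone_convergence_SUP[symmetric] inc) simp
  also have "\<dots> = emeasure (B.\<tau> x) V"
    using V by (simp add: SUP)
  finally show ?thesis .
qed

text \<open>Open sets form an intersection-stable generator of the Borel sets. Restricting both
  measures to the overlap by a density extends the agreement from open subsets of the overlap to all
  open sets.\<close>

lemma slice_measures_agree:
  assumes E: "E \<in> sets borel" "E \<subseteq> W \<inter> W'"
  shows "emeasure (A.\<tau> x) E = emeasure (B.\<tau> x) E"
proof -
  have V: "open (W \<inter> W')" using A.open_W B.open_W by auto
  then have [measurable]: "W \<inter> W' \<in> sets borel" by simp
  let ?D = "\<lambda>M. density M (indicator (W \<inter> W'))"
  have "?D (A.\<tau> x) = ?D (B.\<tau> x)"
  proof (rule measure_eqI_generator_eq[of "{S. open S}" UNIV _ _ "\<lambda>_. UNIV"])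
    fix S :: "'a set" assume "S \<in> {S. open S}"
    then have S: "open S" by simp
    then have "emeasure (?D (A.\<tau> x)) S = emeasure (A.\<tau> x) (W \<inter> W' \<inter> S)"
      by (subst emeasure_density) (auto simp flip: indicator_inter_arith)
    also have "\<dots> = emeasure (B.\<tau> x) (W \<inter> W' \<inter> S)"
      using S V by (intro slice_measures_agree_open) auto
    also have "\<dots> = emeasure (?D (B.\<tau> x)) S"
      using S by (subst emeasure_density) (auto simp flip: indicator_inter_arith)
    finally show "emeasure (?D (A.\<tau> x)) S = emeasure (?D (B.\<tau> x)) S" .
  next
    have "emeasure (?D (A.\<tau> x)) UNIV = emeasure (A.\<tau> x) (W \<inter> W')"
      by (subst emeasure_density) auto
    then show "emeasure (?D (A.\<tau> x)) UNIV \<noteq> \<infinity>"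
      using finite_measure.emeasure_finite[OF A.finite_\<tau>] by simp
  qed (auto simp: Int_stable_def borel_def)
  moreover have "emeasure (?D (A.\<tau> x)) E = emeasure (A.\<tau> x) (W \<inter> W' \<inter> E)"
    "emeasure (?D (B.\<tau> x)) E = emeasure (B.\<tau> x) (W \<inter> W' \<inter> E)"
    using E(1) by (subst emeasure_density; auto simp flip: indicator_inter_arith)+
  ultimately show ?thesis using E(2) by (simp add: inf.absorb2)
qed

end

subsection \<open>Graph patches of a level set\<close>

text \<open>\<open>P\<close> is constant along the curves of the graph over coordinate lines of the
  hyperplane; differentiating gives p_i + \<phi>'_i p_b = 0, so \<open>p\<close> and
  \<open>\<phi>' v - b\<close> are proportional. This holds for every graph patch, whether or not it
  comes from a chart.\<close>

lemma graph_patch_gradient: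
  fixes P :: "'a::euclidean_space \<Rightarrow> real"
  assumes gp: "graph_patch S b U \<phi> \<phi>'" and S: "\<And>y. y \<in> S \<Longrightarrow> P y = x" and v: "v \<in> U"
    and P: "(P has_derivative (\<lambda>d. p \<bullet> d)) (at (v + \<phi> v *\<^sub>R b))" and p: "p \<noteq> 0"
  shows "p \<bullet> b \<noteq> 0" "sqrt (1 + (norm (\<phi>' v))\<^sup>2) = norm p / \<bar>p \<bullet> b\<bar>"
proof -
  have b: "b \<in> Basis" and U: "openin (top_of_set {v. v \<bullet> b = 0}) U"
    and \<phi>'b: "\<phi>' v \<bullet> b = 0"
    and \<phi>: "(\<phi> has_derivative (\<lambda>d. \<phi>' v \<bullet> d)) (at v within {v. v \<bullet> b = 0})"
    and im: "(\<lambda>v. v + \<phi> v *\<^sub>R b) ` U \<subseteq> S"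
    using gp v by (auto simp: graph_patch_def)
  have vb: "v \<bullet> b = 0" using openin_imp_subset[OF U] v by auto
  have bb: "b \<bullet> b = 1" using b by simp
  have tangent: "p \<bullet> i + (\<phi>' v \<bullet> i) * (p \<bullet> b) = 0" if i: "i \<in> Basis" "i \<noteq> b" for i
  proof -
    have ib: "i \<bullet> b = 0" using i b by (simp add: inner_Basis)
    define \<gamma> where "\<gamma> t = (v + t *\<^sub>R i) + \<phi> (v + t *\<^sub>R i) *\<^sub>R b" for t
    have lin: "((\<lambda>t. v + t *\<^sub>R i) has_derivative (\<lambda>t. t *\<^sub>R i)) (at 0)"
      by (auto intro!: derivative_eq_intros)
    have "((\<lambda>t. \<phi> (v + t *\<^sub>R i)) has_derivative (\<lambda>t. \<phi>' v \<bullet> (t *\<^sub>R i))) (at 0)"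
    proof (rule has_derivative_in_compose[OF lin])
      show "(\<phi> has_derivative (\<bullet>) (\<phi>' v)) (at (v + 0 *\<^sub>R i) within range (\<lambda>t. v + t *\<^sub>R i))"
        using vb ib by (auto intro!: has_derivative_subset[OF \<phi>] simp: inner_add_left)
    qed
    then have "(\<gamma> has_derivative (\<lambda>t. t *\<^sub>R i + (\<phi>' v \<bullet> (t *\<^sub>R i)) *\<^sub>R b)) (at 0)"
      unfolding \<gamma>_def by (auto intro!: derivative_eq_intros)
    moreover have "\<gamma> 0 = v + \<phi> v *\<^sub>R b" by (simp add: \<gamma>_def)
    ultimately have d1: "((\<lambda>t. P (\<gamma> t)) has_derivative (\<lambda>t. p \<bullet> (t *\<^sub>R i + (\<phi>' v \<bullet> (t *\<^sub>R i)) *\<^sub>R b))) (at 0)"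
      using has_derivative_compose[of \<gamma> _ 0 UNIV P "\<lambda>d. p \<bullet> d"] P by simp
    obtain T where T: "open T" "U = T \<inter> {v. v \<bullet> b = 0}"
      using U by (auto simp: openin_open)
    have "\<forall>\<^sub>F t in at 0. v + t *\<^sub>R i \<in> T"
    proof -
      have "((\<lambda>t. v + t *\<^sub>R i) \<longlongrightarrow> v + 0 *\<^sub>R i) (at 0)" by (intro tendsto_intros)
      then show ?thesis using topological_tendstoD[of _ "v + 0 *\<^sub>R i" "at 0" T] T v by simp
    qed
    then have "\<forall>\<^sub>F t in at 0. x = P (\<gamma> t)"
    proof eventually_elim
      case (elim t)
      then have "v + t *\<^sub>R i \<in> U" using T(2) vb ib by (simp add: inner_add_left)
      then show ?case using im S unfolding \<gamma>_def by fastforce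
    qed
    moreover have "x = P (\<gamma> 0)"
      using im S v unfolding \<gamma>_def by fastforce
    ultimately have d2: "((\<lambda>t. P (\<gamma> t)) has_derivative (\<lambda>t. 0)) (at 0)"
      by (intro has_derivative_transform_eventually[OF has_derivative_const[of x]]) auto
    have "p \<bullet> (1 *\<^sub>R i + (\<phi>' v \<bullet> (1 *\<^sub>R i)) *\<^sub>R b) = 0"
      using has_derivative_unique[OF d1 d2] by meson
    then show ?thesis by (simp add: inner_add_right)
  qed
  show pb: "p \<bullet> b \<noteq> 0"
  proof
    assume "p \<bullet> b = 0"
    have "\<forall>i\<in>Basis. p \<bullet> i = 0"
    proof
      fix i :: 'a assume "i \<in> Basis"
      then show "p \<bullet> i = 0" using tangent[of i] \<open>p \<bullet> b = 0\<close> by (cases "i = b") simp_all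
    qed
    then show False using p euclidean_all_zero_iff[of p] by blast
  qed
  \<comment> \<open>Both vectors are normal to the graph, and comparing \<open>b\<close>-components
    gives the factor. As \<open>\<phi>' v\<close> is orthogonal to \<open>b\<close>, the norm of the
    left side is the area factor by Pythagoras.\<close>
  have "\<phi>' v - b = (- 1 / (p \<bullet> b)) *\<^sub>R p"
  proof (rule euclidean_eqI)
    fix i :: 'a assume i: "i \<in> Basis"
    show "(\<phi>' v - b) \<bullet> i = (- 1 / (p \<bullet> b)) *\<^sub>R p \<bullet> i"
    proof (cases "i = b")
      case True then show ?thesis using \<phi>'b pb bb by (simp add: inner_diff_left)
    next
      case False
      then have "b \<bullet> i = 0" using i b by (simp add: inner_Basis)
      then show ?thesis using tangent[OF i False] pb by (simp add: inner_diff_left field_simps)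
    qed
  qed
  then have "norm (\<phi>' v - b) = norm p / \<bar>p \<bullet> b\<bar>" by simp
  moreover have "norm (\<phi>' v - b) = sqrt (1 + (norm (\<phi>' v))\<^sup>2)"
    unfolding norm_eq_sqrt_inner using \<phi>'b bb
    by (simp add: inner_diff_left inner_diff_right inner_commute add.commute)
  ultimately show "sqrt (1 + (norm (\<phi>' v))\<^sup>2) = norm p / \<bar>p \<bullet> b\<bar>" by simp
qed

section \<open>The level set in a chart as a graph patch\<close>

context level_chart begin

text \<open>Inverse function theorem. The derivative of \<open>\<Phi>\<close> alters only the
  \<open>b\<close>-component, so its inverse does too; the correction along \<open>b\<close> is
  fixed by requiring that \<open>dP y\<close> sends the result to
  \<open>d \<bullet> b\<close>.\<close>

lemma \<Psi>_has_derivative: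
  assumes y: "y \<in> W"
  shows "(\<Psi> has_derivative (\<lambda>d. d + ((d \<bullet> b - dP y \<bullet> d) / (dP y \<bullet> b)) *\<^sub>R b)) (at (\<Phi> y))"
proof (rule has_derivative_inverse_strong[OF open_W y cont_\<Phi>])
  show "(\<Phi> has_derivative (\<lambda>d. d + (dP y \<bullet> d - d \<bullet> b) *\<^sub>R b)) (at y)"
    unfolding \<Phi>_def by (auto intro!: derivative_eq_intros deriv y)
  have "dP y \<bullet> b \<noteq> 0" using e_abs[OF y] m_pos by auto
  then have "dP y \<bullet> (d + k *\<^sub>R b) = d \<bullet> b" if "k = (d \<bullet> b - dP y \<bullet> d) / (dP y \<bullet> b)" for d k
    using that by (simp add: inner_add_right)
  then show "(\<lambda>d. d + (dP y \<bullet> d - d \<bullet> b) *\<^sub>R b) \<circ> (\<lambda>d. d + ((d \<bullet> b - dP y \<bullet> d) / (dP y \<bullet> b)) *\<^sub>R b) = id"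
    by (simp add: fun_eq_iff inner_add_left scaleR_diff_left scaleR_add_left)
qed simp

lemma chart_graph_patch:
  assumes S: "\<And>y. y \<in> W \<Longrightarrow> P y = x \<Longrightarrow> y \<in> S"
  shows "graph_patch S b {v. v \<bullet> b = 0 \<and> v + x *\<^sub>R b \<in> \<Phi> ` W} (\<lambda>v. \<Psi> (pt v x) \<bullet> b)
    (\<lambda>v. b - (1 / (dP (\<Psi> (pt v x)) \<bullet> b)) *\<^sub>R dP (\<Psi> (pt v x)))" (is "graph_patch S b ?U ?\<phi> ?\<phi>'")
  unfolding graph_patch_def
proof (intro conjI ballI)
  have nz: "dP y \<bullet> b \<noteq> 0" if "y \<in> W" for y using e_abs[OF that] m_pos by auto
  show "openin (top_of_set {v. v \<bullet> b = 0}) ?U"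
  proof -
    have "open ((\<lambda>v. pt v x) -` (\<Phi> ` W))"
      by (intro open_vimage open_\<Phi>W continuous_intros)
    moreover have "?U = {v. v \<bullet> b = 0} \<inter> (\<lambda>v. pt v x) -` (\<Phi> ` W)" by auto
    ultimately show ?thesis by (auto simp: openin_open)
  qed
  have c\<Psi>: "continuous_on ?U (\<lambda>v. \<Psi> (pt v x))"
    by (rule continuous_on_compose2[OF cont_\<Psi>]) (auto intro!: continuous_intros)
  have "continuous_on ?U (\<lambda>v. dP (\<Psi> (pt v x)))"
    by (rule continuous_on_compose2[OF cont_dP c\<Psi>]) (use \<Psi>_in in blast)
  then show "continuous_on ?U ?\<phi>'"
    using nz \<Psi>_in by (intro continuous_intros) auto
  show "(\<lambda>v. v + ?\<phi> v *\<^sub>R b) ` ?U \<subseteq> S"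
    using \<Psi>_line \<Psi>_in S by (auto simp flip: \<Psi>_line(1))
  fix v assume v: "v \<in> ?U"
  define y where "y = \<Psi> (pt v x)"
  have y: "y \<in> W" "\<Phi> y = pt v x" using v \<Psi>_in by (auto simp: y_def)
  show "?\<phi>' v \<bullet> b = 0"
    using nz[OF y(1)] by (simp add: inner_diff_left y_def)
  \<comment> \<open>Derivatives within the hyperplane are not unique, and \<open>graph_patch\<close>
    wants the one that kills \<open>b\<close>. Composing with the projection, which changes nothing
    on the hyperplane, singles it out.\<close>
  have "((\<lambda>v. \<Psi> ((v - (v \<bullet> b) *\<^sub>R b) + x *\<^sub>R b) \<bullet> b) has_derivative
      (\<lambda>d. ((d - (d \<bullet> b) *\<^sub>R b) + (((d - (d \<bullet> b) *\<^sub>R b) \<bullet> b - dP y \<bullet> (d - (d \<bullet> b) *\<^sub>R b)) / (dP y \<bullet> b)) *\<^sub>R b) \<bullet> b))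
      (at v within {v. v \<bullet> b = 0})"
  proof -
    have 1: "((\<lambda>v. (v - (v \<bullet> b) *\<^sub>R b) + x *\<^sub>R b) has_derivative (\<lambda>d. d - (d \<bullet> b) *\<^sub>R b)) (at v within {v. v \<bullet> b = 0})"
      by (auto intro!: derivative_eq_intros)
    have 2: "(\<Psi> has_derivative (\<lambda>d. d + ((d \<bullet> b - dP y \<bullet> d) / (dP y \<bullet> b)) *\<^sub>R b)) (at ((v - (v \<bullet> b) *\<^sub>R b) + x *\<^sub>R b))"
      using \<Psi>_has_derivative[OF y(1)] v y(2) by simp
    show ?thesis
      by (rule has_derivative_inner_left[OF has_derivative_compose[OF 1 2]])
  qed
  moreover have "((d - (d \<bullet> b) *\<^sub>R b) + (((d - (d \<bullet> b) *\<^sub>R b) \<bullet> b - dP y \<bullet> (d - (d \<bullet> b) *\<^sub>R b)) / (dP y \<bullet> b)) *\<^sub>R b) \<bullet> b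
      = ?\<phi>' v \<bullet> d" for d
    using nz[OF y(1)]
    by (simp add: inner_add_left inner_diff_left inner_diff_right inner_commute[of b d] field_simps flip: y_def)
  ultimately show "(?\<phi> has_derivative (\<lambda>d. ?\<phi>' v \<bullet> d)) (at v within {v. v \<bullet> b = 0})"
    using v by (auto elim!: has_derivative_transform[rotated 2])
qed (rule b)

text \<open>Patch and chart use the same direction, so the integrands can be compared foot by foot:
  a line meets the level set at most once inside \<open>W\<close>, and the area factor is
  \<open>norm (dP y)\<close> times \<open>q\<close>.\<close>

lemma graph_patch_integral:
  assumes gp: "graph_patch S b U \<phi> \<phi>'" and S: "\<And>y. y \<in> S \<Longrightarrow> P y = x"
    and E: "E \<in> sets borel" "E \<subseteq> (\<lambda>v. v + \<phi> v *\<^sub>R b) ` U" "E \<subseteq> W"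
  shows "(\<integral>\<^sup>+v\<in>U. indicator E (v + \<phi> v *\<^sub>R b) * ennreal (sqrt (1 + (norm (\<phi>' v))\<^sup>2)) \<partial>H)
    = (\<integral>\<^sup>+y. indicator E y * ennreal (norm (dP y)) \<partial>\<tau> x)"
proof -
  have [measurable]: "E \<in> sets borel" by fact
  have "(\<lambda>y. indicator W y *\<^sub>R norm (dP y)) \<in> borel_measurable borel"
    by (intro borel_measurable_continuous_on_indicator continuous_intros cont_dP) (use open_W in auto)
  then have "(\<lambda>y. indicator E y * ennreal (indicator W y *\<^sub>R norm (dP y))) \<in> borel_measurable borel"
    by measurable
  also have "(\<lambda>y. indicator E y * ennreal (indicator W y *\<^sub>R norm (dP y))) = (\<lambda>y. indicator E y * ennreal (norm (dP y)))"
    using E(3) by (auto simp: fun_eq_iff indicator_def)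
  finally have [measurable]: "(\<lambda>y. indicator E y * ennreal (norm (dP y))) \<in> borel_measurable borel" .
  have U: "v \<bullet> b = 0" if "v \<in> U" for v
    using gp that openin_imp_subset unfolding graph_patch_def by blast
  show ?thesis
    unfolding nn_integral_\<tau>[OF \<open>(\<lambda>y. indicator E y * ennreal (norm (dP y))) \<in> borel_measurable borel\<close>]
  proof (rule nn_integral_cong_AE)
    show "AE v in H.
      indicator E (v + \<phi> v *\<^sub>R b) * ennreal (sqrt (1 + (norm (\<phi>' v))\<^sup>2)) * indicator U v =
      ennreal (q (pt v x)) * (indicator E (\<Psi>0 (pt v x)) * ennreal (norm (dP (\<Psi>0 (pt v x)))))"
      using AE_hyperplane_lborel[OF b]
    proof eventually_elim
      case (elim v)
      show ?case
      proof (cases "v \<in> U \<and> v + \<phi> v *\<^sub>R b \<in> E")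
        case True
        define y where "y = v + \<phi> v *\<^sub>R b"
        have y: "y \<in> W" "y \<in> E" using True E(3) by (auto simp: y_def)
        have "y \<in> S" using gp True by (auto simp: graph_patch_def y_def)
        then have Py: "P y = x" by (rule S)
        have \<Phi>y: "pt v x = \<Phi> y" using \<Phi>_line[OF elim, of "\<phi> v"] Py by (simp add: y_def)
        have nz: "dP y \<bullet> b \<noteq> 0" "dP y \<noteq> 0" using e_abs[OF y(1)] m_pos by auto
        have "sqrt (1 + (norm (\<phi>' v))\<^sup>2) = norm (dP y) / \<bar>dP y \<bullet> b\<bar>"
          using graph_patch_gradient(2)[OF gp S _ deriv[OF y(1)[unfolded y_def]]] True nz by (auto simp: y_def)
        moreover have "q (pt v x) = 1 / \<bar>dP y \<bullet> b\<bar>" "\<Psi>0 (pt v x) = y"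
          using y by (auto simp: q_def \<Psi>0_def \<Phi>y)
        ultimately show ?thesis
          using True y by (simp add: y_def[symmetric] ennreal_mult'[symmetric])
      next
        case False
        \<comment> \<open>Otherwise the chart point lies in \<open>E\<close>, hence on the patch
          over some \<open>v'\<close>; comparing components orthogonal to \<open>b\<close> gives
          \<open>v' = v\<close>, against the case assumption.\<close>
        have "q (pt v x) = 0 \<or> \<Psi>0 (pt v x) \<notin> E"
        proof (rule ccontr)
          assume "\<not> ?thesis"
          then have *: "pt v x \<in> \<Phi> ` W" "\<Psi> (pt v x) \<in> E" by (auto simp: q_def \<Psi>0_def split: if_splits)
          then obtain v' where v': "v' \<in> U" "\<Psi> (pt v x) = v' + \<phi> v' *\<^sub>R b" using E(2) by blast
          have eq: "v + (\<Psi> (pt v x) \<bullet> b) *\<^sub>R b = v' + \<phi> v' *\<^sub>R b"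
            using \<Psi>_line(1)[OF elim *(1)] v'(2) by simp
          then have "\<Psi> (pt v x) \<bullet> b = \<phi> v'"
            using U[OF v'(1)] elim by (metis add_0 bb(1) inner_add_left inner_scaleR_left mult.right_neutral)
          then have "v = v'" using eq by simp
          then show False using False v' *(2) by simp
        qed
        then show ?thesis using False by auto
      qed
    qed
  qed
qed

end

subsection \<open>The surface measure of a level set\<close>

lemma suminf_emeasure_cover:
  fixes W :: "nat \<Rightarrow> 'a set"
  assumes W: "\<And>i. W i \<in> sets M" and E: "E \<in> sets M" "E \<subseteq> (\<Union>i. W i)"
  shows "(\<Sum>i. emeasure M (E \<inter> disjointed W i)) = emeasure M E"
proof -
  have D: "disjointed W i \<in> sets M" for i
    using sets.range_disjointed_sets[of W M] W by auto
  have "(\<Sum>i. emeasure M (E \<inter> disjointed W i)) = emeasure M (\<Union>i. E \<inter> disjointed W i)"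
    using D E(1) disjoint_family_disjointed[of W]
    by (intro suminf_emeasure) (auto simp: disjoint_family_on_def)
  also have "(\<Union>i. E \<inter> disjointed W i) = E"
    using E(2) UN_disjointed_eq[of W] by auto
  finally show ?thesis .
qed

lemma emeasure_eq_on_cover:
  fixes W :: "nat \<Rightarrow> 'a set"
  assumes sets: "sets M = sets N" and W: "\<And>i. W i \<in> sets M" and E: "E \<in> sets M" "E \<subseteq> (\<Union>i. W i)"
    and eq: "\<And>i A. A \<in> sets M \<Longrightarrow> A \<subseteq> E \<Longrightarrow> A \<subseteq> W i \<Longrightarrow> emeasure M A = emeasure N A"
  shows "emeasure M E = emeasure N E"
proof -
  have "emeasure M (E \<inter> disjointed W i) = emeasure N (E \<inter> disjointed W i)" for i
    using sets.range_disjointed_sets[of W M] W E(1) disjointed_subset[of W i]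
    by (intro eq[of _ i]) auto
  then show ?thesis
    using suminf_emeasure_cover[OF W E] suminf_emeasure_cover[of W N E] sets W E by simp
qed

text \<open>Each \<open>M i\<close> is used only on its disjoint share \<open>D i\<close> of the
  cover. Countable additivity then amounts to exchanging two nonnegative series.\<close>

lemma measure_glue:
  fixes M :: "nat \<Rightarrow> 'a measure" and W :: "nat \<Rightarrow> 'a set"
  assumes sets: "\<And>i. sets (M i) = sets N" and W: "\<And>i. W i \<in> sets N"
    and agree: "\<And>i j E. E \<in> sets N \<Longrightarrow> E \<subseteq> W i \<inter> W j \<Longrightarrow> emeasure (M i) E = emeasure (M j) E"
  obtains T where "sets T = sets N"
    "\<And>i E. E \<in> sets N \<Longrightarrow> E \<subseteq> W i \<Longrightarrow> emeasure T E = emeasure (M i) E"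
proof -
  define D where "D = disjointed W"
  have D: "D i \<in> sets N" "D i \<subseteq> W i" for i
    using sets.range_disjointed_sets[of W N] W disjointed_subset[of W i] by (auto simp: D_def)
  define \<mu> where "\<mu> E = (\<Sum>i. emeasure (M i) (E \<inter> D i))" for E
  define T where "T = measure_of (space N) (sets N) \<mu>"
  have T: "emeasure T E = \<mu> E" if "E \<in> sets N" for E
    unfolding T_def
  proof (rule emeasure_measure_of_sigma)
    show "sigma_algebra (space N) (sets N)" ..
    show "positive (sets N) \<mu>" by (simp add: positive_def \<mu>_def)
    show "countably_additive (sets N) \<mu>"
    proof (rule countably_additiveI)
      fix A :: "nat \<Rightarrow> 'a set" assume A: "range A \<subseteq> sets N" "disjoint_family A" "(\<Union>i. A i) \<in> sets N"
      have "\<mu> (\<Union>k. A k) = (\<Sum>i. emeasure (M i) (\<Union>k. A k \<inter> D i))"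
        by (simp add: \<mu>_def)
      also have "\<dots> = (\<Sum>i. \<Sum>k. emeasure (M i) (A k \<inter> D i))"
      proof (intro suminf_cong suminf_emeasure[symmetric])
        show "range (\<lambda>k. A k \<inter> D i) \<subseteq> sets (M i)" for i using A(1) D(1) sets by auto
        show "disjoint_family (\<lambda>k. A k \<inter> D i)" for i using A(2) by (auto simp: disjoint_family_on_def)
      qed
      also have "\<dots> = (\<Sum>k. \<Sum>i. emeasure (M i) (A k \<inter> D i))"
        using nn_integral_suminf[of "\<lambda>k i. emeasure (M i) (A k \<inter> D i)" "count_space UNIV"]
        by (simp only: nn_integral_count_space_nat borel_measurable_count_space)
      finally show "(\<Sum>k. \<mu> (A k)) = \<mu> (\<Union>k. A k)" by (simp add: \<mu>_def)
    qed
  qed (rule that)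
  show ?thesis
  proof (rule that[of T])
    show "sets T = sets N" by (simp add: T_def sets.sigma_sets_eq sets.space_closed)
    fix i E assume E: "E \<in> sets N" "E \<subseteq> W i"
    have "emeasure (M j) (E \<inter> D j) = emeasure (M i) (E \<inter> D j)" for j
      using E D by (intro agree) auto
    then have "\<mu> E = (\<Sum>j. emeasure (M i) (E \<inter> disjointed W j))" by (simp add: \<mu>_def D_def)
    also have "\<dots> = emeasure (M i) E"
      using E W sets by (intro suminf_emeasure_cover) auto
    finally show "emeasure T E = emeasure (M i) E" using T E by simp
  qed
qed

abbreviation patch_area ::
  "'a::euclidean_space \<Rightarrow> 'a set \<Rightarrow> ('a \<Rightarrow> real) \<Rightarrow> ('a \<Rightarrow> 'a) \<Rightarrow> 'a set \<Rightarrow> ennreal" where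
  "patch_area b U \<phi> \<phi>' E \<equiv>
    (\<integral>\<^sup>+v\<in>U. indicator E (v + \<phi> v *\<^sub>R b) * ennreal (sqrt (1 + (norm (\<phi>' v))\<^sup>2)) \<partial>hyperplane_lborel b)"

text \<open>Comparison over a cover needs countable additivity on both sides, so the right-hand side
  of the defining formula has to be exhibited as a measure.\<close>

lemma graph_patch_measure:
  fixes S :: "'a::euclidean_space set"
  assumes gp: "graph_patch S b U \<phi> \<phi>'"
  obtains N where "sets N = sets borel"
    "\<And>E. E \<in> sets borel \<Longrightarrow> emeasure N E =
      patch_area b U \<phi> \<phi>' E"
proof -
  have U: "openin (top_of_set {v. v \<bullet> b = 0}) U" and c\<phi>': "continuous_on U \<phi>'"
    and \<phi>: "\<And>v. v \<in> U \<Longrightarrow> (\<phi> has_derivative (\<lambda>d. \<phi>' v \<bullet> d)) (at v within {v. v \<bullet> b = 0})"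
    using gp by (auto simp: graph_patch_def)
  have [measurable]: "U \<in> sets borel"
  proof -
    have "closed {v::'a. v \<bullet> b = 0}" by (intro closed_Collect_eq continuous_intros)
    then show ?thesis using U by (auto simp: openin_open)
  qed
  have "continuous_on U \<phi>"
    unfolding continuous_on_eq_continuous_within
    using has_derivative_continuous[OF \<phi>] openin_imp_subset[OF U] by (meson continuous_within_subset)
  then have "(\<lambda>v. indicator U v *\<^sub>R (v + \<phi> v *\<^sub>R b)) \<in> borel_measurable borel"
    by (intro borel_measurable_continuous_on_indicator continuous_intros) auto
  moreover have "(\<lambda>v. indicator U v *\<^sub>R (v + \<phi> v *\<^sub>R b)) = (\<lambda>v. if v \<in> U then v + \<phi> v *\<^sub>R b else 0)"
    by (auto simp: fun_eq_iff)
  ultimately have \<gamma> [measurable]: "(\<lambda>v. if v \<in> U then v + \<phi> v *\<^sub>R b else 0) \<in> borel_measurable borel" by simp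
  have "(\<lambda>v. indicator U v *\<^sub>R sqrt (1 + (norm (\<phi>' v))\<^sup>2)) \<in> borel_measurable borel"
    by (intro borel_measurable_continuous_on_indicator continuous_intros c\<phi>') auto
  then have [measurable]: "(\<lambda>v. indicator U v * sqrt (1 + (norm (\<phi>' v))\<^sup>2)) \<in> borel_measurable borel"
    by simp
  define N where "N = distr (density (hyperplane_lborel b) (\<lambda>v. ennreal (indicator U v * sqrt (1 + (norm (\<phi>' v))\<^sup>2)))) borel
    (\<lambda>v. if v \<in> U then v + \<phi> v *\<^sub>R b else 0)"
  show ?thesis
  proof (rule that[of N])
    show "sets N = sets borel" by (simp add: N_def)
    fix E :: "'a set" assume [measurable]: "E \<in> sets borel"
    have "emeasure N E = (\<integral>\<^sup>+y. indicator E y \<partial>N)" by (simp add: N_def)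
    also have "\<dots> = (\<integral>\<^sup>+v. ennreal (indicator U v * sqrt (1 + (norm (\<phi>' v))\<^sup>2)) *
         indicator E (if v \<in> U then v + \<phi> v *\<^sub>R b else 0) \<partial>hyperplane_lborel b)"
      unfolding N_def by (simp add: nn_integral_distr nn_integral_density del: nn_integral_indicator)
    also have "\<dots> = patch_area b U \<phi> \<phi>' E"
      by (intro nn_integral_cong) (auto simp: indicator_def)
    finally show "emeasure N E = \<dots>" .
  qed
qed

text \<open>The cover condition is per direction, because a graph patch is compared with charts in its own
  direction. Charts may be empty.\<close>

locale level_atlas =
  fixes G :: "'a::euclidean_space set" and P :: "'a \<Rightarrow> real" and dP :: "'a \<Rightarrow> 'a"
    and W :: "nat \<Rightarrow> 'a set" and bs :: "nat \<Rightarrow> 'a" and es ms Ls :: "nat \<Rightarrow> real"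
  assumes open_G: "open G"
    and deriv_G: "\<And>y. y \<in> G \<Longrightarrow> (P has_derivative (\<lambda>d. dP y \<bullet> d)) (at y)"
    and dP_nz: "\<And>y. y \<in> G \<Longrightarrow> dP y \<noteq> 0"
    and chart: "\<And>i. level_chart P dP (W i) (bs i) (es i) (ms i) (Ls i)"
    and W_G: "\<And>i. W i \<subseteq> G"
    and cover: "\<And>b y. b \<in> Basis \<Longrightarrow> y \<in> G \<Longrightarrow> dP y \<bullet> b \<noteq> 0 \<Longrightarrow> \<exists>i. bs i = b \<and> y \<in> W i"
begin

sublocale C: level_chart P dP "W i" "bs i" "es i" "ms i" "Ls i" for i
  by (rule chart)

abbreviation S :: "real \<Rightarrow> 'a set" where "S \<equiv> level_surface G P"

section \<open>Existence and uniqueness of the surface measure\<close>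

definition is_surface_measure :: "real \<Rightarrow> 'a measure \<Rightarrow> bool" where
  "is_surface_measure x \<sigma> \<longleftrightarrow> sets \<sigma> = sets (restrict_space borel (S x)) \<and>
     (\<forall>b U \<phi> \<phi>' E. graph_patch (S x) b U \<phi> \<phi>' \<and> E \<in> sets borel \<and> E \<subseteq> (\<lambda>v. v + \<phi> v *\<^sub>R b) ` U \<longrightarrow>
        emeasure \<sigma> E = patch_area b U \<phi> \<phi>' E)"

lemma is_surface_measureD:
  assumes "is_surface_measure x \<sigma>" "graph_patch (S x) b U \<phi> \<phi>'" "E \<in> sets borel" "E \<subseteq> (\<lambda>v. v + \<phi> v *\<^sub>R b) ` U"
  shows "emeasure \<sigma> E = patch_area b U \<phi> \<phi>' E"
  using assms unfolding is_surface_measure_def by blast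

lemma S_level: "y \<in> S x \<Longrightarrow> P y = x" and S_G: "S x \<subseteq> G"
  by (auto simp: level_surface_def)

lemma W_borel [measurable]: "W i \<in> sets borel"
  using C.open_W by simp

lemma cont_P_G: "continuous_on G P"
  by (meson deriv_G has_derivative_continuous continuous_at_imp_continuous_on)

lemma S_borel [measurable]: "S x \<in> sets borel"
proof -
  have "closedin (top_of_set G) (G \<inter> P -` {x})"
    by (rule continuous_closedin_preimage[OF cont_P_G]) simp
  then obtain T where "closed T" "G \<inter> P -` {x} = G \<inter> T" by (auto simp: closedin_closed)
  moreover have "S x = G \<inter> P -` {x}" by (auto simp: level_surface_def)
  ultimately show ?thesis using open_G by simp
qed

lemma G_cover: "G \<subseteq> (\<Union>i. W i)"
proof
  fix y assume y: "y \<in> G"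
  then obtain b where "b \<in> Basis" "dP y \<bullet> b \<noteq> 0" using dP_nz euclidean_all_zero_iff[of "dP y"] by blast
  then show "y \<in> (\<Union>i. W i)" using cover[OF _ y] by blast
qed

lemma dP_borel [measurable]: "(\<lambda>y. indicator (W i) y *\<^sub>R dP y) \<in> borel_measurable borel"
  by (intro borel_measurable_continuous_on_indicator C.cont_dP) simp

text \<open>The level measure divides the surface element by the norm of the gradient; multiplying
  the chart measure by that norm undoes this. The indicator keeps the density Borel.\<close>

definition \<sigma>_chart :: "nat \<Rightarrow> real \<Rightarrow> 'a measure" where
  "\<sigma>_chart i x = density (C.\<tau> i x) (\<lambda>y. ennreal (norm (indicator (W i) y *\<^sub>R dP y)))"

lemma sets_\<sigma>_chart [simp]: "sets (\<sigma>_chart i x) = sets borel"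
  by (simp add: \<sigma>_chart_def)

lemma emeasure_\<sigma>_chart:
  assumes "E \<in> sets borel" "E \<subseteq> W i"
  shows "emeasure (\<sigma>_chart i x) E = (\<integral>\<^sup>+y. indicator E y * ennreal (norm (dP y)) \<partial>C.\<tau> i x)"
  using assms unfolding \<sigma>_chart_def
  by (subst emeasure_density, measurable) (auto intro!: nn_integral_cong simp: indicator_def)

lemma \<sigma>_chart_agree:
  assumes E: "E \<in> sets borel" "E \<subseteq> W i \<inter> W j"
  shows "emeasure (\<sigma>_chart i x) E = emeasure (\<sigma>_chart j x) E"
proof -
  have [measurable]: "E \<in> sets borel" by fact
  have eq: "density (C.\<tau> i x) (indicator E) = density (C.\<tau> j x) (indicator E)"
  proof (rule measure_eqI)
    fix A assume "A \<in> sets (density (C.\<tau> i x) (indicator E))"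
    then have A: "A \<in> sets borel" by simp
    then have "emeasure (C.\<tau> i x) (E \<inter> A) = emeasure (C.\<tau> j x) (E \<inter> A)"
      using E by (intro slice_measures_agree[OF chart chart]) auto
    then show "emeasure (density (C.\<tau> i x) (indicator E)) A = emeasure (density (C.\<tau> j x) (indicator E)) A"
      using A by (subst (1 2) emeasure_density) (auto simp flip: indicator_inter_arith)
  qed simp
  have "(\<integral>\<^sup>+y. indicator E y * ennreal (norm (dP y)) \<partial>C.\<tau> k x)
      = (\<integral>\<^sup>+y. ennreal (norm (indicator (W i) y *\<^sub>R dP y)) \<partial>density (C.\<tau> k x) (indicator E))" for k
    using E(2) by (subst nn_integral_density, measurable) (auto intro!: nn_integral_cong simp: indicator_def)
  then show ?thesis
    using E eq by (simp add: emeasure_\<sigma>_chart)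
qed

text \<open>At a point of a patch in direction \<open>b\<close> the gradient has nonzero
  \<open>b\<close>-component, so the charts in direction \<open>b\<close> already cover the patch,
  and each can be compared with it directly. Charts in other directions are replaced by the empty
  set.\<close>

lemma patch_formula_eq:
  assumes gp: "graph_patch (S x) b U \<phi> \<phi>'" and E: "E \<in> sets borel" "E \<subseteq> (\<lambda>v. v + \<phi> v *\<^sub>R b) ` U"
    and T: "sets T = sets borel"
      "\<And>i E. E \<in> sets borel \<Longrightarrow> E \<subseteq> W i \<Longrightarrow> emeasure T E = emeasure (\<sigma>_chart i x) E"
  shows "emeasure T E = patch_area b U \<phi> \<phi>' E"
proof -
  obtain N where N: "sets N = sets borel"
    "\<And>E. E \<in> sets borel \<Longrightarrow> emeasure N E =
      patch_area b U \<phi> \<phi>' E"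
    using graph_patch_measure[OF gp] by blast
  have b: "b \<in> Basis" and im: "(\<lambda>v. v + \<phi> v *\<^sub>R b) ` U \<subseteq> S x"
    using gp by (auto simp: graph_patch_def)
  have "emeasure T E = emeasure N E"
  proof (rule emeasure_eq_on_cover[where W = "\<lambda>i. if bs i = b then W i else {}"])
    show "E \<subseteq> (\<Union>i. if bs i = b then W i else {})"
    proof
      fix y assume "y \<in> E"
      then obtain v where v: "v \<in> U" "y = v + \<phi> v *\<^sub>R b" using E(2) by blast
      then have "y \<in> G" using im S_G by blast
      then have "dP y \<bullet> b \<noteq> 0"
        using graph_patch_gradient(1)[OF gp _ v(1) deriv_G[of "v + \<phi> v *\<^sub>R b"]] S_level dP_nz v(2) by blast
      then show "y \<in> (\<Union>i. if bs i = b then W i else {})"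
        using cover[OF b \<open>y \<in> G\<close>] by force
    qed
    fix i A assume A: "A \<in> sets T" "A \<subseteq> E" "A \<subseteq> (if bs i = b then W i else {})"
    show "emeasure T A = emeasure N A"
    proof (cases "bs i = b")
      case True
      then have "A \<subseteq> W i" using A by simp
      then show ?thesis
        using C.graph_patch_integral[of "S x" i U \<phi> \<phi>' x A] gp True A E T S_level
        by (simp add: N(2) emeasure_\<sigma>_chart)
    qed (use A in simp)
  qed (use E N T in auto)
  then show ?thesis using N(2) E by simp
qed

text \<open>Chart pieces are themselves patches, so the defining formula prescribes the surface
  measure on every Borel set inside one. Uniqueness rests on this.\<close>

lemma own_patch:
  assumes E: "E \<in> sets borel" "E \<subseteq> W i \<inter> S x"
  obtains b U \<phi> \<phi>' where "graph_patch (S x) b U \<phi> \<phi>'" "E \<subseteq> (\<lambda>v. v + \<phi> v *\<^sub>R b) ` U"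
proof (rule that)
  let ?U = "{v. v \<bullet> bs i = 0 \<and> v + x *\<^sub>R bs i \<in> C.\<Phi> i ` W i}"
  let ?\<gamma> = "\<lambda>v. v + (C.\<Psi> i (v + x *\<^sub>R bs i) \<bullet> bs i) *\<^sub>R bs i"
  show "graph_patch (S x) (bs i) ?U (\<lambda>v. C.\<Psi> i (v + x *\<^sub>R bs i) \<bullet> bs i)
    (\<lambda>v. bs i - (1 / (dP (C.\<Psi> i (v + x *\<^sub>R bs i)) \<bullet> bs i)) *\<^sub>R dP (C.\<Psi> i (v + x *\<^sub>R bs i)))"
    by (rule C.chart_graph_patch) (use W_G in \<open>auto simp: level_surface_def\<close>)
  show "E \<subseteq> ?\<gamma> ` ?U"
  proof
    fix y assume "y \<in> E"
    then have y: "y \<in> W i" "P y = x" using E S_level by auto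
    define v where "v = y - (y \<bullet> bs i) *\<^sub>R bs i"
    have v: "v \<bullet> bs i = 0" using C.proj_orthogonal by (simp add: v_def)
    have yv: "y = v + (y \<bullet> bs i) *\<^sub>R bs i" by (simp add: v_def)
    have "C.\<Phi> i y = v + x *\<^sub>R bs i"
      using C.\<Phi>_line[OF v, of "y \<bullet> bs i"] y(2) yv by simp
    then have mem: "v + x *\<^sub>R bs i \<in> C.\<Phi> i ` W i" and "C.\<Psi> i (v + x *\<^sub>R bs i) = y"
      using y(1) C.\<Psi>_\<Phi>[OF y(1)] by (metis imageI, metis)
    then have "y = v + (C.\<Psi> i (v + x *\<^sub>R bs i) \<bullet> bs i) *\<^sub>R bs i" using yv by metis
    then show "y \<in> ?\<gamma> ` ?U"
      using mem v by blast
  qed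
qed

lemma ex1_surface_measure: "\<exists>!\<sigma>. is_surface_measure x \<sigma>"
proof (rule ex_ex1I)
  obtain T where T: "sets T = sets borel"
    "\<And>i E. E \<in> sets borel \<Longrightarrow> E \<subseteq> W i \<Longrightarrow> emeasure T E = emeasure (\<sigma>_chart i x) E"
    by (rule measure_glue[of "\<lambda>i. \<sigma>_chart i x" borel W]) (auto intro: \<sigma>_chart_agree)
  show "\<exists>\<sigma>. is_surface_measure x \<sigma>"
  \<comment> \<open>The glued measure lives on the whole space, whereas the description asks for one
    with the level surface as its space.\<close>
  proof (intro exI[of _ "restrict_space T (S x)"], unfold is_surface_measure_def, intro conjI allI impI)
    show "sets (restrict_space T (S x)) = sets (restrict_space borel (S x))"
      using T(1) by (rule sets_restrict_space_cong)
    fix b U \<phi> \<phi>' E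
    assume *: "graph_patch (S x) b U \<phi> \<phi>' \<and> E \<in> sets borel \<and> E \<subseteq> (\<lambda>v. v + \<phi> v *\<^sub>R b) ` U"
    then have gp: "graph_patch (S x) b U \<phi> \<phi>'" and E: "E \<in> sets borel" "E \<subseteq> (\<lambda>v. v + \<phi> v *\<^sub>R b) ` U"
      by auto
    have "E \<subseteq> S x" using gp E(2) unfolding graph_patch_def by blast
    then have "emeasure (restrict_space T (S x)) E = emeasure T E"
      using T by (intro emeasure_restrict_space) (auto dest: sets_eq_imp_space_eq)
    then show "emeasure (restrict_space T (S x)) E =
      patch_area b U \<phi> \<phi>' E"
      using patch_formula_eq[OF gp E T] by (rule trans)
  qed
next
  fix \<sigma> \<sigma>' assume s: "is_surface_measure x \<sigma>" "is_surface_measure x \<sigma>'"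
  show "\<sigma> = \<sigma>'"
  proof (rule measure_eqI)
    have ss: "sets \<sigma> = sets (restrict_space borel (S x))" "sets \<sigma>' = sets (restrict_space borel (S x))"
      using s unfolding is_surface_measure_def by blast+
    then show "sets \<sigma> = sets \<sigma>'" by simp
    fix E assume "E \<in> sets \<sigma>"
    then have E: "E \<in> sets borel" "E \<subseteq> S x" "E \<in> sets \<sigma>"
      using ss by (auto simp: sets_restrict_space_iff)
    show "emeasure \<sigma> E = emeasure \<sigma>' E"
    proof (rule emeasure_eq_on_cover[where W = "\<lambda>i. W i \<inter> S x"])
      show "W i \<inter> S x \<in> sets \<sigma>" for i using ss by (auto simp: sets_restrict_space_iff)
      show "E \<subseteq> (\<Union>i. W i \<inter> S x)" 
      proof
        fix y assume "y \<in> E"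
        then have y: "y \<in> S x" using E(2) by (rule subsetD[rotated])
        then have "y \<in> (\<Union>i. W i)" using S_G[of x] G_cover by (meson subsetD)
        then show "y \<in> (\<Union>i. W i \<inter> S x)" using y by simp
      qed
      fix i A assume "A \<in> sets \<sigma>" "A \<subseteq> E" "A \<subseteq> W i \<inter> S x"
      then have A: "A \<in> sets borel" "A \<subseteq> W i \<inter> S x"
        using ss by (auto simp: sets_restrict_space_iff)
      obtain b U \<phi> \<phi>' where gp: "graph_patch (S x) b U \<phi> \<phi>'" "A \<subseteq> (\<lambda>v. v + \<phi> v *\<^sub>R b) ` U"
        using own_patch[OF A] by blast
      show "emeasure \<sigma> A = emeasure \<sigma>' A"
        by (rule trans[OF is_surface_measureD[OF s(1) gp(1) A(1) gp(2)]
              is_surface_measureD[OF s(2) gp(1) A(1) gp(2), symmetric]])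
    qed (use ss E in auto)
  qed
qed

lemma surface_measure: "is_surface_measure x (surface_measure (S x))"
  using theI'[OF ex1_surface_measure[of x]] unfolding is_surface_measure_def surface_measure_def .

lemma sets_surface_measure: "sets (surface_measure (S x)) = sets (restrict_space borel (S x))"
  using surface_measure[of x] unfolding is_surface_measure_def by blast

lemma space_surface_measure: "space (surface_measure (S x)) = S x"
  using sets_eq_imp_space_eq[OF sets_surface_measure] by (simp add: space_restrict_space)

text \<open>The definite description reveals its value only through patches. A glued measure obeys
  the same patch formula, so the two agree on the chart's own patch.\<close>

lemma emeasure_surface_measure:
  assumes E: "E \<in> sets borel" "E \<subseteq> W i \<inter> S x"
  shows "emeasure (surface_measure (S x)) E = emeasure (\<sigma>_chart i x) E"
proof -
  obtain T where T: "sets T = sets borel"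
    "\<And>i E. E \<in> sets borel \<Longrightarrow> E \<subseteq> W i \<Longrightarrow> emeasure T E = emeasure (\<sigma>_chart i x) E"
    by (rule measure_glue[of "\<lambda>i. \<sigma>_chart i x" borel W]) (auto intro: \<sigma>_chart_agree)
  obtain b U \<phi> \<phi>' where gp: "graph_patch (S x) b U \<phi> \<phi>'" "E \<subseteq> (\<lambda>v. v + \<phi> v *\<^sub>R b) ` U"
    using own_patch[OF E] by blast
  have "emeasure (surface_measure (S x)) E = emeasure T E"
    by (rule trans[OF is_surface_measureD[OF surface_measure gp(1) E(1) gp(2)]
          patch_formula_eq[OF gp(1) E(1) gp(2) T, symmetric]])
  then show ?thesis using T(2) E by simp
qed

end

subsection \<open>Integration over level sets\<close>

lemma integral_eq_nn_integral_transfer: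
  fixes f :: "'a \<Rightarrow> real" and g :: "'b \<Rightarrow> real"
  assumes f: "integrable M f" "\<And>y. 0 \<le> f y" and g: "g \<in> borel_measurable N" "\<And>x. 0 \<le> g x"
    and eq: "(\<integral>\<^sup>+y. ennreal (f y) \<partial>M) = (\<integral>\<^sup>+x. ennreal (g x) \<partial>N)"
  shows "integrable N g" "(\<integral>y. f y \<partial>M) = (\<integral>x. g x \<partial>N)"
proof -
  have "(\<integral>\<^sup>+y. ennreal (f y) \<partial>M) = ennreal (\<integral>y. f y \<partial>M)"
    using f by (intro nn_integral_eq_integral) auto
  then have g': "(\<integral>\<^sup>+x. ennreal (g x) \<partial>N) = ennreal (\<integral>y. f y \<partial>M)" using eq by simp
  then show "integrable N g" using g by (intro integrableI_nonneg) auto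
  then have "(\<integral>\<^sup>+x. ennreal (g x) \<partial>N) = ennreal (\<integral>x. g x \<partial>N)"
    using g by (intro nn_integral_eq_integral) auto
  then show "(\<integral>y. f y \<partial>M) = (\<integral>x. g x \<partial>N)"
    using g' f(2) g(2) by (simp add: integral_nonneg)
qed

section \<open>Bochner form of the coarea formula in a chart\<close>

context level_chart begin

lemma measurable_integral_\<tau>:
  fixes f :: "'a \<Rightarrow> 'c::{banach,second_countable_topology}"
  assumes [measurable]: "f \<in> borel_measurable borel"
  shows "(\<lambda>x. \<integral>y. f y \<partial>\<tau> x) \<in> borel_measurable borel"
proof -
  interpret H: sigma_finite_measure H by (rule sigma_finite_hyperplane_lborel[OF b])
  show ?thesis
    unfolding integral_\<tau>[OF assms] by (rule H.borel_measurable_lebesgue_integral) measurable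
qed

lemma integrable_on_W:
  fixes f :: "'a \<Rightarrow> 'c::{banach,second_countable_topology}"
  assumes [measurable]: "f \<in> borel_measurable borel" and M: "\<And>y. norm (f y) \<le> M" and f0: "\<And>y. y \<notin> W \<Longrightarrow> f y = 0"
  shows "integrable lborel f"
proof (rule Bochner_Integration.integrable_bound[of _ "\<lambda>y. indicator W y * M"])
  have "emeasure lborel W < \<infinity>" by (rule emeasure_bounded_finite[OF bounded_W])
  then show "integrable lborel (\<lambda>y. indicator W y * M)"
    using open_W by (intro integrable_mult_left integrable_real_indicator) auto
  show "AE y in lborel. norm (f y) \<le> norm (indicator W y * M)"
    using M f0 by (intro AE_I2) (auto simp: indicator_def intro: order_trans[OF M abs_ge_self])
qed simp

abbreviation slice :: "('a \<Rightarrow> 'c::{banach,second_countable_topology}) \<Rightarrow> real \<Rightarrow> 'c" where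
  "slice f x \<equiv> (\<integral>y. f y \<partial>\<tau> x)"

text \<open>Finiteness of the volume integral makes the slice function integrable; the signed and
  complex versions follow by splitting the integrand.\<close>

lemma coarea_nonneg:
  fixes f :: "'a \<Rightarrow> real"
  assumes f [measurable]: "f \<in> borel_measurable borel" and M: "\<And>y. norm (f y) \<le> M"
    and f0: "\<And>y. y \<notin> W \<Longrightarrow> f y = 0" and nn: "\<And>y. 0 \<le> f y"
  shows "integrable lborel (slice f)" "(\<integral>y. f y \<partial>lborel) = (\<integral>x. slice f x \<partial>lborel)"
proof -
  have "(\<integral>\<^sup>+y. ennreal (f y) \<partial>lborel) = (\<integral>\<^sup>+y. indicator W y * ennreal (f y) \<partial>lborel)"
    using f0 by (intro nn_integral_cong) (auto simp: indicator_def)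
  also have "\<dots> = (\<integral>\<^sup>+x. \<integral>\<^sup>+y. ennreal (f y) \<partial>\<tau> x \<partial>lborel)"
    by (rule nn_coarea) measurable
  also have "\<dots> = (\<integral>\<^sup>+x. ennreal (slice f x) \<partial>lborel)"
    using nn by (intro nn_integral_cong nn_integral_eq_integral integrable_\<tau>_bounded[OF f M]) auto
  finally have eq: "(\<integral>\<^sup>+y. ennreal (f y) \<partial>lborel) = (\<integral>\<^sup>+x. ennreal (slice f x) \<partial>lborel)" .
  note * = integral_eq_nn_integral_transfer[OF integrable_on_W[OF f M f0] nn _ _ eq]
  show "integrable lborel (slice f)" "(\<integral>y. f y \<partial>lborel) = (\<integral>x. slice f x \<partial>lborel)"
    by (rule *; use measurable_integral_\<tau>[OF f] nn in \<open>simp add: integral_nonneg\<close>)+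
qed

lemma coarea_real:
  fixes f :: "'a \<Rightarrow> real"
  assumes f [measurable]: "f \<in> borel_measurable borel" and M: "\<And>y. norm (f y) \<le> M"
    and f0: "\<And>y. y \<notin> W \<Longrightarrow> f y = 0"
  shows "integrable lborel (slice f)" "(\<integral>y. f y \<partial>lborel) = (\<integral>x. slice f x \<partial>lborel)"
proof -
  let ?p = "\<lambda>y. max 0 (f y)" and ?n = "\<lambda>y. max 0 (- f y)"
  have m [measurable]: "?p \<in> borel_measurable borel" "?n \<in> borel_measurable borel" by measurable
  have b: "norm (?p y) \<le> M" "norm (?n y) \<le> M" for y
    using M[of y] by (auto simp: max_def)
  have z: "?p y = 0" "?n y = 0" if "y \<notin> W" for y using f0[OF that] by auto
  have f: "f = (\<lambda>y. ?p y - ?n y)" by (auto simp: fun_eq_iff max_def)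
  have s: "slice f x = (\<integral>y. ?p y \<partial>\<tau> x) - (\<integral>y. ?n y \<partial>\<tau> x)" for x
    by (subst f, rule Bochner_Integration.integral_diff)
       (auto intro!: integrable_\<tau>_bounded[OF m(1) b(1)] integrable_\<tau>_bounded[OF m(2) b(2)])
  have p: "integrable lborel (\<lambda>x. \<integral>y. ?p y \<partial>\<tau> x)" "(\<integral>y. ?p y \<partial>lborel) = (\<integral>x. \<integral>y. ?p y \<partial>\<tau> x \<partial>lborel)"
    using coarea_nonneg[OF m(1) b(1) z(1)] by auto
  have n: "integrable lborel (\<lambda>x. \<integral>y. ?n y \<partial>\<tau> x)" "(\<integral>y. ?n y \<partial>lborel) = (\<integral>x. \<integral>y. ?n y \<partial>\<tau> x \<partial>lborel)"
    using coarea_nonneg[OF m(2) b(2) z(2)] by auto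
  show "integrable lborel (slice f)"
    unfolding s by (intro Bochner_Integration.integrable_diff p n)
  have "(\<integral>y. f y \<partial>lborel) = (\<integral>y. ?p y \<partial>lborel) - (\<integral>y. ?n y \<partial>lborel)"
    by (subst f, rule Bochner_Integration.integral_diff)
       (auto intro!: integrable_on_W[OF m(1) b(1)] integrable_on_W[OF m(2) b(2)] z)
  also have "\<dots> = (\<integral>x. slice f x \<partial>lborel)"
    unfolding s p(2) n(2) by (rule Bochner_Integration.integral_diff[symmetric, OF p(1) n(1)])
  finally show "(\<integral>y. f y \<partial>lborel) = (\<integral>x. slice f x \<partial>lborel)" .
qed

lemma coarea:
  fixes f :: "'a \<Rightarrow> complex"
  assumes f [measurable]: "f \<in> borel_measurable borel" and M: "\<And>y. norm (f y) \<le> M"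
    and f0: "\<And>y. y \<notin> W \<Longrightarrow> f y = 0"
  shows "integrable lborel (slice f)" "(\<integral>y. f y \<partial>lborel) = (\<integral>x. slice f x \<partial>lborel)"
proof -
  have b: "norm (Re (f y)) \<le> M" "norm (Im (f y)) \<le> M" for y
    using order_trans[OF abs_Re_le_cmod M] order_trans[OF abs_Im_le_cmod M] by auto
  have z: "Re (f y) = 0" "Im (f y) = 0" if "y \<notin> W" for y using f0[OF that] by auto
  have i: "integrable (\<tau> x) f" for x by (rule integrable_\<tau>_bounded[OF f M])
  have ii: "integrable lborel f" by (rule integrable_on_W[OF f M f0])
  have R: "integrable lborel (\<lambda>x. \<integral>y. Re (f y) \<partial>\<tau> x)" "(\<integral>y. Re (f y) \<partial>lborel) = (\<integral>x. \<integral>y. Re (f y) \<partial>\<tau> x \<partial>lborel)"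
    using coarea_real[of "\<lambda>y. Re (f y)", OF _ b(1) z(1)] by auto
  have I: "integrable lborel (\<lambda>x. \<integral>y. Im (f y) \<partial>\<tau> x)" "(\<integral>y. Im (f y) \<partial>lborel) = (\<integral>x. \<integral>y. Im (f y) \<partial>\<tau> x \<partial>lborel)"
    using coarea_real[of "\<lambda>y. Im (f y)", OF _ b(2) z(2)] by auto
  have R': "(\<integral>y. Re (f y) \<partial>\<tau> x) = Re (slice f x)" and I': "(\<integral>y. Im (f y) \<partial>\<tau> x) = Im (slice f x)" for x
    using i by (auto simp: integral_Re integral_Im)
  have "(slice f) = (\<lambda>x. complex_of_real (\<integral>y. Re (f y) \<partial>\<tau> x) + \<i> * complex_of_real (\<integral>y. Im (f y) \<partial>\<tau> x))"
    unfolding R' I' by (simp add: fun_eq_iff complex_eq_iff)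
  then show int: "integrable lborel (slice f)"
    using R(1) I(1) by simp
  show "(\<integral>y. f y \<partial>lborel) = (\<integral>x. slice f x \<partial>lborel)"
    using R(2) I(2) integral_Re[OF ii] integral_Re[OF int] integral_Im[OF ii] integral_Im[OF int]
    unfolding R' I' by (intro complex_eqI) simp_all
qed

end

text \<open>Meant for the level measure against a chart measure, which are known to agree only
  inside the chart.\<close>

lemma integral_eq_on_subset:
  fixes f :: "'a \<Rightarrow> 'c::{banach,second_countable_topology}"
  assumes sets: "sets M = sets N" and V: "V \<in> sets N" and f: "f \<in> borel_measurable N"
    and f0: "\<And>y. y \<notin> V \<Longrightarrow> f y = 0"
    and eq: "\<And>E. E \<in> sets N \<Longrightarrow> E \<subseteq> V \<Longrightarrow> emeasure M E = emeasure N E"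
  shows "integrable M f \<longleftrightarrow> integrable N f" "(\<integral>y. f y \<partial>M) = (\<integral>y. f y \<partial>N)"
proof -
  have fM: "f \<in> borel_measurable M" and VM: "V \<in> sets M"
    using f V sets by (auto cong: measurable_cong_sets)
  have "density M (indicator V) = density N (indicator V)"
  proof (rule measure_eqI)
    fix A assume "A \<in> sets (density M (indicator V))"
    then have A: "A \<in> sets N" "A \<in> sets M" using sets by auto
    then have "emeasure M (V \<inter> A) = emeasure N (V \<inter> A)"
      using V by (intro eq) auto
    then show "emeasure (density M (indicator V)) A = emeasure (density N (indicator V)) A"
      using A V VM by (subst (1 2) emeasure_density) (auto simp flip: indicator_inter_arith)
  qed (simp add: sets)
  then have d: "density M (\<lambda>y. ennreal (indicator V y)) = density N (\<lambda>y. ennreal (indicator V y))"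
    by (simp add: ennreal_indicator)
  have f': "(\<lambda>y. indicator V y *\<^sub>R f y) = f" using f0 by (auto simp: fun_eq_iff indicator_def)
  have V': "(indicator V :: _ \<Rightarrow> real) \<in> borel_measurable M" "(indicator V :: _ \<Rightarrow> real) \<in> borel_measurable N"
    using V VM by auto
  show "integrable M f \<longleftrightarrow> integrable N f"
    using integrable_density[OF fM V'(1)] integrable_density[OF f V'(2)] d f' by simp
  show "(\<integral>y. f y \<partial>M) = (\<integral>y. f y \<partial>N)"
    using integral_density[OF fM V'(1)] integral_density[OF f V'(2)] d f' by simp
qed

text \<open>The level measure has the level surface as its space; the identity map pushes it to the
  Borel sets of the whole space, where the chart measures live.\<close>

lemma measurable_id_restrict_space:
  "sets M = sets (restrict_space N V) \<Longrightarrow> (\<lambda>y. y) \<in> measurable M N"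
proof -
  assume a: "sets M = sets (restrict_space N V)"
  have "(\<lambda>y. y) \<in> measurable (restrict_space N V) N"
    by (intro measurable_restrict_space1) simp
  then show ?thesis
    using measurable_cong_sets[OF a refl, of N] by simp
qed

section \<open>The level measure in a chart\<close>

context level_atlas begin

lemma grad_eq: "y \<in> G \<Longrightarrow> grad P y = dP y"
proof -
  assume "y \<in> G"
  then have "frechet_derivative P (at y) = (\<lambda>d. dP y \<bullet> d)"
    using frechet_derivative_at[OF deriv_G] by simp
  then show ?thesis by (simp add: grad_def euclidean_representation)
qed

lemma cont_dP_G: "continuous_on G dP"
proof -
  have "continuous_on (\<Union>i. W i) dP"
    using C.open_W C.cont_dP by (intro continuous_on_open_UN) auto
  then show ?thesis using G_cover by (rule continuous_on_subset)
qed

abbreviation \<mu> :: "real \<Rightarrow> 'a measure" where "\<mu> \<equiv> level_measure G P"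

lemma sets_\<mu>: "sets (\<mu> x) = sets (restrict_space borel (S x))" and space_\<mu>: "space (\<mu> x) = S x"
  by (simp_all add: level_measure_def sets_surface_measure space_surface_measure)

lemma id_measurable_\<mu>: "(\<lambda>y. y) \<in> measurable (\<mu> x) borel"
  by (rule measurable_id_restrict_space[OF sets_\<mu>])

lemma emeasure_surface_W:
  assumes E: "E \<in> sets borel" "E \<subseteq> W i"
  shows "emeasure (surface_measure (S x)) (E \<inter> S x) = emeasure (\<sigma>_chart i x) E"
proof -
  have "emeasure (surface_measure (S x)) (E \<inter> S x) = emeasure (\<sigma>_chart i x) (E \<inter> S x)"
    using E by (intro emeasure_surface_measure) auto
  also have "\<dots> = (\<integral>\<^sup>+y. indicator (E \<inter> S x) y * ennreal (norm (dP y)) \<partial>C.\<tau> i x)"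
    using E by (intro emeasure_\<sigma>_chart) auto
  also have "\<dots> = (\<integral>\<^sup>+y. indicator E y * ennreal (norm (dP y)) \<partial>C.\<tau> i x)"
  proof (rule nn_integral_cong_AE)
    show "AE y in C.\<tau> i x. indicator (E \<inter> S x) y * ennreal (norm (dP y)) = indicator E y * ennreal (norm (dP y))"
      using C.AE_\<tau>[of i x]
    proof eventually_elim
      case (elim y)
      then have "y \<in> S x" using W_G by (auto simp: level_surface_def)
      then show ?case by (simp add: indicator_def)
    qed
  qed
  also have "\<dots> = emeasure (\<sigma>_chart i x) E"
    using E by (intro emeasure_\<sigma>_chart[symmetric]) auto
  finally show ?thesis .
qed

text \<open>The gradient norm in \<open>\<sigma>_chart\<close> cancels against its reciprocal in
  \<open>level_measure\<close>, which leaves the chart measure.\<close>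

lemma emeasure_\<mu>_W:
  assumes E: "E \<in> sets borel" "E \<subseteq> W i"
  shows "emeasure (distr (\<mu> x) borel (\<lambda>y. y)) E = emeasure (C.\<tau> i x) E"
proof -
  have [measurable]: "E \<in> sets borel" by fact
  define \<sigma> where "\<sigma> = surface_measure (S x)"
  have \<sigma>: "sets \<sigma> = sets (restrict_space borel (S x))" "space \<sigma> = S x"
    by (simp_all add: \<sigma>_def sets_surface_measure space_surface_measure)
  have id: "(\<lambda>y. y) \<in> measurable \<sigma> borel"
    by (rule measurable_id_restrict_space[OF \<sigma>(1)])
  define k where "k y = indicator G y * (1 / norm (dP y))" for y
  have "(\<lambda>y. indicator G y *\<^sub>R (1 / norm (dP y))) \<in> borel_measurable borel"
    using dP_nz open_G cont_dP_G
    by (intro borel_measurable_continuous_on_indicator continuous_intros) auto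
  then have k [measurable]: "k \<in> borel_measurable borel" by (simp add: k_def[abs_def])
  have k\<sigma>: "k \<in> borel_measurable \<sigma>" using measurable_compose[OF id k] .
  have gk: "1 / norm (grad P y) = k y" if "y \<in> S x" for y
    using that S_G by (auto simp: k_def grad_eq indicator_def)
  have \<mu>: "\<mu> x = density \<sigma> (\<lambda>y. ennreal (k y))"
    unfolding level_measure_def \<sigma>_def[symmetric]
  proof (rule density_cong)
    show "(\<lambda>y. ennreal (1 / norm (grad P y))) \<in> borel_measurable \<sigma>"
      using k\<sigma> gk \<sigma>(2) by (subst measurable_cong[of _ _ "\<lambda>y. ennreal (k y)"]) auto
  qed (use k\<sigma> gk \<sigma>(2) in auto)
  have k\<sigma>': "(\<lambda>y. ennreal (k y)) \<in> borel_measurable \<sigma>"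
    by (rule measurable_compose[OF k\<sigma> measurable_ennreal])
  have ind: "(indicator E :: _ \<Rightarrow> ennreal) \<in> borel_measurable \<sigma>"
    by (rule measurable_compose[OF id]) simp
  let ?\<mu> = "distr (\<mu> x) borel (\<lambda>y. y)" and ?\<sigma> = "distr \<sigma> borel (\<lambda>y. y)"
  let ?\<sigma>W = "density ?\<sigma> (indicator (W i))"
  have "emeasure ?\<mu> E = (\<integral>\<^sup>+y. indicator E y \<partial>?\<mu>)"
    by simp
  also have "\<dots> = (\<integral>\<^sup>+y. indicator E y \<partial>\<mu> x)"
    using id_measurable_\<mu> by (intro nn_integral_distr) auto
  also have "\<dots> = (\<integral>\<^sup>+y. ennreal (k y) * indicator E y \<partial>\<sigma>)"
    unfolding \<mu> by (rule nn_integral_density[OF k\<sigma>' ind])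
  also have "\<dots> = (\<integral>\<^sup>+y. ennreal (k y) * indicator E y \<partial>?\<sigma>)"
    using id by (intro nn_integral_distr[symmetric]) auto
  \<comment> \<open>Inside \<open>W i\<close> the surface measure is known to be
    \<open>\<sigma>_chart i x\<close>, so it is first cut down to \<open>W i\<close>.\<close>
  also have "\<dots> = (\<integral>\<^sup>+y. ennreal (k y) * indicator E y \<partial>?\<sigma>W)"
    using E(2) by (subst nn_integral_density) (auto intro!: nn_integral_cong simp: indicator_def)
  also have "?\<sigma>W = \<sigma>_chart i x"
  proof (rule measure_eqI)
    fix A assume "A \<in> sets ?\<sigma>W"
    then have A [measurable]: "A \<in> sets borel" by simp
    have "emeasure ?\<sigma>W A = emeasure ?\<sigma> (W i \<inter> A)"
      by (subst emeasure_density) (auto simp flip: indicator_inter_arith)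
    also have "\<dots> = emeasure \<sigma> ((W i \<inter> A) \<inter> S x)"
      using id \<sigma>(2) by (subst emeasure_distr) auto
    also have "\<dots> = emeasure (\<sigma>_chart i x) (W i \<inter> A)"
      unfolding \<sigma>_def by (intro emeasure_surface_W) auto
    also have "\<dots> = emeasure (\<sigma>_chart i x) A"
      unfolding \<sigma>_chart_def
      by (subst (1 2) emeasure_density, measurable) (auto intro!: nn_integral_cong simp: indicator_def)
    finally show "emeasure ?\<sigma>W A = emeasure (\<sigma>_chart i x) A" .
  qed simp
  also have "(\<integral>\<^sup>+y. ennreal (k y) * indicator E y \<partial>\<sigma>_chart i x)
    = (\<integral>\<^sup>+y. ennreal (norm (indicator (W i) y *\<^sub>R dP y)) * (ennreal (k y) * indicator E y) \<partial>C.\<tau> i x)"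
    unfolding \<sigma>_chart_def by (rule nn_integral_density) measurable
  also have "\<dots> = (\<integral>\<^sup>+y. indicator E y \<partial>C.\<tau> i x)"
  proof (rule nn_integral_cong)
    fix y
    show "ennreal (norm (indicator (W i) y *\<^sub>R dP y)) * (ennreal (k y) * indicator E y) = indicator E y"
    proof (cases "y \<in> E")
      case True
      then have "y \<in> W i" "y \<in> G" using E(2) W_G by auto
      then show ?thesis using True dP_nz
        by (simp add: k_def ennreal_mult'[symmetric])
    qed simp
  qed
  also have "\<dots> = emeasure (C.\<tau> i x) E" by simp
  finally show ?thesis .
qed

lemma integral_\<mu>_W:
  fixes f :: "'a \<Rightarrow> 'c::{banach,second_countable_topology}"
  assumes f: "f \<in> borel_measurable borel" and f0: "\<And>y. y \<notin> W i \<Longrightarrow> f y = 0"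
  shows "integrable (\<mu> x) f \<longleftrightarrow> integrable (C.\<tau> i x) f" "(\<integral>y. f y \<partial>\<mu> x) = (\<integral>y. f y \<partial>C.\<tau> i x)"
proof -
  have f': "f \<in> borel_measurable (C.\<tau> i x)" using f by (simp cong: measurable_cong_sets)
  note * = integral_eq_on_subset[of "distr (\<mu> x) borel (\<lambda>y. y)" "C.\<tau> i x" "W i" f]
  show "integrable (\<mu> x) f \<longleftrightarrow> integrable (C.\<tau> i x) f"
    using *(1) f' f0 emeasure_\<mu>_W integrable_distr_eq[OF id_measurable_\<mu> f, of x] by simp
  show "(\<integral>y. f y \<partial>\<mu> x) = (\<integral>y. f y \<partial>C.\<tau> i x)"
    using *(2) f' f0 emeasure_\<mu>_W integral_distr[OF id_measurable_\<mu> f, of x] by simp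
qed

section \<open>The coarea formula and Lipschitz densities on G\<close>

abbreviation level_int :: "('a \<Rightarrow> complex) \<Rightarrow> real \<Rightarrow> complex" where "level_int f x \<equiv> (\<integral>y. f y \<partial>\<mu> x)"

text \<open>The integrability clauses make the property stable under sums, which is how the pieces
  of a cover are assembled.\<close>

definition has_coarea :: "('a \<Rightarrow> complex) \<Rightarrow> bool" where
  "has_coarea f \<longleftrightarrow> (\<forall>x. integrable (\<mu> x) f) \<and> integrable lborel f \<and>
     integrable lborel (level_int f) \<and> (\<integral>y. f y \<partial>lborel) = (\<integral>x. level_int f x \<partial>lborel)"

definition has_Lipschitz_density :: "('a \<Rightarrow> complex) \<Rightarrow> bool" where
  "has_Lipschitz_density f \<longleftrightarrow>
     (\<exists>C. \<forall>x x'. norm (level_int f x - level_int f x') \<le> C * \<bar>x - x'\<bar>)"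

lemma has_coarea_add:
  assumes "has_coarea f" "has_coarea g"
  shows "has_coarea (\<lambda>y. f y + g y)"
proof -
  have f: "\<And>x. integrable (\<mu> x) f" "integrable lborel f" "integrable lborel (level_int f)"
      "(\<integral>y. f y \<partial>lborel) = (\<integral>x. level_int f x \<partial>lborel)"
    and g: "\<And>x. integrable (\<mu> x) g" "integrable lborel g" "integrable lborel (level_int g)"
      "(\<integral>y. g y \<partial>lborel) = (\<integral>x. level_int g x \<partial>lborel)"
    using assms unfolding has_coarea_def by blast+
  have s: "(\<integral>y. f y + g y \<partial>\<mu> x) = level_int f x + level_int g x" for x
    by (rule Bochner_Integration.integral_add[OF f(1) g(1)])
  show ?thesis
    unfolding has_coarea_def s
    using Bochner_Integration.integral_add[OF f(2) g(2)] Bochner_Integration.integral_add[OF f(3) g(3)] f(4) g(4)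
      Bochner_Integration.integrable_add[OF f(1) g(1)] Bochner_Integration.integrable_add[OF f(2) g(2)]
      Bochner_Integration.integrable_add[OF f(3) g(3)]
    by presburger
qed

lemma has_Lipschitz_density_add:
  assumes "has_coarea f" "has_coarea g" "has_Lipschitz_density f" "has_Lipschitz_density g"
  shows "has_Lipschitz_density (\<lambda>y. f y + g y)"
proof -
  obtain C C' where *: "\<And>x x'. norm (level_int f x - level_int f x') \<le> C * \<bar>x - x'\<bar>"
    "\<And>x x'. norm (level_int g x - level_int g x') \<le> C' * \<bar>x - x'\<bar>"
    using assms unfolding has_Lipschitz_density_def by blast
  have s: "(\<integral>y. f y + g y \<partial>\<mu> x) = level_int f x + level_int g x" for x
    using assms unfolding has_coarea_def by simp
  show ?thesis
    unfolding has_Lipschitz_density_def s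
  proof (intro exI[of _ "C + C'"] allI)
    fix x x'
    show "norm (level_int f x + level_int g x - (level_int f x' + level_int g x')) \<le> (C + C') * \<bar>x - x'\<bar>"
      using norm_diff_triangle_ineq[of "level_int f x" "level_int g x" "level_int f x'" "level_int g x'"]
        *[of x x'] by (simp add: distrib_right)
  qed
qed

lemma has_coarea_W:
  assumes f: "f \<in> borel_measurable borel" and M: "\<And>y. norm (f y) \<le> M" and f0: "\<And>y. y \<notin> W i \<Longrightarrow> f y = 0"
  shows "has_coarea f"
proof -
  have "level_int f x = (\<integral>y. f y \<partial>C.\<tau> i x)" "integrable (\<mu> x) f \<longleftrightarrow> integrable (C.\<tau> i x) f" for x
    by (rule integral_\<mu>_W[OF f]; rule f0; assumption)+
  moreover have "integrable lborel f" by (rule C.integrable_on_W[OF f M f0])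
  moreover have "integrable lborel (\<lambda>x. \<integral>y. f y \<partial>C.\<tau> i x)" "(\<integral>y. f y \<partial>lborel) = (\<integral>x. \<integral>y. f y \<partial>C.\<tau> i x \<partial>lborel)"
    by (rule C.coarea[OF f M]; rule f0; assumption)+
  ultimately show ?thesis
    unfolding has_coarea_def using C.integrable_\<tau>_bounded[OF f M] by simp
qed

lemma has_Lipschitz_density_W:
  assumes fL: "\<And>y y'. norm (f y - f y') \<le> K * norm (y - y')"
    and f: "f \<in> borel_measurable borel" and M: "\<And>y. norm (f y) \<le> M" and f0: "\<And>y. y \<notin> W i \<Longrightarrow> f y = 0"
  shows "has_Lipschitz_density f"
proof -
  have "level_int f x = (\<integral>y. f y \<partial>C.\<tau> i x)" for x
    by (rule integral_\<mu>_W(2)[OF f f0])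
  then show ?thesis
    unfolding has_Lipschitz_density_def using C.integral_\<tau>_Lipschitz[where i = i, OF fL f0 M] by simp
qed

end

context level_atlas begin

text \<open>Instead of using a partition of unity, the induction splits off one Lipschitz cutoff at a time.\<close>

lemma has_coarea_finite_cover:
  fixes f :: "'a \<Rightarrow> complex"
  assumes "finite A" and "\<And>p. p \<in> A \<Longrightarrow> 0 < snd p \<and> (\<exists>i. ball (fst p) (2 * snd p) \<subseteq> W i)"
    and "f \<in> borel_measurable borel" and "\<And>y. norm (f y) \<le> M"
    and "\<And>y. y \<notin> (\<Union>p\<in>A. ball (fst p) (snd p)) \<Longrightarrow> f y = 0"
  shows "has_coarea f \<and> ((\<exists>K. \<forall>y y'. norm (f y - f y') \<le> K * norm (y - y')) \<longrightarrow> has_Lipschitz_density f)"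
  using assms
proof (induction A arbitrary: f rule: finite_induct)
  \<comment> \<open>Here \<open>f\<close> vanishes identically and any chart will do; index 0 is
    taken.\<close>
  case empty
  then have f0: "f y = 0" if "y \<notin> W 0" for y by simp
  show ?case
    using has_coarea_W[OF empty(2,3) f0] has_Lipschitz_density_W[OF _ empty(2,3) f0] by blast
next
  case (insert p A)
  obtain c r where p: "p = (c, r)" by force
  have r: "0 < r" using insert.prems(1)[of p] p by simp
  obtain i where i: "ball c (2 * r) \<subseteq> W i" using insert.prems(1)[of p] p by auto
  have M: "0 \<le> M" using insert.prems(3)[of undefined] norm_ge_zero order_trans by blast
  \<comment> \<open>Equal to 1 on the ball of radius \<open>r\<close> and to 0 beyond radius
    \<open>2 * r\<close>; this is why the hypothesis on \<open>A\<close> asks for doubled balls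
    inside charts.\<close>
  define \<xi> where "\<xi> y = max 0 (min 1 (2 - dist y c / r))" for y
  have \<xi>_le: "0 \<le> \<xi> y" "\<xi> y \<le> 1" for y by (auto simp: \<xi>_def)
  have \<xi>1: "\<xi> y = 1" if "y \<in> ball c r" for y
    using that r by (simp add: \<xi>_def dist_commute field_simps)
  have \<xi>0: "\<xi> y = 0" if "y \<notin> W i" for y
  proof -
    have "2 * r \<le> dist y c" using that i by (auto simp: dist_commute not_less[symmetric])
    then show ?thesis using r by (simp add: \<xi>_def field_simps)
  qed
  have \<xi>L: "\<bar>\<xi> y - \<xi> y'\<bar> \<le> norm (y - y') / r" for y y'
  proof -
    have "\<bar>\<xi> y - \<xi> y'\<bar> \<le> \<bar>dist y c / r - dist y' c / r\<bar>" by (auto simp: \<xi>_def)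
    also have "\<dots> = \<bar>dist y c - dist y' c\<bar> / r" using r by (simp flip: diff_divide_distrib)
    also have "\<dots> \<le> dist y y' / r"
      using r abs_dist_diff_le[of y c y'] by (intro divide_right_mono) (auto simp: dist_commute)
    finally show ?thesis by (simp add: dist_norm)
  qed
  have \<xi>m [measurable]: "\<xi> \<in> borel_measurable borel"
    unfolding \<xi>_def[abs_def] by measurable
  note [measurable] = insert.prems(2)
  define f1 where "f1 y = complex_of_real (\<xi> y) * f y" for y
  define f2 where "f2 y = complex_of_real (1 - \<xi> y) * f y" for y
  have m: "f1 \<in> borel_measurable borel" "f2 \<in> borel_measurable borel"
    unfolding f1_def[abs_def] f2_def[abs_def] by measurable
  have b: "norm (f1 y) \<le> M" "norm (f2 y) \<le> M" for y
  proof -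
    have "\<xi> y * norm (f y) \<le> 1 * M"
      by (rule mult_mono) (use \<xi>_le[of y] insert.prems(3)[of y] M in auto)
    moreover have "(1 - \<xi> y) * norm (f y) \<le> 1 * M"
      by (rule mult_mono) (use \<xi>_le[of y] insert.prems(3)[of y] M in auto)
    ultimately show "norm (f1 y) \<le> M" "norm (f2 y) \<le> M"
      unfolding f1_def f2_def norm_mult norm_of_real using \<xi>_le[of y] by simp_all
  qed
  have z1: "f1 y = 0" if "y \<notin> W i" for y using \<xi>0[OF that] by (simp add: f1_def)
  \<comment> \<open>The remainder vanishes on the ball that was split off, so the smaller family of
    balls carries it and the induction hypothesis applies.\<close>
  have z2: "f2 y = 0" if "y \<notin> (\<Union>p\<in>A. ball (fst p) (snd p))" for y
  proof (cases "y \<in> ball c r")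
    case True then show ?thesis using \<xi>1 by (simp add: f2_def)
  next
    case False
    then have "f y = 0" using that p by (intro insert.prems(4)) auto
    then show ?thesis by (simp add: f2_def)
  qed
  have sum: "f = (\<lambda>y. f1 y + f2 y)"
    by (simp add: fun_eq_iff f1_def f2_def algebra_simps)
  have c1: "has_coarea f1" by (rule has_coarea_W[OF m(1) b(1) z1])
  have IH: "has_coarea f2 \<and> ((\<exists>K. \<forall>y y'. norm (f2 y - f2 y') \<le> K * norm (y - y')) \<longrightarrow> has_Lipschitz_density f2)"
    by (rule insert.IH[OF _ m(2) b(2) z2]) (use insert.prems(1) in auto)
  show ?case
  proof (intro conjI impI)
    show "has_coarea f" using has_coarea_add[OF c1] IH sum by simp
    assume "\<exists>K. \<forall>y y'. norm (f y - f y') \<le> K * norm (y - y')"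
    then obtain K where K: "\<And>y y'. norm (f y - f y') \<le> K * norm (y - y')" by blast
    have L1: "norm (f1 y - f1 y') \<le> (K + M / r) * norm (y - y')" for y y'
    proof -
      have "f1 y - f1 y' = complex_of_real (\<xi> y) * (f y - f y') + complex_of_real (\<xi> y - \<xi> y') * f y'"
        by (simp add: f1_def algebra_simps)
      then have "norm (f1 y - f1 y') \<le> \<xi> y * norm (f y - f y') + \<bar>\<xi> y - \<xi> y'\<bar> * norm (f y')"
        using norm_triangle_ineq[of "complex_of_real (\<xi> y) * (f y - f y')" "complex_of_real (\<xi> y - \<xi> y') * f y'"]
          \<xi>_le[of y] by (simp add: norm_mult del: of_real_diff)
      also have "\<dots> \<le> 1 * norm (f y - f y') + (norm (y - y') / r) * M"
        using \<xi>_le[of y] \<xi>L[of y y'] insert.prems(3)[of y'] r by (intro add_mono mult_mono) auto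
      also have "\<dots> \<le> K * norm (y - y') + (norm (y - y') / r) * M"
        using K[of y y'] by simp
      finally show ?thesis by (simp add: algebra_simps)
    qed
    have L2: "norm (f2 y - f2 y') \<le> (K + (K + M / r)) * norm (y - y')" for y y'
    proof -
      have "f2 y - f2 y' = (f y - f y') - (f1 y - f1 y')"
        by (simp add: f1_def f2_def algebra_simps)
      then have "norm (f2 y - f2 y') \<le> norm (f y - f y') + norm (f1 y - f1 y')"
        by (simp only: norm_triangle_ineq4)
      then show ?thesis using K[of y y'] L1[of y y'] by (simp add: distrib_right)
    qed
    have "has_Lipschitz_density f1"
      by (rule has_Lipschitz_density_W[OF L1 m(1) b(1) z1])
    moreover have "has_Lipschitz_density f2" using IH L2 by blast
    ultimately show "has_Lipschitz_density f"
      using has_Lipschitz_density_add[OF c1] IH sum by simp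
  qed
qed

lemma compact_support_coarea:
  fixes f :: "'a \<Rightarrow> complex"
  assumes K: "compact K" "K \<subseteq> G" and f: "f \<in> borel_measurable borel" and M: "\<And>y. norm (f y) \<le> M"
    and f0: "\<And>y. y \<notin> K \<Longrightarrow> f y = 0"
  shows "has_coarea f" "(\<exists>C. \<forall>y y'. norm (f y - f y') \<le> C * norm (y - y')) \<Longrightarrow> has_Lipschitz_density f"
proof -
  define B where "B = {p :: 'a \<times> real. 0 < snd p \<and> (\<exists>i. ball (fst p) (2 * snd p) \<subseteq> W i)}"
  have "K \<subseteq> (\<Union>p\<in>B. ball (fst p) (snd p))"
  proof
    fix y assume "y \<in> K"
    then obtain i where "y \<in> W i" using K(2) G_cover by blast
    then obtain r where r: "r > 0" "ball y r \<subseteq> W i"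
      using C.open_W[of i] by (meson open_contains_ball)
    then have "(y, r / 2) \<in> B" by (auto simp: B_def)
    moreover have "y \<in> ball (fst (y, r / 2)) (snd (y, r / 2))" using r by simp
    ultimately show "y \<in> (\<Union>p\<in>B. ball (fst p) (snd p))" by (meson UN_I)
  qed
  then obtain A where A: "A \<subseteq> B" "finite A" "K \<subseteq> (\<Union>p\<in>A. ball (fst p) (snd p))"
    using compactE_image[OF K(1), of B "\<lambda>p. ball (fst p) (snd p)"] by auto
  have z: "f y = 0" if "y \<notin> (\<Union>p\<in>A. ball (fst p) (snd p))" for y
    using that A(3) f0 by blast
  have "0 < snd p \<and> (\<exists>i. ball (fst p) (2 * snd p) \<subseteq> W i)" if "p \<in> A" for p
    using that A(1) by (auto simp: B_def)
  then have "has_coarea f \<and> ((\<exists>K. \<forall>y y'. norm (f y - f y') \<le> K * norm (y - y')) \<longrightarrow> has_Lipschitz_density f)"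
    using has_coarea_finite_cover[OF A(2) _ f M z] by blast
  then show "has_coarea f" "(\<exists>C. \<forall>y y'. norm (f y - f y') \<le> C * norm (y - y')) \<Longrightarrow> has_Lipschitz_density f"
    by blast+
qed

text \<open>\<open>P\<close> is constant on the space of the measure, so a function of
  \<open>P\<close> leaves the integral; with the resolvent kernel as \<open>k\<close>, the coarea
  formula becomes a one-dimensional integral.\<close>

lemma integral_\<mu>_mult_P:
  fixes f :: "'a \<Rightarrow> complex" and k :: "real \<Rightarrow> complex"
  shows "(\<integral>y. f y * k (P y) \<partial>\<mu> x) = level_int f x * k x"
proof -
  have "(\<integral>y. f y * k (P y) \<partial>\<mu> x) = (\<integral>y. f y * k x \<partial>\<mu> x)"
    by (rule Bochner_Integration.integral_cong) (auto simp: space_\<mu> S_level)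
  then show ?thesis by simp
qed

lemma integral_\<mu>_eq_0:
  fixes f :: "'a \<Rightarrow> complex"
  assumes "\<And>y. y \<notin> K \<Longrightarrow> f y = 0" "x \<notin> P ` K"
  shows "level_int f x = 0"
proof -
  have "f y = 0" if "y \<in> S x" for y
    using assms S_level[OF that] by blast
  then have "level_int f x = (\<integral>y. 0 \<partial>\<mu> x)"
    by (intro Bochner_Integration.integral_cong) (auto simp: space_\<mu>)
  then show ?thesis by simp
qed

end

subsection \<open>Existence of an atlas\<close>

lemma frechet_derivative_basis:
  fixes f :: "'a::euclidean_space \<Rightarrow> 'b::real_normed_vector"
  assumes "f differentiable (at y)"
  shows "frechet_derivative f (at y) d = (\<Sum>c\<in>Basis. (d \<bullet> c) *\<^sub>R frechet_derivative f (at y) c)"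
proof -
  have "linear (frechet_derivative f (at y))" using assms by (rule linear_frechet_derivative)
  then have "frechet_derivative f (at y) (\<Sum>c\<in>Basis. (d \<bullet> c) *\<^sub>R c)
    = (\<Sum>c\<in>Basis. (d \<bullet> c) *\<^sub>R frechet_derivative f (at y) c)"
    by (simp add: linear_sum linear_scale)
  then show ?thesis by (simp add: euclidean_representation)
qed

text \<open>Expanding the derivative in the basis and bounding each coordinate by the norm produces
  the factor \<open>DIM('a)\<close>.\<close>

lemma partial_bound_imp_Lipschitz:
  fixes f :: "'a::euclidean_space \<Rightarrow> 'b::real_normed_vector"
  assumes W: "convex W" and f: "\<And>y. y \<in> W \<Longrightarrow> f differentiable (at y)"
    and M: "\<And>y c. y \<in> W \<Longrightarrow> c \<in> Basis \<Longrightarrow> norm (frechet_derivative f (at y) c) \<le> M"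
    and y: "y \<in> W" "y' \<in> W"
  shows "norm (f y - f y') \<le> (real DIM('a) * M) * norm (y - y')"
proof (rule differentiable_bound[OF W _ _ y])
  fix z assume z: "z \<in> W"
  show "(f has_derivative frechet_derivative f (at z)) (at z within W)"
    using f[OF z] by (simp add: frechet_derivative_works has_derivative_at_withinI)
  show "onorm (frechet_derivative f (at z)) \<le> real DIM('a) * M"
  proof (rule onorm_le)
    fix d :: 'a
    have "norm (frechet_derivative f (at z) d) \<le> (\<Sum>c\<in>Basis. norm ((d \<bullet> c) *\<^sub>R frechet_derivative f (at z) c))"
      unfolding frechet_derivative_basis[OF f[OF z], of d] by (rule norm_sum)
    also have "\<dots> \<le> (\<Sum>c::'a\<in>Basis. norm d * M)"
      using M[OF z] by (intro sum_mono) (auto intro!: mult_mono simp: Basis_le_norm)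
    finally show "norm (frechet_derivative f (at z) d) \<le> real DIM('a) * M * norm d"
      by (simp add: mult_ac)
  qed
qed

lemma grad_has_derivative:
  fixes P :: "'a::euclidean_space \<Rightarrow> real"
  assumes "P differentiable (at y)"
  shows "(P has_derivative (\<lambda>d. grad P y \<bullet> d)) (at y)"
proof -
  have "frechet_derivative P (at y) = (\<lambda>d. grad P y \<bullet> d)"
  proof
    fix d
    show "frechet_derivative P (at y) d = grad P y \<bullet> d"
      unfolding grad_def frechet_derivative_basis[OF assms, of d] inner_sum_left inner_scaleR_left
      by (simp add: inner_commute mult.commute)
  qed
  then show ?thesis using assms by (simp add: frechet_derivative_works)
qed

lemma grad_inner_Basis: "b \<in> Basis \<Longrightarrow> grad P y \<bullet> b = frechet_derivative P (at y) b"
  by (simp add: grad_def inner_sum_left_Basis)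

text \<open>On a small ball, continuity keeps the derivative in direction \<open>b\<close> within
  half of its size at \<open>y\<close>, so its sign persists, and so does a lower bound. Bounded
  second derivatives of \<open>P\<close> on \<open>G\<close> give the Lipschitz constant.\<close>

lemma ex_level_chart:
  fixes P :: "'a::euclidean_space \<Rightarrow> real"
  assumes G: "open G" and P_smooth: "smooth_on G P"
    and P_bounded: "\<And>bs. bs \<in> lists Basis \<Longrightarrow> bounded (mixed_deriv bs P ` G)"
    and b: "b \<in> Basis" and y: "y \<in> G" and nz: "grad P y \<bullet> b \<noteq> 0"
  shows "\<exists>W e m L. y \<in> W \<and> W \<subseteq> G \<and> level_chart P (grad P) W b e m L"
proof -
  have diff: "P differentiable (at z)" if "z \<in> G" for z
    using P_smooth that unfolding smooth_on_def by (metis lists.Nil mixed_deriv.simps(1))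
  have D: "mixed_deriv [c] P = (\<lambda>z. grad P z \<bullet> c)" if "c \<in> Basis" for c
    using that by (simp add: fun_eq_iff grad_inner_Basis)
  have diffD: "(\<lambda>z. grad P z \<bullet> c) differentiable (at z)" if "z \<in> G" "c \<in> Basis" for z c
  proof -
    have "[c] \<in> lists Basis" using that by simp
    then show ?thesis using P_smooth that unfolding smooth_on_def D[OF that(2), symmetric] by blast
  qed
  have cont: "continuous_on G (grad P)"
  proof -
    have "continuous_on G (\<lambda>z. \<Sum>c\<in>Basis. (grad P z \<bullet> c) *\<^sub>R c)"
      by (intro continuous_intros continuous_at_imp_continuous_on ballI differentiable_imp_continuous_within diffD)
    then show ?thesis by (simp add: euclidean_representation)
  qed
  have "\<exists>M. \<forall>z\<in>G. \<forall>c\<in>Basis. \<bar>frechet_derivative (\<lambda>z. grad P z \<bullet> b) (at z) c\<bar> \<le> M"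
  proof -
    \<comment> \<open>The head of the list in \<open>mixed_deriv\<close> is the last
      differentiation, so \<open>[c, b]\<close> stands for the derivative in direction
      \<open>c\<close> of the one in direction \<open>b\<close>.\<close>
    have "\<exists>M. \<forall>z\<in>G. \<bar>frechet_derivative (\<lambda>z. grad P z \<bullet> b) (at z) c\<bar> \<le> M" if "c \<in> Basis" for c
      using P_bounded[of "[c, b]"] that b D[OF b] by (auto simp: bounded_iff)
    then obtain M where M: "\<And>c z. c \<in> Basis \<Longrightarrow> z \<in> G \<Longrightarrow> \<bar>frechet_derivative (\<lambda>z. grad P z \<bullet> b) (at z) c\<bar> \<le> M c"
      by metis
    have "\<bar>frechet_derivative (\<lambda>z. grad P z \<bullet> b) (at z) c\<bar> \<le> (\<Sum>c\<in>Basis. \<bar>M c\<bar>)"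
      if "c \<in> Basis" "z \<in> G" for c z
      using M[OF that] member_le_sum[of c Basis "\<lambda>c. \<bar>M c\<bar>"] that(1) by force
    then show ?thesis by blast
  qed
  then obtain M where M: "\<And>z c. z \<in> G \<Longrightarrow> c \<in> Basis \<Longrightarrow> \<bar>frechet_derivative (\<lambda>z. grad P z \<bullet> b) (at z) c\<bar> \<le> M"
    by blast
  define a where "a = grad P y \<bullet> b"
  have "continuous_on G (\<lambda>z. grad P z \<bullet> b)" by (intro continuous_intros cont)
  then have "open (G \<inter> (\<lambda>z. grad P z \<bullet> b) -` ball a (\<bar>a\<bar> / 2))"
    using G by (intro continuous_open_preimage) auto
  moreover have "y \<in> G \<inter> (\<lambda>z. grad P z \<bullet> b) -` ball a (\<bar>a\<bar> / 2)"
    using y nz by (simp add: a_def)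
  ultimately obtain r where r: "r > 0" "ball y r \<subseteq> G \<inter> (\<lambda>z. grad P z \<bullet> b) -` ball a (\<bar>a\<bar> / 2)"
    by (meson open_contains_ball)
  have "level_chart P (grad P) (ball y r) b (sgn a) (\<bar>a\<bar> / 2) (\<bar>real DIM('a) * M\<bar>)"
  proof
    show "(P has_derivative (\<bullet>) (grad P z)) (at z)" if "z \<in> ball y r" for z
      using that r by (intro grad_has_derivative diff) auto
    show "continuous_on (ball y r) (grad P)" using r by (intro continuous_on_subset[OF cont]) auto
    show "0 < \<bar>a\<bar> / 2" "\<bar>sgn a\<bar> = 1" using nz by (auto simp: a_def sgn_if)
    show "\<bar>a\<bar> / 2 \<le> sgn a * (grad P z \<bullet> b)" if "z \<in> ball y r" for z
    proof -
      have "\<bar>a - grad P z \<bullet> b\<bar> < \<bar>a\<bar> / 2" using that r by (auto simp: dist_real_def)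
      then show ?thesis using nz by (cases "0 < a") (auto simp: a_def[symmetric] sgn_if abs_if split: if_splits)
    qed
    show "\<bar>grad P z \<bullet> b - grad P z' \<bullet> b\<bar> \<le> \<bar>real DIM('a) * M\<bar> * norm (z - z')"
      if "z \<in> ball y r" "z' \<in> ball y r" for z z'
    proof -
      have "norm (grad P z \<bullet> b - grad P z' \<bullet> b) \<le> (real DIM('a) * M) * norm (z - z')"
        by (rule partial_bound_imp_Lipschitz[of "ball y r"]) (use that r diffD[OF _ b] M in auto)
      also have "\<dots> \<le> \<bar>real DIM('a) * M\<bar> * norm (z - z')" by (intro mult_right_mono) auto
      finally show ?thesis by simp
    qed
  qed (use b in auto)
  moreover have "y \<in> ball y r" "ball y r \<subseteq> G" using r by auto
  ultimately show ?thesis by blast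
qed

text \<open>Lindelof is applied to each direction separately, because the cover condition of an
  atlas is per direction; the countable families are then merged into one sequence of pairs.\<close>

lemma ex_level_atlas:
  fixes P :: "'a::euclidean_space \<Rightarrow> real"
  assumes G: "open G" and P_smooth: "smooth_on G P"
    and P_bounded: "\<And>bs. bs \<in> lists Basis \<Longrightarrow> bounded (mixed_deriv bs P ` G)"
    and P_grad: "\<And>y. y \<in> G \<Longrightarrow> grad P y \<noteq> 0"
  shows "\<exists>W bs es ms Ls. level_atlas G P (grad P) W bs es ms Ls"
proof -
  define Q where "Q W b \<longleftrightarrow> W \<subseteq> G \<and> (\<exists>e m L. level_chart P (grad P) W b e m L)" for W b
  have "\<exists>F. countable F \<and> F \<subseteq> {W. Q W b} \<and> \<Union>F = \<Union>{W. Q W b}" for b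
  proof -
    have "open W" if "W \<in> {W. Q W b}" for W using that by (auto simp: Q_def level_chart_def)
    then show ?thesis using Lindelof[of "{W. Q W b}"] by metis
  qed
  then obtain F where F: "\<And>b. countable (F b)" "\<And>b. F b \<subseteq> {W. Q W b}" "\<And>b. \<Union>(F b) = \<Union>{W. Q W b}"
    by metis
  obtain b0 :: 'a where b0: "b0 \<in> Basis" using nonempty_Basis by blast
  \<comment> \<open>The empty chart makes \<open>Z\<close> nonempty, so that
    \<open>from_nat_into\<close> enumerates it even if \<open>G\<close> is empty.\<close>
  define Z where "Z = insert ({}, b0) (\<Union>b\<in>Basis. F b \<times> {b})"
  have Z: "countable Z" "Z \<noteq> {}"
    using F(1) unfolding Z_def by (auto intro!: countable_UN countable_SIGMA intro: countable_finite)
  have "Q {} b0"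
  proof -
    have "level_chart P (grad P) {} b0 1 1 0" by standard (use b0 in auto)
    then show ?thesis by (auto simp: Q_def)
  qed
  then have ZQ: "Q (fst z) (snd z)" if "z \<in> Z" for z
    using that subsetD[OF F(2)] by (auto simp: Z_def)
  define W where "W i = fst (from_nat_into Z i)" for i
  define bs where "bs i = snd (from_nat_into Z i)" for i
  have WQ: "Q (W i) (bs i)" for i
    using ZQ from_nat_into[OF Z(2)] by (simp add: W_def bs_def)
  then have "\<forall>i. \<exists>e m L. level_chart P (grad P) (W i) (bs i) e m L" by (simp add: Q_def)
  then obtain es ms Ls where chart: "\<And>i. level_chart P (grad P) (W i) (bs i) (es i) (ms i) (Ls i)"
    by metis
  have "level_atlas G P (grad P) W bs es ms Ls"
  proof (rule level_atlas.intro)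
    show "(P has_derivative (\<bullet>) (grad P y)) (at y)" if "y \<in> G" for y
      using P_smooth that unfolding smooth_on_def
      by (intro grad_has_derivative) (metis lists.Nil mixed_deriv.simps(1))
    show "\<exists>i. bs i = b \<and> y \<in> W i" if y: "b \<in> Basis" "y \<in> G" "grad P y \<bullet> b \<noteq> 0" for b y
    proof -
      have "\<exists>W. y \<in> W \<and> Q W b"
        using ex_level_chart[OF G P_smooth P_bounded y] by (auto simp: Q_def)
      then obtain V where "y \<in> V" "V \<in> F b" using F(3)[of b] by auto
      then have "(V, b) \<in> Z" using y(1) by (auto simp: Z_def)
      then obtain i where "from_nat_into Z i = (V, b)" using from_nat_into_surj[OF Z(1)] by blast
      then show ?thesis using \<open>y \<in> V\<close> by (intro exI[of _ i]) (simp add: W_def bs_def)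
    qed
  qed (use G P_grad chart WQ in \<open>auto simp: Q_def\<close>)
  then show ?thesis by blast
qed

subsection \<open>The Plemelj formula\<close>

lemma integral_Icc_inverse_Complex:
  fixes R u :: real
  assumes R: "0 < R" and u: "u \<noteq> 0"
  shows "(\<integral>t. indicator {-R..R} t *\<^sub>R (1 / Complex t u) \<partial>lborel) = - 2 * \<i> * of_real (arctan (R / u))"
proof -
  \<comment> \<open>A primitive of 1/(t + iu) = (t - iu)/(t^2 + u^2). The logarithm is even in
    \<open>t\<close> and cancels over the symmetric interval.\<close>
  define F where "F t = Complex (ln (t\<^sup>2 + u\<^sup>2) / 2) (- arctan (t / u))" for t
  have pos: "0 < t\<^sup>2 + u\<^sup>2" for t using u by (simp add: add_nonneg_pos)
  have der: "(F has_vector_derivative 1 / Complex t u) (at t)" for t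
  proof -
    have "((\<lambda>t. ln (t\<^sup>2 + u\<^sup>2) / 2) has_real_derivative (t / (t\<^sup>2 + u\<^sup>2))) (at t)"
      using pos[of t] by (auto intro!: derivative_eq_intros simp: divide_simps)
    moreover have "((\<lambda>t. - arctan (t / u)) has_real_derivative (- u / (t\<^sup>2 + u\<^sup>2))) (at t)"
      using u pos[of t] by (auto intro!: derivative_eq_intros simp: field_simps power2_eq_square)
    ultimately have "(F has_vector_derivative Complex (t / (t\<^sup>2 + u\<^sup>2)) (- u / (t\<^sup>2 + u\<^sup>2))) (at t)"
      unfolding F_def has_vector_derivative_complex_iff has_real_derivative_iff_has_vector_derivative by simp
    also have "Complex (t / (t\<^sup>2 + u\<^sup>2)) (- u / (t\<^sup>2 + u\<^sup>2)) = 1 / Complex t u"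
      by (simp add: complex_eq_iff Re_divide Im_divide)
    finally show ?thesis .
  qed
  have "continuous_on UNIV (\<lambda>t. 1 / Complex t u)"
    using u by (intro continuous_intros) (auto simp: complex_eq_iff)
  then have "continuous_on {-R..R} (\<lambda>t. 1 / Complex t u)" by (rule continuous_on_subset) simp
  then have "(\<integral>t. indicator {-R..R} t *\<^sub>R (1 / Complex t u) \<partial>lborel) = F R - F (- R)"
    using R der by (intro integral_FTC_Icc) (auto intro: has_vector_derivative_at_within)
  also have "\<dots> = - 2 * \<i> * of_real (arctan (R / u))"
    by (simp add: F_def complex_eq_iff arctan_minus)
  finally show ?thesis .
qed

text \<open>The sign of \<open>u\<close> decides between the two limits; their difference is the
  jump in the Plemelj formula.\<close>

lemma arctan_divide_at_0:
  assumes "0 < R"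
  shows "((\<lambda>u. arctan (R / u)) \<longlongrightarrow> pi / 2) (at_right 0)" "((\<lambda>u. arctan (R / u)) \<longlongrightarrow> - (pi / 2)) (at_left 0)"
proof -
  have "filterlim (\<lambda>u. R / u) at_top (at_right 0)"
    using filterlim_tendsto_pos_mult_at_top[OF tendsto_const assms filterlim_inverse_at_top_right]
    by (simp add: divide_inverse)
  then show "((\<lambda>u. arctan (R / u)) \<longlongrightarrow> pi / 2) (at_right 0)"
    by (rule filterlim_compose[OF tendsto_arctan_at_top])
  have "((\<lambda>u. arctan (R / - u)) \<longlongrightarrow> - (pi / 2)) (at_right 0)"
    using tendsto_minus[OF \<open>((\<lambda>u. arctan (R / u)) \<longlongrightarrow> pi / 2) (at_right 0)\<close>] by (simp add: arctan_minus)
  then show "((\<lambda>u. arctan (R / u)) \<longlongrightarrow> - (pi / 2)) (at_left 0)"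
    by (subst filterlim_at_left_to_right) simp
qed

text \<open>The pole is moved to 0: the locale is meant for the reflected density t \<mapsto>
  \<phi>(x - t). The window [-R, R] is symmetric so that the truncated odd kernel 1/t integrates to
  0 over it.\<close>

locale Lipschitz_density =
  fixes \<phi> :: "real \<Rightarrow> complex" and C R :: real
  assumes Lip: "\<And>s t. norm (\<phi> s - \<phi> t) \<le> C * \<bar>s - t\<bar>"
    and supp: "\<And>t. R \<le> \<bar>t\<bar> \<Longrightarrow> \<phi> t = 0" and R: "0 < R"
begin

abbreviation window :: "real \<Rightarrow> real \<Rightarrow> complex" where
  "window u t \<equiv> indicator {-R..R} t *\<^sub>R (1 / Complex t u)"

abbreviation reg :: "real \<Rightarrow> real \<Rightarrow> complex" where
  "reg u t \<equiv> indicator {-R..R} t *\<^sub>R ((\<phi> t - \<phi> 0) / Complex t u)"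

abbreviation quot :: "real \<Rightarrow> complex" where
  "quot t \<equiv> indicator {-R..R} t *\<^sub>R ((\<phi> t - \<phi> 0) / of_real t)"

abbreviation cut :: "real \<Rightarrow> real \<Rightarrow> complex" where
  "cut \<epsilon> t \<equiv> indicator {-R..R} t *\<^sub>R (indicator {t. \<epsilon> \<le> \<bar>t\<bar>} t *\<^sub>R ((\<phi> t - \<phi> 0) / of_real t))"

lemma C_nonneg: "0 \<le> C"
  using order_trans[OF norm_ge_zero Lip[of 1 0]] by simp

lemma cont_\<phi>: "continuous_on X \<phi>"
  using C_nonneg Lip by (intro lipschitz_on_continuous_on[of C] lipschitz_onI) (simp_all add: dist_norm)

lemma \<phi>_borel [measurable]: "\<phi> \<in> borel_measurable borel"
  using cont_\<phi> by (rule borel_measurable_continuous_onI)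

lemma integrable_window: "integrable lborel (\<lambda>t. indicator {-R..R} t * (c::real))"
  using R by (intro integrable_mult_left integrable_real_indicator) (auto simp: emeasure_lborel_Icc_eq)

text \<open>Supplies the dominating constant for both limits below. At \<open>t = 0\<close> division
  by zero gives 0.\<close>

lemma quotient_bound: "norm ((\<phi> t - \<phi> 0) / of_real t) \<le> C"
  using Lip[of t 0] C_nonneg by (cases "t = 0") (simp_all add: norm_divide divide_le_eq)

lemma integrable_quotient: "integrable lborel (\<lambda>t. quot t)"
proof (rule Bochner_Integration.integrable_bound[of _ "\<lambda>t. indicator {-R..R} t * C"])
  show "AE t in lborel. norm (quot t) \<le> norm (indicator {-R..R} t * C)"
    using quotient_bound C_nonneg by (intro AE_I2) (auto simp: indicator_def)
  show "integrable lborel (\<lambda>t. indicator {-R..R} t * C)" by (rule integrable_window)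
qed simp

text \<open>The principal value at \<open>0\<close>, written as an absolutely convergent integral.\<close>

definition J :: complex where "J = (\<integral>t. quot t \<partial>lborel)"

text \<open>Dominated convergence: |t + iu| is at least |t|, so the difference quotient bounds the
  integrand for every \<open>u\<close>.\<close>

lemma regularised_limit:
  fixes F :: "real filter"
  assumes F: "F = at_left 0 \<or> F = at_right 0"
  shows "((\<lambda>u. \<integral>t. reg u t \<partial>lborel) \<longlongrightarrow> J) F"
proof -
  have dom: "((\<lambda>n. \<integral>t. reg (X n) t \<partial>lborel) \<longlonglongrightarrow> J)"
    if X: "X \<longlonglongrightarrow> 0" for X
    unfolding J_def
  proof (rule integral_dominated_convergence[where w = "\<lambda>t. indicator {-R..R} t * C"])
    show "integrable lborel (\<lambda>t. indicator {-R..R} t * C)" by (rule integrable_window)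
    have nz: "AE t in lborel. t \<noteq> (0::real)" by (rule AE_lborel_singleton)
    then show "AE t in lborel. (\<lambda>n. reg (X n) t)
        \<longlonglongrightarrow> quot t"
    proof eventually_elim
      case (elim t)
      have "(\<lambda>n. Complex t (X n)) \<longlonglongrightarrow> Complex t 0"
        using X by (intro tendsto_Complex tendsto_const)
      then have "(\<lambda>n. Complex t (X n)) \<longlonglongrightarrow> of_real t" by (simp add: complex_of_real_def)
      then show ?case using elim by (intro tendsto_intros) auto
    qed
    show "AE t in lborel. norm (reg (X n) t) \<le> indicator {-R..R} t * C" for n
      using nz
    proof eventually_elim
      case (elim t)
      have "\<bar>t\<bar> \<le> norm (Complex t (X n))" using abs_Re_le_cmod[of "Complex t (X n)"] by simp
      then have "norm ((\<phi> t - \<phi> 0) / Complex t (X n)) \<le> norm ((\<phi> t - \<phi> 0) / of_real t)"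
        using elim unfolding norm_divide by (intro divide_left_mono mult_pos_pos) auto
      then show ?case using quotient_bound[of t] by (simp add: indicator_def)
    qed
  qed (unfold Complex_eq, measurable)
  show ?thesis
    using F
  proof
    assume "F = at_left 0"
    then show ?thesis
      by (simp only:) (rule tendsto_at_left_sequentially[of "-1"], use dom in auto)
  next
    assume "F = at_right 0"
    then show ?thesis
      by (simp only:) (rule tendsto_at_right_sequentially[of _ 1], use dom in auto)
  qed
qed

lemma integrable_kernel:
  assumes "u \<noteq> 0"
  shows "integrable lborel (\<lambda>t. window u t)"
    "integrable lborel (\<lambda>t. reg u t)"
proof -
  have c: "continuous_on {-R..R} (\<lambda>t. 1 / Complex t u)"
    using assms by (intro continuous_intros) (auto simp: complex_eq_iff)
  have c': "continuous_on {-R..R} (\<lambda>t. (\<phi> t - \<phi> 0) / Complex t u)"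
    using assms by (intro continuous_intros cont_\<phi>) (auto simp: complex_eq_iff)
  show "integrable lborel (\<lambda>t. window u t)"
    "integrable lborel (\<lambda>t. reg u t)"
    using borel_integrable_compact[OF compact_Icc c] borel_integrable_compact[OF compact_Icc c'] by auto
qed

text \<open>Subtracting \<open>\<phi> 0\<close> inside the window removes the singularity; the
  subtracted part is an explicit arctangent.\<close>

lemma kernel_split:
  assumes "u \<noteq> 0"
  shows "(\<integral>t. \<phi> t / Complex t u \<partial>lborel)
    = (\<integral>t. reg u t \<partial>lborel) + \<phi> 0 * (- 2 * \<i> * of_real (arctan (R / u)))"
proof -
  have "\<phi> t / Complex t u = reg u t + \<phi> 0 * (window u t)" for t
    using supp[of t] by (cases "t \<in> {-R..R}") (auto simp: add_divide_distrib[symmetric])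
  then have "(\<integral>t. \<phi> t / Complex t u \<partial>lborel) = (\<integral>t. reg u t
      + \<phi> 0 * (window u t) \<partial>lborel)" by presburger
  also have "\<dots> = (\<integral>t. reg u t \<partial>lborel)
      + (\<integral>t. \<phi> 0 * (window u t) \<partial>lborel)"
    by (intro Bochner_Integration.integral_add integrable_kernel[OF assms] integrable_mult_right)
  also have "(\<integral>t. \<phi> 0 * (window u t) \<partial>lborel) = \<phi> 0 * (- 2 * \<i> * of_real (arctan (R / u)))"
    using integral_mult_right_zero[of lborel "\<phi> 0" "\<lambda>t. window u t"]
      integral_Icc_inverse_Complex[OF R assms] by simp
  finally show ?thesis .
qed

lemma Plemelj:
  shows "((\<lambda>u. \<integral>t. \<phi> t / Complex t u \<partial>lborel) \<longlongrightarrow> J - \<i> * of_real pi * \<phi> 0) (at_right 0)"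
    "((\<lambda>u. \<integral>t. \<phi> t / Complex t u \<partial>lborel) \<longlongrightarrow> J + \<i> * of_real pi * \<phi> 0) (at_left 0)"
proof -
  have ev: "\<forall>\<^sub>F u in at_right 0. u \<noteq> (0::real)" "\<forall>\<^sub>F u in at_left 0. u \<noteq> (0::real)"
    by (auto simp: eventually_at_filter)
  have l1: "((\<lambda>u. (\<integral>t. reg u t \<partial>lborel) + \<phi> 0 * (- 2 * \<i> * of_real (arctan (R / u))))
     \<longlongrightarrow> J + \<phi> 0 * (- 2 * \<i> * of_real (pi / 2))) (at_right 0)"
    by (intro tendsto_intros regularised_limit arctan_divide_at_0 R) simp
  show "((\<lambda>u. \<integral>t. \<phi> t / Complex t u \<partial>lborel) \<longlongrightarrow> J - \<i> * of_real pi * \<phi> 0) (at_right 0)"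
    using Lim_transform_eventually[OF l1 eventually_mono[OF ev(1) kernel_split[symmetric]]]
    by (simp add: mult_ac)
  have l2: "((\<lambda>u. (\<integral>t. reg u t \<partial>lborel) + \<phi> 0 * (- 2 * \<i> * of_real (arctan (R / u))))
     \<longlongrightarrow> J + \<phi> 0 * (- 2 * \<i> * of_real (- (pi / 2)))) (at_left 0)"
    by (intro tendsto_intros regularised_limit arctan_divide_at_0 R) simp
  show "((\<lambda>u. \<integral>t. \<phi> t / Complex t u \<partial>lborel) \<longlongrightarrow> J + \<i> * of_real pi * \<phi> 0) (at_left 0)"
    using Lim_transform_eventually[OF l2 eventually_mono[OF ev(2) kernel_split[symmetric]]]
    by (simp add: mult_ac)
qed

text \<open>The truncated kernel 1/t is odd on the symmetric window, so subtracting
  \<open>\<phi> 0\<close> does not change the truncated integrals, and the subtracted form converges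
  by domination.\<close>

lemma truncated_limit:
  "((\<lambda>\<epsilon>. \<integral>t. indicator {t. \<epsilon> \<le> \<bar>t\<bar>} t *\<^sub>R (\<phi> t / of_real t) \<partial>lborel) \<longlongrightarrow> J) (at_right 0)"
proof -
  have eq: "(\<integral>t. indicator {t. \<epsilon> \<le> \<bar>t\<bar>} t *\<^sub>R (\<phi> t / of_real t) \<partial>lborel)
     = (\<integral>t. cut \<epsilon> t \<partial>lborel)"
    if \<epsilon>: "0 < \<epsilon>" for \<epsilon>
  proof -
    let ?k = "\<lambda>t::real. indicator {t. t \<in> {-R..R} \<and> \<epsilon> \<le> \<bar>t\<bar>} t *\<^sub>R (1 / complex_of_real t)"
    let ?q = "\<lambda>t. cut \<epsilon> t"
    have m: "{t. t \<in> {-R..R} \<and> \<epsilon> \<le> \<bar>t\<bar>} \<in> sets borel" "{t::real. \<epsilon> \<le> \<bar>t\<bar>} \<in> sets borel"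
      by measurable
    have k: "integrable lborel ?k"
    proof (rule Bochner_Integration.integrable_bound[of _ "\<lambda>t. indicator {-R..R} t * (1 / \<epsilon>)"])
      show "integrable lborel (\<lambda>t. indicator {-R..R} t * (1 / \<epsilon>))" by (rule integrable_window)
      show "AE t in lborel. norm (?k t) \<le> norm (indicator {-R..R} t * (1 / \<epsilon>))"
        using \<epsilon> by (intro AE_I2) (auto simp: indicator_def norm_divide intro!: divide_left_mono)
    qed (use m in measurable)
    have q: "integrable lborel ?q"
      by (rule Bochner_Integration.integrable_bound[OF integrable_quotient])
         (use m in \<open>auto simp: indicator_def\<close>)
    have "(\<integral>t. ?k t \<partial>lborel) = (\<integral>t. ?k (- t) \<partial>lborel)"
      using lborel_integral_real_affine[of "-1" ?k 0] by simp
    also have "\<dots> = (\<integral>t. - ?k t \<partial>lborel)"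
      by (intro Bochner_Integration.integral_cong) (auto simp: indicator_def)
    finally have k0: "(\<integral>t. ?k t \<partial>lborel) = 0" by simp
    have "indicator {t. \<epsilon> \<le> \<bar>t\<bar>} t *\<^sub>R (\<phi> t / of_real t) = ?q t + \<phi> 0 * ?k t" for t
      using supp[of t] by (cases "t \<in> {-R..R}") (auto simp: indicator_def diff_divide_distrib)
    then have "(\<integral>t. indicator {t. \<epsilon> \<le> \<bar>t\<bar>} t *\<^sub>R (\<phi> t / of_real t) \<partial>lborel) = (\<integral>t. ?q t + \<phi> 0 * ?k t \<partial>lborel)"
      by presburger
    also have "\<dots> = (\<integral>t. ?q t \<partial>lborel) + (\<integral>t. \<phi> 0 * ?k t \<partial>lborel)"
      by (intro Bochner_Integration.integral_add q integrable_mult_right k)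
    also have "(\<integral>t. \<phi> 0 * ?k t \<partial>lborel) = 0"
      using integral_mult_right_zero[of lborel "\<phi> 0" ?k] k0 by simp
    finally show ?thesis by simp
  qed
  have lim: "(\<lambda>n. \<integral>t. cut (X n) t \<partial>lborel) \<longlonglongrightarrow> J"
    if X: "X \<longlonglongrightarrow> 0" for X
    unfolding J_def
  proof (rule integral_dominated_convergence[where w = "\<lambda>t. indicator {-R..R} t * C"])
    show "integrable lborel (\<lambda>t. indicator {-R..R} t * C)" by (rule integrable_window)
    have nz: "AE t in lborel. t \<noteq> (0::real)" by (rule AE_lborel_singleton)
    then show "AE t in lborel. (\<lambda>n. cut (X n) t)
       \<longlonglongrightarrow> quot t"
    proof eventually_elim
      case (elim t)
      have "\<forall>\<^sub>F n in sequentially. X n < \<bar>t\<bar>" using X elim by (intro order_tendstoD) auto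
      then show ?case
        by (intro tendsto_eventually) (auto elim!: eventually_mono simp: indicator_def)
    qed
    show "AE t in lborel. norm (cut (X n) t) \<le> indicator {-R..R} t * C" for n
      using quotient_bound C_nonneg by (intro AE_I2) (auto simp: indicator_def)
    have "{t::real. X n \<le> \<bar>t\<bar>} \<in> sets borel" for n by measurable
    then show "(\<lambda>t. cut (X n) t) \<in> borel_measurable lborel" for n
      by measurable
  qed measurable
  have "((\<lambda>\<epsilon>. \<integral>t. cut \<epsilon> t \<partial>lborel) \<longlongrightarrow> J) (at_right 0)"
    by (rule tendsto_at_right_sequentially[of _ 1]) (use lim in auto)
  then show ?thesis
    by (rule Lim_transform_eventually) (auto simp: eventually_at_filter eq)
qed

end

subsection \<open>Resolvents\<close>

text \<open>Boundedness instead of square integrability: the class is closed under products and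
  conjugation, contains the resolvent kernels off the real axis, and over a bounded open
  \<open>G\<close> its members are integrable.\<close>

definition bdd_borel_on :: "'a::euclidean_space set \<Rightarrow> ('a \<Rightarrow> complex) \<Rightarrow> bool" where
  "bdd_borel_on G f \<longleftrightarrow> set_borel_measurable lborel G f \<and> (\<exists>M. \<forall>y\<in>G. norm (f y) \<le> M)"

lemma bdd_borel_on_mult:
  assumes "bdd_borel_on G f" "bdd_borel_on G g"
  shows "bdd_borel_on G (\<lambda>y. f y * g y)"
proof -
  obtain M N where M: "\<And>y. y \<in> G \<Longrightarrow> norm (f y) \<le> M" and N: "\<And>y. y \<in> G \<Longrightarrow> norm (g y) \<le> N"
    and m: "set_borel_measurable lborel G f" "set_borel_measurable lborel G g"
    using assms unfolding bdd_borel_on_def by blast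
  have "(\<lambda>y. (indicator G y *\<^sub>R f y) * (indicator G y *\<^sub>R g y)) \<in> borel_measurable lborel"
    using m unfolding set_borel_measurable_def by (rule borel_measurable_times)
  moreover have "(\<lambda>y. (indicator G y *\<^sub>R f y) * (indicator G y *\<^sub>R g y)) = (\<lambda>y. indicator G y *\<^sub>R (f y * g y))"
    by (auto simp: fun_eq_iff indicator_def)
  moreover have "norm (f y * g y) \<le> \<bar>M\<bar> * \<bar>N\<bar>" if "y \<in> G" for y
    unfolding norm_mult using M[OF that] N[OF that] by (intro mult_mono) auto
  ultimately show ?thesis
    unfolding bdd_borel_on_def set_borel_measurable_def by auto
qed

lemma bdd_borel_on_add:
  assumes "bdd_borel_on G f" "bdd_borel_on G g"
  shows "bdd_borel_on G (\<lambda>y. f y + g y)"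
proof -
  obtain M N where M: "\<And>y. y \<in> G \<Longrightarrow> norm (f y) \<le> M" and N: "\<And>y. y \<in> G \<Longrightarrow> norm (g y) \<le> N"
    and m: "set_borel_measurable lborel G f" "set_borel_measurable lborel G g"
    using assms unfolding bdd_borel_on_def by blast
  have "(\<lambda>y. (indicator G y *\<^sub>R f y) + (indicator G y *\<^sub>R g y)) \<in> borel_measurable lborel"
    using m unfolding set_borel_measurable_def by (rule borel_measurable_add)
  moreover have "norm (f y + g y) \<le> M + N" if "y \<in> G" for y
    using norm_triangle_ineq[of "f y" "g y"] M[OF that] N[OF that] by linarith
  ultimately show ?thesis
    unfolding bdd_borel_on_def set_borel_measurable_def scaleR_add_right by blast
qed

lemma borel_measurable_cnj:
  "f \<in> borel_measurable M \<Longrightarrow> (\<lambda>x. cnj (f x)) \<in> borel_measurable M"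
  by (rule borel_measurable_continuous_on[OF continuous_on_cnj[OF continuous_on_id]])

lemma bdd_borel_on_cnj:
  assumes "bdd_borel_on G f"
  shows "bdd_borel_on G (\<lambda>y. cnj (f y))"
proof -
  have "(\<lambda>y. cnj (indicator G y *\<^sub>R f y)) \<in> borel_measurable lborel"
    using assms unfolding bdd_borel_on_def set_borel_measurable_def
    by (intro borel_measurable_cnj) auto
  then show ?thesis
    using assms unfolding bdd_borel_on_def set_borel_measurable_def by simp
qed

lemma bdd_borel_on_const: "G \<in> sets borel \<Longrightarrow> bdd_borel_on G (\<lambda>y. c)"
  unfolding bdd_borel_on_def set_borel_measurable_def by auto

context
  fixes G :: "'a::euclidean_space set" and P :: "'a \<Rightarrow> real"
  assumes G: "open G" "bounded G" and P: "continuous_on G P"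
begin

lemma G_borel: "G \<in> sets borel" using G by simp

lemma set_integrable_bounded:
  assumes "bdd_borel_on G f"
  shows "set_integrable lborel G f"
proof -
  obtain M where M: "\<And>y. y \<in> G \<Longrightarrow> norm (f y) \<le> M" and m: "set_borel_measurable lborel G f"
    using assms unfolding bdd_borel_on_def by blast
  show ?thesis
    unfolding set_integrable_def
  proof (rule Bochner_Integration.integrable_bound[of _ "\<lambda>y. indicator G y * M"])
    show "integrable lborel (\<lambda>y. indicator G y * M)"
      using G_borel emeasure_bounded_finite[OF G(2)] by (intro integrable_mult_left integrable_real_indicator) auto
    show "AE y in lborel. norm (indicator G y *\<^sub>R f y) \<le> norm (indicator G y * M)"
      using M by (intro AE_I2) (auto simp: indicator_def intro: order_trans[OF _ abs_ge_self])
    show "(\<lambda>y. indicator G y *\<^sub>R f y) \<in> borel_measurable lborel"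
      using m by (simp add: set_borel_measurable_def)
  qed
qed

lemma bounded_measurable_square_integrable:
  assumes "bdd_borel_on G f"
  shows "f \<in> square_integrable G"
proof -
  have "set_integrable lborel G (\<lambda>y. Re (f y * cnj (f y)))"
    using set_integrable_bounded[OF bdd_borel_on_mult[OF assms bdd_borel_on_cnj[OF assms]]]
    unfolding set_integrable_def by (auto dest: integrable_Re)
  moreover have "Re (f y * cnj (f y)) = (cmod (f y))\<^sup>2" for y
    by (simp add: complex_norm_square[symmetric] flip: of_real_power)
  ultimately show ?thesis
    using assms by (simp add: square_integrable_def bdd_borel_on_def)
qed

lemma kernel_bounded_measurable:
  assumes z: "Im z \<noteq> 0"
  shows "bdd_borel_on G (\<lambda>y. 1 / (z - of_real (P y)))"
proof -
  have nz: "z - of_real t \<noteq> 0" for t using z by (auto simp: complex_eq_iff)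
  have "continuous_on G (\<lambda>y. 1 / (z - of_real (P y)))"
    using nz by (intro continuous_intros P) auto
  then have "(\<lambda>y. indicator G y *\<^sub>R (1 / (z - of_real (P y)))) \<in> borel_measurable borel"
    by (intro borel_measurable_continuous_on_indicator G_borel)
  moreover have "norm (1 / (z - of_real (P y))) \<le> 1 / \<bar>Im z\<bar>" for y
  proof -
    have "\<bar>Im z\<bar> \<le> norm (z - of_real (P y))" using abs_Im_le_cmod[of "z - of_real (P y)"] by simp
    then show ?thesis using z unfolding norm_divide by (intro frac_le) auto
  qed
  ultimately show ?thesis
    unfolding bdd_borel_on_def set_borel_measurable_def by auto
qed

lemma mult_resolvent_bounded_measurable:
  "Im z \<noteq> 0 \<Longrightarrow> bdd_borel_on G f \<Longrightarrow> bdd_borel_on G (mult_resolvent P z f)"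
  unfolding mult_resolvent_def by (intro bdd_borel_on_mult kernel_bounded_measurable)

lemma braket_add_scale:
  assumes a: "bdd_borel_on G a" and v: "bdd_borel_on G v" and w: "bdd_borel_on G w"
  shows "braket G a (\<lambda>y. v y + c * w y) = braket G a v + c * braket G a w"
proof -
  have i: "set_integrable lborel G (\<lambda>y. cnj (a y) * v y)" "set_integrable lborel G (\<lambda>y. cnj (a y) * w y)"
    using a v w by (auto intro!: set_integrable_bounded bdd_borel_on_mult bdd_borel_on_cnj)
  have "braket G a (\<lambda>y. v y + c * w y) = (LINT y:G|lborel. cnj (a y) * v y + c * (cnj (a y) * w y))"
    unfolding braket_def by (simp add: algebra_simps)
  also have "\<dots> = (LINT y:G|lborel. cnj (a y) * v y) + (LINT y:G|lborel. c * (cnj (a y) * w y))"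
    using i by (intro set_integral_add) auto
  finally show ?thesis by (simp add: braket_def)
qed

text \<open>\<open>resolvent\<close> is a choice, so a solution is exhibited first. Any solution
  \<open>u\<close> is almost everywhere the free resolvent of f plus k times that of g, where k =
  <h|u> is still unknown; pairing with \<open>h\<close> determines k, since C(z) is nonzero.\<close>

lemma braket_resolvent:
  assumes bm: "bdd_borel_on G a" "bdd_borel_on G f" "bdd_borel_on G g" "bdd_borel_on G h"
    and z: "Im z \<noteq> 0" and C: "C_fun G P g h z \<noteq> 0"
  shows "braket G a (resolvent G (perturbed_op G P g h) z f)
    = braket G a (mult_resolvent P z f)
      + braket G a (mult_resolvent P z g) * braket G h (mult_resolvent P z f) / C_fun G P g h z"
proof -
  let ?Rf = "mult_resolvent P z f" and ?Rg = "mult_resolvent P z g"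
  define Cz where "Cz = C_fun G P g h z"
  have Cz: "Cz \<noteq> 0" "braket G h ?Rg = 1 - Cz" using C by (auto simp: Cz_def C_fun_def)
  have R: "bdd_borel_on G ?Rf" "bdd_borel_on G ?Rg"
    using bm z by (auto intro: mult_resolvent_bounded_measurable)
  have nz: "z - of_real t \<noteq> 0" for t using z by (auto simp: complex_eq_iff)
  define sol where "sol u \<longleftrightarrow> u \<in> square_integrable G \<and>
    (AE y in lborel. y \<in> G \<longrightarrow> z * u y - perturbed_op G P g h u y = f y)" for u
  have "sol (\<lambda>y. ?Rf y + (braket G h ?Rf / Cz) * ?Rg y)"
    unfolding sol_def
  proof (intro conjI AE_I2 impI)
    let ?k = "braket G h ?Rf / Cz"
    show "(\<lambda>y. ?Rf y + ?k * ?Rg y) \<in> square_integrable G"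
      by (intro bounded_measurable_square_integrable bdd_borel_on_add bdd_borel_on_mult
            bdd_borel_on_const R G_borel)
    fix y
    have k: "?k * Cz = braket G h ?Rf" using Cz by simp
    have *: "(z - of_real (P y)) * ?Rf y = f y" "(z - of_real (P y)) * ?Rg y = g y"
      using nz[of "P y"] by (simp_all add: mult_resolvent_def)
    have "z * (?Rf y + ?k * ?Rg y) - perturbed_op G P g h (\<lambda>y. ?Rf y + ?k * ?Rg y) y
      = (z - of_real (P y)) * ?Rf y + ?k * ((z - of_real (P y)) * ?Rg y)
        - g y * (braket G h ?Rf + ?k * (1 - Cz))"
      unfolding perturbed_op_def mult_op_def braket_add_scale[OF bm(4) R] Cz(2) by (simp add: algebra_simps)
    also have "\<dots> = f y + g y * (?k * Cz - braket G h ?Rf)"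
      unfolding * by (simp only: algebra_simps mult_1_left)
    also have "\<dots> = f y" unfolding k by simp
    finally show "z * (?Rf y + ?k * ?Rg y) - perturbed_op G P g h (\<lambda>y. ?Rf y + ?k * ?Rg y) y = f y" .
  qed
  then have "\<exists>u. sol u" by (rule exI[of sol])
  then have "sol (SOME u. sol u)" by (rule someI_ex)
  moreover have "resolvent G (perturbed_op G P g h) z f = (SOME u. sol u)"
    unfolding resolvent_def sol_def ..
  ultimately have res: "sol (resolvent G (perturbed_op G P g h) z f)" by (simp only:)
  define u where "u = resolvent G (perturbed_op G P g h) z f"
  have u: "u \<in> square_integrable G"
    "AE y in lborel. y \<in> G \<longrightarrow> z * u y - perturbed_op G P g h u y = f y"
    using res unfolding sol_def u_def by blast+
  define k where "k = braket G h u"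
  have AE: "AE y in lborel. y \<in> G \<longrightarrow> u y = ?Rf y + k * ?Rg y"
    using u(2)
  proof eventually_elim
    case (elim y)
    show ?case
    proof
      assume "y \<in> G"
      then have "(z - of_real (P y)) * u y = f y + k * g y"
        using elim by (simp add: perturbed_op_def mult_op_def k_def algebra_simps)
      then have "u y = (f y + k * g y) / (z - of_real (P y))"
        using nz[of "P y"] by (simp add: field_simps)
      then show "u y = ?Rf y + k * ?Rg y"
        by (simp add: mult_resolvent_def add_divide_distrib)
    qed
  qed
  have eq: "braket G c u = braket G c ?Rf + k * braket G c ?Rg" if c: "bdd_borel_on G c" for c
  proof -
    have "set_borel_measurable lborel G u" using u(1) by (simp add: square_integrable_def)
    moreover have "(\<lambda>y. cnj (indicator G y *\<^sub>R c y)) \<in> borel_measurable lborel"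
      using c unfolding bdd_borel_on_def set_borel_measurable_def
      by (intro borel_measurable_cnj) auto
    ultimately have "(\<lambda>y. cnj (indicator G y *\<^sub>R c y) * (indicator G y *\<^sub>R u y)) \<in> borel_measurable lborel"
      unfolding set_borel_measurable_def by (intro borel_measurable_times)
    moreover have "(\<lambda>y. cnj (indicator G y *\<^sub>R c y) * (indicator G y *\<^sub>R u y)) = (\<lambda>y. indicator G y *\<^sub>R (cnj (c y) * u y))"
      by (auto simp: fun_eq_iff indicator_def)
    ultimately have m1: "set_borel_measurable lborel G (\<lambda>y. cnj (c y) * u y)"
      by (simp add: set_borel_measurable_def)
    have "bdd_borel_on G (\<lambda>y. cnj (c y) * (?Rf y + k * ?Rg y))"
      by (intro bdd_borel_on_add bdd_borel_on_mult bdd_borel_on_cnj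
            bdd_borel_on_const R G_borel c)
    then have m2: "set_borel_measurable lborel G (\<lambda>y. cnj (c y) * (?Rf y + k * ?Rg y))"
      by (simp add: bdd_borel_on_def)
    have "braket G c u = braket G c (\<lambda>y. ?Rf y + k * ?Rg y)"
      unfolding braket_def set_lebesgue_integral_def
    proof (rule integral_cong_AE)
      show "AE y in lborel. indicator G y *\<^sub>R (cnj (c y) * u y) = indicator G y *\<^sub>R (cnj (c y) * (?Rf y + k * ?Rg y))"
        using AE by eventually_elim (auto simp: indicator_def)
    qed (use m1 m2 in \<open>auto simp: set_borel_measurable_def\<close>)
    then show ?thesis using braket_add_scale[OF c R] by simp
  qed
  \<comment> \<open>Self-consistency: \<open>k\<close> was defined from \<open>u\<close>
    itself.\<close>
  have "k = braket G h ?Rf + k * (1 - Cz)" using eq[OF bm(4)] Cz(2) by (simp add: k_def)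
  then have "k * Cz = braket G h ?Rf" by (simp add: algebra_simps)
  then have "k = braket G h ?Rf / Cz" using Cz(1) by (simp add: field_simps)
  then show ?thesis using eq[OF bm(1)] by (simp add: u_def Cz_def)
qed

end

subsection \<open>Boundary values\<close>

text \<open>The first derivatives are continuous, hence bounded on the compact support, and they
  vanish off it. The whole space is convex, so the Lipschitz bound is global.\<close>

lemma compact_support_Lipschitz:
  fixes f :: "'a::euclidean_space \<Rightarrow> 'b::real_normed_vector"
  assumes smooth: "smooth_on UNIV f" and K: "compact (closure {y. f y \<noteq> 0})"
  obtains C M where "\<And>y y'. norm (f y - f y') \<le> C * norm (y - y')" "\<And>y. norm (f y) \<le> M"
proof -
  define K where "K = closure {y. f y \<noteq> 0}"
  have diff: "f differentiable (at y)" for y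
    using smooth unfolding smooth_on_def by (metis UNIV_I lists.Nil mixed_deriv.simps(1))
  have diffD: "(\<lambda>y. frechet_derivative f (at y) c) differentiable (at y)" if "c \<in> Basis" for y c
  proof -
    have "[c] \<in> lists Basis" "mixed_deriv [c] f = (\<lambda>y. frechet_derivative f (at y) c)" using that by auto
    then show ?thesis using smooth unfolding smooth_on_def by (metis UNIV_I)
  qed
  have outside: "frechet_derivative f (at y) c = 0" if "y \<notin> K" for y c
  proof -
    have "open (- K)" by (simp add: K_def open_Compl)
    moreover have "f z = 0" if "z \<in> - K" for z
      using that closure_subset[of "{y. f y \<noteq> 0}"] by (auto simp: K_def)
    ultimately have "(f has_derivative (\<lambda>_. 0)) (at y)"
      using that by (intro has_derivative_transform_within_open[OF has_derivative_const[of 0]]) auto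
    then show ?thesis using frechet_derivative_at by metis
  qed
  have "\<exists>M. \<forall>y. norm (frechet_derivative f (at y) c) \<le> M" if "c \<in> Basis" for c
  proof -
    have "continuous_on K (\<lambda>y. frechet_derivative f (at y) c)"
      by (intro continuous_at_imp_continuous_on ballI differentiable_imp_continuous_within diffD that)
    then have "bounded ((\<lambda>y. frechet_derivative f (at y) c) ` K)"
      using K unfolding K_def by (intro compact_imp_bounded compact_continuous_image)
    then obtain M where M: "\<And>y. y \<in> K \<Longrightarrow> norm (frechet_derivative f (at y) c) \<le> M"
      by (auto simp: bounded_iff)
    have "norm (frechet_derivative f (at y) c) \<le> \<bar>M\<bar>" for y
      using M[of y] outside[of y] by (cases "y \<in> K") auto
    then show ?thesis by blast
  qed
  then obtain M where M: "\<And>c y. c \<in> Basis \<Longrightarrow> norm (frechet_derivative f (at y) c) \<le> M c" by metis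
  have M': "norm (frechet_derivative f (at y) c) \<le> (\<Sum>c\<in>Basis. \<bar>M c\<bar>)" if "c \<in> Basis" for c y
    using M[OF that] member_le_sum[of c Basis "\<lambda>c. \<bar>M c\<bar>"] that by (meson abs_ge_self abs_ge_zero finite_Basis order_trans)
  have Lip: "norm (f y - f y') \<le> (real DIM('a) * (\<Sum>c\<in>Basis. \<bar>M c\<bar>)) * norm (y - y')" for y y'
    by (rule partial_bound_imp_Lipschitz[of UNIV]) (use diff M' in auto)
  have "continuous_on K f"
    by (intro continuous_at_imp_continuous_on ballI differentiable_imp_continuous_within diff)
  then have "bounded (f ` K)"
    using K unfolding K_def by (intro compact_imp_bounded compact_continuous_image)
  then obtain N where N: "\<And>y. y \<in> K \<Longrightarrow> norm (f y) \<le> N" by (auto simp: bounded_iff)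
  have "norm (f y) \<le> \<bar>N\<bar>" for y
  proof (cases "y \<in> K")
    case True then show ?thesis using N[of y] by simp
  next
    case False then have "f y = 0" using closure_subset[of "{y. f y \<noteq> 0}"] by (auto simp: K_def)
    then show ?thesis by simp
  qed
  with Lip show ?thesis by (rule that)
qed

lemma integral_lborel_reflect:
  fixes F :: "real \<Rightarrow> complex"
  shows "(\<integral>t. F t \<partial>lborel) = (\<integral>t. F (x - t) \<partial>lborel)"
  using lborel_integral_real_affine[of "-1" F x] by simp

text \<open>The kernel depends on \<open>y\<close> through \<open>P y\<close> only, so the coarea
  formula turns the resolvent integral into a Cauchy integral of \<open>\<phi>\<close>; reflection
  at \<open>x\<close> brings the pole to 0.\<close>

lemma (in level_atlas) boundary_values:
  fixes F :: "'a \<Rightarrow> complex" and x :: real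
  assumes K: "compact K" "K \<subseteq> G" and F0: "\<And>y. y \<notin> K \<Longrightarrow> F y = 0"
    and FL: "\<And>y y'. norm (F y - F y') \<le> C * norm (y - y')" and FM: "\<And>y. norm (F y) \<le> M"
  defines "\<phi> \<equiv> \<lambda>\<omega>. \<integral>y. F y \<partial>\<mu> \<omega>"
  defines "pv \<equiv> principal_value x \<phi>"
  shows "((\<lambda>u. \<integral>y. F y * (1 / (Complex x u - of_real (P y))) \<partial>lborel) \<longlongrightarrow> pv - \<i> * of_real pi * \<phi> x) (at_right 0)"
    and "((\<lambda>u. \<integral>y. F y * (1 / (Complex x u - of_real (P y))) \<partial>lborel) \<longlongrightarrow> pv + \<i> * of_real pi * \<phi> x) (at_left 0)"
proof -
  have "continuous_on UNIV F"
    using FL by (intro Lipschitz_imp_continuous_UNIV[of F C]) (simp add: dist_norm)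
  then have F [measurable]: "F \<in> borel_measurable borel" by (rule borel_measurable_continuous_onI)
  have "has_Lipschitz_density F"
    by (rule compact_support_coarea(2)[OF K F FM F0 exI[of _ C]]) (simp_all add: FL)
  then obtain L where L: "\<And>s t. norm (\<phi> s - \<phi> t) \<le> L * \<bar>s - t\<bar>"
    unfolding has_Lipschitz_density_def \<phi>_def by blast
  have "bounded (P ` K)"
    by (intro compact_imp_bounded compact_continuous_image continuous_on_subset[OF cont_P_G] K)
  then obtain B where B: "\<And>y. y \<in> K \<Longrightarrow> \<bar>P y\<bar> \<le> B" by (auto simp: bounded_iff)
  have \<phi>0: "\<phi> t = 0" if "\<bar>B\<bar> < \<bar>t\<bar>" for t
    unfolding \<phi>_def by (rule integral_\<mu>_eq_0[OF F0]) (use B that in fastforce)+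
  \<comment> \<open>For |t| at least R, the level x - t has modulus at least |B| + 1 and so is not
    attained on \<open>K\<close>; there \<open>\<phi>\<close> vanishes.\<close>
  define R where "R = \<bar>x\<bar> + \<bar>B\<bar> + 1"
  interpret Lipschitz_density "\<lambda>t. \<phi> (x - t)" L R
  proof
    show "norm (\<phi> (x - s) - \<phi> (x - t)) \<le> L * \<bar>s - t\<bar>" for s t
      using L[of "x - s" "x - t"] by (simp add: abs_minus_commute)
    show "\<phi> (x - t) = 0" if "R \<le> \<bar>t\<bar>" for t using that by (intro \<phi>0) (simp add: R_def)
    show "0 < R" by (simp add: R_def)
  qed
  have kernel: "(\<integral>y. F y * (1 / (Complex x u - of_real (P y))) \<partial>lborel) = (\<integral>t. \<phi> (x - t) / Complex t u \<partial>lborel)"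
    if u: "u \<noteq> 0" for u
  proof -
    define k where "k \<omega> = 1 / (Complex x u - complex_of_real \<omega>)" for \<omega>
    have k: "norm (k \<omega>) \<le> 1 / \<bar>u\<bar>" for \<omega>
    proof -
      have "\<bar>u\<bar> \<le> norm (Complex x u - of_real \<omega>)" using abs_Im_le_cmod[of "Complex x u - of_real \<omega>"] by simp
      then show ?thesis using u unfolding norm_divide k_def by (intro frac_le) auto
    qed
    have "continuous_on G (\<lambda>y. k (P y))"
      unfolding k_def using u by (intro continuous_intros cont_P_G) (auto simp: complex_eq_iff)
    then have "(\<lambda>y. indicator G y *\<^sub>R k (P y)) \<in> borel_measurable borel"
      using open_G by (intro borel_measurable_continuous_on_indicator) auto
    then have "(\<lambda>y. F y * (indicator G y *\<^sub>R k (P y))) \<in> borel_measurable borel" by measurable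
    moreover have "(\<lambda>y. F y * (indicator G y *\<^sub>R k (P y))) = (\<lambda>y. F y * k (P y))"
      using F0 K(2) by (force simp: fun_eq_iff indicator_def)
    ultimately have m: "(\<lambda>y. F y * k (P y)) \<in> borel_measurable borel" by simp
    have "norm (F y * k (P y)) \<le> M * (1 / \<bar>u\<bar>)" for y
      unfolding norm_mult by (intro mult_mono FM k) (auto intro: order_trans[OF norm_ge_zero FM])
    then have "has_coarea (\<lambda>y. F y * k (P y))"
      by (rule compact_support_coarea(1)[OF K m]) (simp add: F0)
    then have "(\<integral>y. F y * k (P y) \<partial>lborel) = (\<integral>\<omega>. \<integral>y. F y * k (P y) \<partial>\<mu> \<omega> \<partial>lborel)"
      by (simp add: has_coarea_def)
    also have "\<dots> = (\<integral>\<omega>. \<phi> \<omega> * k \<omega> \<partial>lborel)"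
      unfolding integral_\<mu>_mult_P \<phi>_def ..
    also have "\<dots> = (\<integral>t. \<phi> (x - t) * k (x - t) \<partial>lborel)"
      by (rule integral_lborel_reflect)
    also have "\<dots> = (\<integral>t. \<phi> (x - t) / Complex t u \<partial>lborel)"
    proof -
      have "k (x - t) = 1 / Complex t u" for t
      proof -
        have "Complex x u - complex_of_real (x - t) = Complex t u" by (simp add: complex_eq_iff)
        then show ?thesis by (simp add: k_def)
      qed
      then show ?thesis by simp
    qed
    finally show ?thesis unfolding k_def .
  qed
  have pv: "pv = J"
    unfolding pv_def principal_value_def
  proof (rule tendsto_Lim)
    have "(LINT \<omega>:{\<omega>. \<epsilon> \<le> \<bar>x - \<omega>\<bar>}|lborel. \<phi> \<omega> / of_real (x - \<omega>))
       = (\<integral>t. indicator {t. \<epsilon> \<le> \<bar>t\<bar>} t *\<^sub>R (\<phi> (x - t) / of_real t) \<partial>lborel)" for \<epsilon>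
    proof -
      have "(LINT \<omega>:{\<omega>. \<epsilon> \<le> \<bar>x - \<omega>\<bar>}|lborel. \<phi> \<omega> / of_real (x - \<omega>))
        = (\<integral>t. indicator {\<omega>. \<epsilon> \<le> \<bar>x - \<omega>\<bar>} (x - t) *\<^sub>R (\<phi> (x - t) / of_real (x - (x - t))) \<partial>lborel)"
        unfolding set_lebesgue_integral_def by (rule integral_lborel_reflect)
      then show ?thesis by (simp add: indicator_def)
    qed
    then show "((\<lambda>\<epsilon>. LINT \<omega>:{\<omega>. \<epsilon> \<le> \<bar>x - \<omega>\<bar>}|lborel. \<phi> \<omega> / of_real (x - \<omega>)) \<longlongrightarrow> J) (at_right 0)"
      using truncated_limit by simp
  qed simp
  have ev: "\<forall>\<^sub>F u in at_right 0. u \<noteq> (0::real)" "\<forall>\<^sub>F u in at_left 0. u \<noteq> (0::real)"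
    by (auto simp: eventually_at_filter)
  show "((\<lambda>u. \<integral>y. F y * (1 / (Complex x u - of_real (P y))) \<partial>lborel) \<longlongrightarrow> pv - \<i> * of_real pi * \<phi> x) (at_right 0)"
    using Lim_transform_eventually[OF Plemelj(1) eventually_mono[OF ev(1) kernel[symmetric]]]
    by (simp add: pv)
  show "((\<lambda>u. \<integral>y. F y * (1 / (Complex x u - of_real (P y))) \<partial>lborel) \<longlongrightarrow> pv + \<i> * of_real pi * \<phi> x) (at_left 0)"
    using Lim_transform_eventually[OF Plemelj(2) eventually_mono[OF ev(2) kernel[symmetric]]]
    by (simp add: pv)
qed

lemma braket_boundary_values:
  fixes P :: "'a::euclidean_space \<Rightarrow> real" and x :: real
  assumes G: "open G" and P_smooth: "smooth_on G P"
    and P_bounded: "\<And>bs. bs \<in> lists Basis \<Longrightarrow> bounded (mixed_deriv bs P ` G)"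
    and P_grad: "\<And>y. y \<in> G \<Longrightarrow> grad P y \<noteq> 0"
    and f: "f1 \<in> test_functions G" "f2 \<in> test_functions G"
  shows "((\<lambda>u. braket G f1 (mult_resolvent P (Complex x u) f2))
      \<longlongrightarrow> pv_form G P x f1 f2 - \<i> * of_real pi * delta_form G P x f1 f2) (at_right 0)"
    and "((\<lambda>u. braket G f1 (mult_resolvent P (Complex x u) f2))
      \<longlongrightarrow> pv_form G P x f1 f2 + \<i> * of_real pi * delta_form G P x f1 f2) (at_left 0)"
proof -
  obtain W bs es ms Ls where "level_atlas G P (grad P) W bs es ms Ls"
    using ex_level_atlas[OF G P_smooth P_bounded P_grad] by blast
  then interpret level_atlas G P "grad P" W bs es ms Ls .
  obtain C1 M1 where f1: "\<And>y y'. norm (f1 y - f1 y') \<le> C1 * norm (y - y')" "\<And>y. norm (f1 y) \<le> M1"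
    using f(1) compact_support_Lipschitz[of f1] unfolding test_functions_def by blast
  obtain C2 M2 where f2: "\<And>y y'. norm (f2 y - f2 y') \<le> C2 * norm (y - y')" "\<And>y. norm (f2 y) \<le> M2"
    using f(2) compact_support_Lipschitz[of f2] unfolding test_functions_def by blast
  have M: "0 \<le> M1" "0 \<le> M2"
    using order_trans[OF norm_ge_zero f1(2)] order_trans[OF norm_ge_zero f2(2)] by auto
  define K where "K = closure {y. f1 y \<noteq> 0}"
  define F where "F y = cnj (f1 y) * f2 y" for y
  have K: "compact K" "K \<subseteq> G" using f(1) by (auto simp: K_def test_functions_def)
  have F0: "F y = 0" if "y \<notin> K" for y
    using that closure_subset[of "{y. f1 y \<noteq> 0}"] by (auto simp: K_def F_def)
  have FM: "norm (F y) \<le> M1 * M2" for y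
    unfolding F_def norm_mult complex_mod_cnj by (intro mult_mono f1 f2 M) auto
  have FL: "norm (F y - F y') \<le> (C1 * M2 + M1 * C2) * norm (y - y')" for y y'
  proof -
    have "F y - F y' = cnj (f1 y - f1 y') * f2 y + cnj (f1 y') * (f2 y - f2 y')"
      by (simp add: F_def algebra_simps)
    then have "norm (F y - F y') \<le> norm (f1 y - f1 y') * norm (f2 y) + norm (f1 y') * norm (f2 y - f2 y')"
      using norm_triangle_ineq[of "cnj (f1 y - f1 y') * f2 y" "cnj (f1 y') * (f2 y - f2 y')"]
      by (simp only: norm_mult complex_mod_cnj)
    also have "\<dots> \<le> (C1 * norm (y - y')) * M2 + M1 * (C2 * norm (y - y'))"
      by (intro add_mono mult_mono f1 f2 M) (auto intro: order_trans[OF norm_ge_zero f1(1)])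
    finally show ?thesis by (simp add: algebra_simps)
  qed
  have eq: "braket G f1 (mult_resolvent P (Complex x u) f2) = (\<integral>y. F y * (1 / (Complex x u - of_real (P y))) \<partial>lborel)" for u
  proof -
    have "indicator G y *\<^sub>R (cnj (f1 y) * mult_resolvent P (Complex x u) f2 y) = F y * (1 / (Complex x u - of_real (P y)))" for y
    proof (cases "y \<in> G")
      case True then show ?thesis by (simp add: F_def mult_resolvent_def)
    next
      case False then have "F y = 0" using F0 K(2) by blast
      then show ?thesis using False by simp
    qed
    then show ?thesis unfolding braket_def set_lebesgue_integral_def by presburger
  qed
  have forms: "delta_form G P x f1 f2 = (\<integral>y. F y \<partial>\<mu> x)"
    "pv_form G P x f1 f2 = principal_value x (\<lambda>\<omega>. \<integral>y. F y \<partial>\<mu> \<omega>)"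
    by (simp_all add: delta_form_def pv_form_def F_def)
  show "((\<lambda>u. braket G f1 (mult_resolvent P (Complex x u) f2))
      \<longlongrightarrow> pv_form G P x f1 f2 - \<i> * of_real pi * delta_form G P x f1 f2) (at_right 0)"
    unfolding eq forms by (rule boundary_values(1)[OF K F0 FL FM])
  show "((\<lambda>u. braket G f1 (mult_resolvent P (Complex x u) f2))
      \<longlongrightarrow> pv_form G P x f1 f2 + \<i> * of_real pi * delta_form G P x f1 f2) (at_left 0)"
    unfolding eq forms by (rule boundary_values(2)[OF K F0 FL FM])
qed

lemma test_function_bounded_measurable:
  assumes "f \<in> test_functions G" "open G"
  shows "bdd_borel_on G f"
proof -
  obtain C M where f: "\<And>y y'. norm (f y - f y') \<le> C * norm (y - y')" "\<And>y. norm (f y) \<le> M"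
    using assms(1) compact_support_Lipschitz[of f] unfolding test_functions_def by blast
  have "continuous_on UNIV f"
    using f(1) by (intro Lipschitz_imp_continuous_UNIV[of f C]) (simp add: dist_norm)
  then have "continuous_on G f" by (rule continuous_on_subset) simp
  then have "(\<lambda>y. indicator G y *\<^sub>R f y) \<in> borel_measurable borel"
    using assms(2) by (intro borel_measurable_continuous_on_indicator) auto
  then show ?thesis
    using f(2) by (auto simp: bdd_borel_on_def set_borel_measurable_def)
qed

section \<open>Algebra of the jump\<close>

text \<open>To be used with w = i\<pi>. Over the common denominator the numerator is odd in
  \<open>w\<close>, so it contains a factor 2w, which cancels the prefactor.\<close>

lemma jump_identity:
  fixes w :: complex
  assumes w: "w \<noteq> 0" and nz: "c1 - w * c2 \<noteq> 0" "c1 + w * c2 \<noteq> 0"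
  shows "1 / (2 * w) * ((a + w * d + (A + w * B) * (A' + w * B') / (c1 - w * c2))
      - (a - w * d + (A - w * B) * (A' - w * B') / (c1 + w * c2)))
    = d + 1 / (c1\<^sup>2 - w\<^sup>2 * c2\<^sup>2) * (A * c2 * A' + A * c1 * B' + B * c1 * A' + w\<^sup>2 * (B * c2 * B'))"
proof -
  define p m where "p = c1 + w * c2" and "m = c1 - w * c2"
  have pm: "p \<noteq> 0" "m \<noteq> 0" "c1\<^sup>2 - w\<^sup>2 * c2\<^sup>2 = p * m"
    using nz by (auto simp: p_def m_def power2_eq_square algebra_simps)
  have num: "(A + w * B) * (A' + w * B') * p - (A - w * B) * (A' - w * B') * m
     = 2 * w * (A * c2 * A' + A * c1 * B' + B * c1 * A' + w\<^sup>2 * (B * c2 * B'))"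
    unfolding p_def m_def by algebra
  have "(a + w * d + (A + w * B) * (A' + w * B') / m) - (a - w * d + (A - w * B) * (A' - w * B') / p)
     = 2 * w * d + ((A + w * B) * (A' + w * B') * p - (A - w * B) * (A' - w * B') * m) / (p * m)"
    using pm by (simp add: field_simps)
  also have "\<dots> = 2 * w * (d + 1 / (p * m) * (A * c2 * A' + A * c1 * B' + B * c1 * A' + w\<^sup>2 * (B * c2 * B')))"
    unfolding num by (simp only: distrib_left add_divide_distrib times_divide_eq_right mult_1_left times_divide_eq_left)
  finally show ?thesis
    using w unfolding pm(3) p_def[symmetric] m_def[symmetric] by simp
qed

text \<open>Here \<open>s\<close> stands for \<pi>^2. Expanding (c1 B + c2 A)(c1 B' + c2 A') and
  replacing c1^2 by D - s c2^2 separates the term D B B'; what remains is divisible by c2.\<close>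

lemma rank_one_split:
  fixes D :: complex
  assumes D: "D = c1\<^sup>2 + s * c2\<^sup>2" "D \<noteq> 0" and c2: "c2 \<noteq> 0"
  shows "1 / D * (A * c2 * A' + A * c1 * B' + B * c1 * A' - s * (B * c2 * B'))
    = - (B * B' / c2) + (c1 * B + A * c2) * (c1 * B' + A' * c2) / (D * c2)"
proof -
  have "(A * c2 * A' + A * c1 * B' + B * c1 * A' - s * (B * c2 * B')) * c2
     = - (B * B') * D + (c1 * B + A * c2) * (c1 * B' + A' * c2)"
    unfolding D(1) by algebra
  then have "(A * c2 * A' + A * c1 * B' + B * c1 * A' - s * (B * c2 * B'))
     = (- (B * B') * D + (c1 * B + A * c2) * (c1 * B' + A' * c2)) / c2"
    using c2 by (simp add: field_simps)
  then show ?thesis using D(2) c2 by (simp add: divide_simps)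
qed

section \<open>The jump of the perturbed resolvent\<close>

theorem proposition6:
  fixes G K :: "'a::euclidean_space set"
    and P :: "'a \<Rightarrow> real"
    and g h :: "'a \<Rightarrow> complex"
    and G\<^sub>1 I :: "real set"
    and G\<^sub>0 :: "complex set"
    and C\<^sub>p C\<^sub>m :: "real \<Rightarrow> complex"
    and x :: real
  assumes G: "open G" "bounded G"
    and P_smooth: "smooth_on G P"
    and P_bounded: "\<And>bs. bs \<in> lists Basis \<Longrightarrow> bounded (mixed_deriv bs P ` G)"
    and P_grad: "\<And>y. y \<in> G \<Longrightarrow> grad P y \<noteq> 0"
    and gh: "g \<in> test_functions G" "h \<in> test_functions G"
    and K: "compact K" "K \<subseteq> G" "closure {y. g y \<noteq> 0} \<subseteq> K" "closure {y. h y \<noteq> 0} \<subseteq> K"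
    and G1: "open G\<^sub>1" "P ` K \<subseteq> G\<^sub>1"
    and I: "open I" "is_interval I" "0 \<in> I"
    and G0: "G\<^sub>0 = {Complex t u | t u. t \<in> G\<^sub>1 \<and> u \<in> I}"
    and C_hol: "C_fun G P g h holomorphic_on G\<^sub>0 - complex_of_real ` P ` K"
    and C_nz: "\<And>z. z \<in> G\<^sub>0 - complex_of_real ` P ` K \<Longrightarrow> C_fun G P g h z \<noteq> 0"
    and C_plus: "\<And>t. complex_of_real t \<in> G\<^sub>0 \<Longrightarrow>
          ((\<lambda>u. C_fun G P g h (Complex t u)) \<longlongrightarrow> C\<^sub>p t) (at_right 0) \<and> C\<^sub>p t \<noteq> 0"
    and C_minus: "\<And>t. complex_of_real t \<in> G\<^sub>0 \<Longrightarrow>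
          ((\<lambda>u. C_fun G P g h (Complex t u)) \<longlongrightarrow> C\<^sub>m t) (at_left 0) \<and> C\<^sub>m t \<noteq> 0"
    and gh_real: "\<And>y. g y \<in> \<real>" "\<And>y. h y \<in> \<real>"
    and C_plus_norm: "\<And>t. complex_of_real t \<in> G\<^sub>0 \<Longrightarrow>
          (cmod (C\<^sub>p t))\<^sup>2 = (cmod (C1 G P g h t + \<i> * of_real pi * C2 G P g h t))\<^sup>2 \<and>
          of_real ((cmod (C1 G P g h t + \<i> * of_real pi * C2 G P g h t))\<^sup>2)
            = (C1 G P g h t)\<^sup>2 + of_real (pi\<^sup>2) * (C2 G P g h t)\<^sup>2"
    and C_minus_norm: "\<And>t. complex_of_real t \<in> G\<^sub>0 \<Longrightarrow>
          (cmod (C\<^sub>m t))\<^sup>2 = (cmod (C1 G P g h t - \<i> * of_real pi * C2 G P g h t))\<^sup>2 \<and>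
          of_real ((cmod (C1 G P g h t - \<i> * of_real pi * C2 G P g h t))\<^sup>2)
            = (C1 G P g h t)\<^sup>2 + of_real (pi\<^sup>2) * (C2 G P g h t)\<^sup>2"
    and C_norm_nz: "\<And>t. complex_of_real t \<in> G\<^sub>0 \<Longrightarrow>
          (C1 G P g h t)\<^sup>2 + of_real (pi\<^sup>2) * (C2 G P g h t)\<^sup>2 \<noteq> 0"
    and x: "x \<in> P ` K"
  shows "let c1 = C1 G P g h x; c2 = C2 G P g h x;
             D = c1\<^sup>2 + of_real (pi\<^sup>2) * c2\<^sup>2;
             A = (\<lambda>f. pv_form G P x f g); A' = (\<lambda>f. pv_form G P x h f);
             B = (\<lambda>f. delta_form G P x f g); B' = (\<lambda>f. delta_form G P x h f)
         in \<forall>f\<^sub>1\<in>test_functions G. \<forall>f\<^sub>2\<in>test_functions G.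
              kappa G P g h x f\<^sub>1 f\<^sub>2 =
                delta_form G P x f\<^sub>1 f\<^sub>2 +
                1 / D * (A f\<^sub>1 * c2 * A' f\<^sub>2 + A f\<^sub>1 * c1 * B' f\<^sub>2 + B f\<^sub>1 * c1 * A' f\<^sub>2
                         - of_real (pi\<^sup>2) * (B f\<^sub>1 * c2 * B' f\<^sub>2)) \<and>
              (c2 \<noteq> 0 \<longrightarrow>
                 kappa G P g h x f\<^sub>1 f\<^sub>2 =
                   delta_form G P x f\<^sub>1 f\<^sub>2 - B f\<^sub>1 * B' f\<^sub>2 / c2 +
                   (c1 * B f\<^sub>1 + A f\<^sub>1 * c2) * (c1 * B' f\<^sub>2 + A' f\<^sub>2 * c2) / (D * c2) \<and>
                 (\<forall>N. N\<^sup>2 = 1 / (D * c2) \<longrightarrow>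
                    kappa G P g h x f\<^sub>1 f\<^sub>2 =
                      p_form G P g h x f\<^sub>1 f\<^sub>2 +
                      alpha_ket G P g h x N f\<^sub>1 * alpha_bra G P g h x N f\<^sub>2))"
proof -
  define c1 where "c1 = C1 G P g h x"
  define c2 where "c2 = C2 G P g h x"
  define D where "D = c1\<^sup>2 + of_real (pi\<^sup>2) * c2\<^sup>2"
  define w where "w = \<i> * complex_of_real pi"
  have w: "w \<noteq> 0" "w\<^sup>2 = - of_real (pi\<^sup>2)" by (simp_all add: w_def power_mult_distrib)
  have x1: "x \<in> G\<^sub>1" using x G1(2) by blast
  have "complex_of_real x \<in> G\<^sub>0"
    unfolding G0 using x1 I(3) by (auto simp: complex_of_real_def)
  then have D_nz: "D \<noteq> 0" using C_norm_nz by (simp add: D_def c1_def c2_def)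
  have D_w: "D = c1\<^sup>2 - w\<^sup>2 * c2\<^sup>2" by (simp add: D_def w(2))
  \<comment> \<open>The factors turn out to be the limits of C(z) from below and from above, so a
    nonzero \<open>D\<close> keeps both denominators away from 0.\<close>
  have "D = (c1 - w * c2) * (c1 + w * c2)"
    unfolding D_w by (simp add: power2_eq_square algebra_simps)
  then have nz: "c1 - w * c2 \<noteq> 0" "c1 + w * c2 \<noteq> 0" using D_nz by auto
  have "P differentiable (at y)" if "y \<in> G" for y
    using P_smooth that unfolding smooth_on_def by (metis lists.Nil mixed_deriv.simps(1))
  then have cP: "continuous_on G P"
    by (intro continuous_at_imp_continuous_on ballI differentiable_imp_continuous_within)
  note bv = braket_boundary_values[OF G(1) P_smooth P_bounded P_grad]
  let ?d = "delta_form G P x" and ?p = "pv_form G P x" and ?k = "kappa G P g h x"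
  define r where "r f1 f2 u = braket G f1 (mult_resolvent P (Complex x u) f2)" for f1 f2 u
  have r_right: "(r f1 f2 \<longlongrightarrow> ?p f1 f2 - w * ?d f1 f2) (at_right 0)"
    and r_left: "(r f1 f2 \<longlongrightarrow> ?p f1 f2 + w * ?d f1 f2) (at_left 0)"
    if "f1 \<in> test_functions G" "f2 \<in> test_functions G" for f1 f2
    using bv(1)[OF _ _ that, of x] bv(2)[OF _ _ that, of x] unfolding r_def[abs_def] w_def by auto
  define Cz where "Cz u = C_fun G P g h (Complex x u)" for u
  have Cz: "Cz u = 1 - r h g u" for u by (simp add: Cz_def C_fun_def r_def)
  \<comment> \<open>C(z) is one minus a matrix element of the free resolvent, so its delta term has
    the opposite sign: plus from above, minus from below.\<close>
  have "((\<lambda>u. 1 - r h g u) \<longlongrightarrow> 1 - (?p h g - w * ?d h g)) (at_right 0)"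
    by (intro tendsto_intros r_right gh)
  then have Cz_right: "(Cz \<longlongrightarrow> c1 + w * c2) (at_right 0)"
    by (simp add: Cz[abs_def] c1_def c2_def C1_def C2_def algebra_simps)
  have "((\<lambda>u. 1 - r h g u) \<longlongrightarrow> 1 - (?p h g + w * ?d h g)) (at_left 0)"
    by (intro tendsto_intros r_left gh)
  then have Cz_left: "(Cz \<longlongrightarrow> c1 - w * c2) (at_left 0)"
    by (simp add: Cz[abs_def] c1_def c2_def C1_def C2_def algebra_simps)
  \<comment> \<open>\<open>I\<close> is a neighbourhood of 0, and for nonzero \<open>u\<close> in it
    the point x + iu lies in \<open>G\<^sub>0\<close> and is not real; so C is nonzero there and the
    resolvent formula applies.\<close>
  have ev: "\<forall>\<^sub>F u in at 0. u \<in> I \<and> u \<noteq> 0"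
    using eventually_at_in_open'[OF I(1,3)] by (auto simp: eventually_at_filter elim: eventually_mono)
  have ev_right: "\<forall>\<^sub>F u in at_right 0. u \<in> I \<and> u \<noteq> 0" and ev_left: "\<forall>\<^sub>F u in at_left 0. u \<in> I \<and> u \<noteq> 0"
    using ev by (simp_all add: eventually_at_split)
  have kappa: "?k f1 f2 = ?d f1 f2 +
      1 / D * (?p f1 g * c2 * ?p h f2 + ?p f1 g * c1 * ?d h f2
        + ?d f1 g * c1 * ?p h f2
        - of_real (pi\<^sup>2) * (?d f1 g * c2 * ?d h f2))"
    if f: "f1 \<in> test_functions G" "f2 \<in> test_functions G" for f1 f2
  proof -
    define R where "R u = braket G f1 (resolvent G (perturbed_op G P g h) (Complex x u) f2)" for u
    have R: "r f1 f2 u + r f1 g u * r h f2 u / Cz u = R u" if u: "u \<in> I \<and> u \<noteq> 0" for u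
    proof -
      have "Complex x u \<in> G\<^sub>0 - complex_of_real ` P ` K"
        using u x1 unfolding G0 by (auto simp: complex_eq_iff)
      then have "C_fun G P g h (Complex x u) \<noteq> 0" by (rule C_nz)
      moreover have "Im (Complex x u) \<noteq> 0" using u by simp
      ultimately show ?thesis
        unfolding R_def r_def Cz_def
        by (intro braket_resolvent[OF G cP, symmetric] test_function_bounded_measurable[OF _ G(1)] f gh)
    qed
    let ?lp = "?p f1 f2 - w * ?d f1 f2 +
      (?p f1 g - w * ?d f1 g) * (?p h f2 - w * ?d h f2) / (c1 + w * c2)"
    let ?lm = "?p f1 f2 + w * ?d f1 f2 +
      (?p f1 g + w * ?d f1 g) * (?p h f2 + w * ?d h f2) / (c1 - w * c2)"
    have "((\<lambda>u. r f1 f2 u + r f1 g u * r h f2 u / Cz u) \<longlongrightarrow> ?lp) (at_right 0)"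
      by (intro tendsto_intros r_right Cz_right f gh nz)
    then have "(R \<longlongrightarrow> ?lp) (at_right 0)"
      by (rule Lim_transform_eventually[OF _ eventually_mono[OF ev_right R]])
    then have lp: "Lim (at_right 0) R = ?lp" by (rule tendsto_Lim[rotated]) simp
    have "((\<lambda>u. r f1 f2 u + r f1 g u * r h f2 u / Cz u) \<longlongrightarrow> ?lm) (at_left 0)"
      by (intro tendsto_intros r_left Cz_left f gh nz)
    then have "(R \<longlongrightarrow> ?lm) (at_left 0)"
      by (rule Lim_transform_eventually[OF _ eventually_mono[OF ev_left R]])
    then have lm: "Lim (at_left 0) R = ?lm" by (rule tendsto_Lim[rotated]) simp
    \<comment> \<open>Below minus above, as in \<open>kappa\<close>; the prefactor 1/(2\<pi>i) is
      1/(2w).\<close>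
    have "?k f1 f2 = 1 / (2 * w) * (?lm - ?lp)"
      unfolding kappa_def R_def[symmetric] lp lm by (simp add: w_def mult_ac)
    also have "\<dots> = ?d f1 f2 + 1 / (c1\<^sup>2 - w\<^sup>2 * c2\<^sup>2) *
       (?p f1 g * c2 * ?p h f2 + ?p f1 g * c1 * ?d h f2
        + ?d f1 g * c1 * ?p h f2
        + w\<^sup>2 * (?d f1 g * c2 * ?d h f2))"
      by (rule jump_identity[OF w(1) nz])
    finally show ?thesis unfolding D_w[symmetric] unfolding w(2) by simp
  qed
  have split: "?k f1 f2 = ?d f1 f2 - ?d f1 g * ?d h f2 / c2
      + (c1 * ?d f1 g + ?p f1 g * c2)
        * (c1 * ?d h f2 + ?p h f2 * c2) / (D * c2)"
    if "f1 \<in> test_functions G" "f2 \<in> test_functions G" "c2 \<noteq> 0" for f1 f2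
    unfolding kappa[OF that(1,2)] rank_one_split[OF D_def D_nz that(3)] by simp
  have form: "?k f1 f2 = p_form G P g h x f1 f2 + alpha_ket G P g h x N f1 * alpha_bra G P g h x N f2"
    if "f1 \<in> test_functions G" "f2 \<in> test_functions G" "c2 \<noteq> 0" "N\<^sup>2 = 1 / (D * c2)" for f1 f2 N
  proof -
    \<comment> \<open>Only \<open>N\<^sup>2\<close> enters the product of ket and bra, so either
      square root serves.\<close>
    have "alpha_ket G P g h x N f1 * alpha_bra G P g h x N f2
      = N\<^sup>2 * ((c1 * ?d f1 g + ?p f1 g * c2)
        * (c1 * ?d h f2 + ?p h f2 * c2))"
      by (simp add: alpha_ket_def alpha_bra_def c1_def c2_def power2_eq_square mult_ac)
    then show ?thesis
      unfolding split[OF that(1-3)] that(4) by (simp add: p_form_def c2_def C2_def)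
  qed
  show ?thesis
    unfolding Let_def c1_def[symmetric] c2_def[symmetric] D_def[symmetric]
    using kappa split form by blast
qed

end
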